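(* On $\mathbf{W}$, we have \begin{gather*} A = \alpha+\beta\tau\mathcal{A}, \qquad A^* = \alpha^*+\beta^*\mathcal{A}^*, \qquad \widetilde{A}^* = \widetilde{\alpha}^*+\widetilde{\beta}^*\widetilde{\mathcal{A}}^*, \end{gather*} where $\alpha=\frac{q^e-1}{1-q}$, $\beta=\frac{q^{D+e}}{q-1}$, $\alpha^*=\widetilde{\alpha}^*=\frac{q(1+q^{D+e-2})}{1-q}$, $\beta^*=\frac{q(1+q^{D+e-2})(1+q^{D+e-1})}{(q-1)(1+q^{e-1})}$, $\widetilde{\beta}^*=\frac{1+q^{e-1}}{1+q^e}\beta^*$. Moreover, $\mathbf{W}$ is an irreducible $\overline{\mathcal{H}}$-module.
   Context: Let $\Gamma$ be a dual polar graph with diameter $D\geqslant 3$: its vertex set $X$ is the set of maximal isotropic subspaces of a finite-dimensional vector space over $\mathbb{F}_q$ with a non-degenerate (alternating, quadratic or Hermitian) form of Witt index $D$, two vertices being adjacent iff their intersection has dimension $D-1$; to the type of form is assigned a scalar $e\in\{0,\tfrac12,1,\tfrac32,2\}$. Let $A$ be the adjacency matrix, $\Gamma_i(x)$ the set of vertices at distance $i$ from $x$, and $E_i^*=\operatorname{diag}$ of the characteristic vector of $\Gamma_i(x)$. Fix a vertex $x$ and a maximal clique $C\ni x$; let $C_i$ ($0\leqslant i\leqslant D-1$) be the set of vertices at distance $i$ from $C$, $\widetilde{E}_i^*=\operatorname{diag}(\hat{C}_i)$, $C_i^-=\Gamma_i(x)\cap C_i$, $C_i^+=\Gamma_{i+1}(x)\cap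 C_i$. Let $A^*=\sum_{i=0}^D(\alpha^*+\beta^*q^{-i})E_i^*$ (dual adjacency matrix w.r.t. $x$) and $\widetilde{A}^*=\sum_{i=0}^{D-1}(\widetilde{\alpha}^*+\widetilde{\beta}^*q^{-i})\widetilde{E}_i^*$ (dual adjacency matrix w.r.t. $C$), with the scalars as in the claim. Let $\mathbf{W}\subset\mathbb{C}^X$ be the span of the characteristic vectors $\hat{C}_i^\pm$, with ordered basis $\mathcal{C}=(\hat{C}^-_0,\hat{C}^+_0,\dots,\hat{C}^-_{D-1},\hat{C}^+_{D-1})$. Let $\overline{\mathcal{H}}=\overline{\mathcal{H}}(\kappa,\kappa')$, $\kappa=q^{-e/2}$, $\kappa'=\sqrt{-1}q^{-D/2}$, be the nil-DAHA of type $(C_1^\vee,C_1)$: generated by $\mathcal{T}^{\pm1},\mathcal{U},\mathcal{X}^{\pm1}$ with relations $(\mathcal{T}-\kappa)(\mathcal{T}+\kappa^{-1})=0$, $(\mathcal{T}'-\kappa')(\mathcal{T}'+\kappa'^{-1})=0$, $\mathcal{U}(\mathcal{U}+1)=0$, $\mathcal{U}'^2=0$, where $\mathcal{T}'=\mathcal{X}\mathcal{T}^{-1}$, $\mathcal{U}'=\mathcal{X}^{-1}(\mathcal{U}+1)$. $\mathbf{W}$ is an $\overline{\mathcal{H}}$-module where, in basis $\mathcal{C}$: $\mathcal{T}$ acts by $\operatorname{blockdiag}(t(0),\dots,t(D-1))$ with $t(i)=\begin{pmatrix}q^{-e/2}-q^{e/2}&q^{e/2}\\ q^{-e/2}&0\end{pmatrix}$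 on $(\hat C_i^-,\hat C_i^+)$; $\mathcal{U}'$ acts by $\operatorname{blockdiag}(u'(0),\dots,u'(D-1))$ with $u'(i)=\begin{pmatrix}0&0\\ -\sqrt{-1}q^{(D-e)/2-i}&0\end{pmatrix}$ on $(\hat C_i^-,\hat C_i^+)$; $\mathcal{T}'$ acts by $\operatorname{blockdiag}(t'(0),\dots,t'(D))$ and $\mathcal{U}$ by $\operatorname{blockdiag}(u(0),\dots,u(D))$, where $t'(0)=t'(D)=(\sqrt{-1}q^{-D/2})$, $u(0)=(0)$, $u(D)=(-1)$ act on $\hat C_0^-$, resp. $\hat C_{D-1}^+$, and for $1\leqslant i\leqslant D-1$ the blocks $t'(i)=\sqrt{-1}\begin{pmatrix}q^{-D/2}(q^D-q^i+1)&q^{D/2}(q^{i-D}-1)\\ q^{-D/2}(1-q^i)&q^{i-D/2}\end{pmatrix}$, $u(i)=\begin{pmatrix}-1&1-q^{D-i}\\0&0\end{pmatrix}$ act on $(\hat C_{i-1}^+,\hat C_i^-)$; and $\mathcal{X}$ acts by the product of the matrices of $\mathcal{T}'$ and $\mathcal{T}$. Set $\tau=\sqrt{-1}q^{-(D+e)/2}$, $\mathcal{A}=\mathcal{X}+\mathcal{X}^{-1}$, $\mathcal{A}^*=\sqrt{-1}q^{-D/2}(\mathcal{T}\mathcal{U}'+\mathcal{U}\mathcal{T}')$, $\widetilde{\mathcal{A}}^*=\sqrt{-1}q^{-D/2}(\mathcal{T}\mathcal{U}'+q\,\mathcal{U}\mathcal{T}')$. *)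

theory Defs
  imports "HOL-Analysis.Analysis"
begin

definition is_bilin :: "(('k::field)^'n \<Rightarrow> 'k^'n \<Rightarrow> 'k) \<Rightarrow> bool" where
  "is_bilin f \<longleftrightarrow>
     (\<forall>x y z. f (x + y) z = f x z + f y z) \<and> (\<forall>c x z. f (c *s x) z = c * f x z) \<and>
     (\<forall>x y z. f x (y + z) = f x y + f x z) \<and> (\<forall>c x z. f x (c *s z) = c * f x z)"

definition alt_nondeg :: "(('k::field)^'n \<Rightarrow> 'k^'n \<Rightarrow> 'k) \<Rightarrow> bool" where
  "alt_nondeg f \<longleftrightarrow> is_bilin f \<and> (\<forall>x. f x x = 0) \<and> (\<forall>x. (\<forall>y. f x y = 0) \<longrightarrow> x = 0)"

definition herm_nondeg :: "('k::field \<Rightarrow> 'k) \<Rightarrow> ('k^'n \<Rightarrow> 'k^'n \<Rightarrow> 'k) \<Rightarrow> bool" where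
  "herm_nondeg \<sigma> f \<longleftrightarrow>
     (\<forall>a b. \<sigma> (a + b) = \<sigma> a + \<sigma> b) \<and> (\<forall>a b. \<sigma> (a * b) = \<sigma> a * \<sigma> b) \<and>
     (\<forall>a. \<sigma> (\<sigma> a) = a) \<and> (\<exists>a. \<sigma> a \<noteq> a) \<and>
     (\<forall>x y z. f (x + y) z = f x z + f y z) \<and> (\<forall>c x z. f (c *s x) z = c * f x z) \<and>
     (\<forall>x y. f y x = \<sigma> (f x y)) \<and> (\<forall>x. (\<forall>y. f x y = 0) \<longrightarrow> x = 0)"

definition quad_nondeg :: "(('k::field)^'n \<Rightarrow> 'k) \<Rightarrow> bool" where
  "quad_nondeg Q \<longleftrightarrow>
     (\<forall>c x. Q (c *s x) = c ^ 2 * Q x) \<and> is_bilin (\<lambda>x y. Q (x + y) - Q x - Q y) \<and>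
     (\<forall>x. (\<forall>y. Q (x + y) - Q x - Q y = 0) \<and> Q x = 0 \<longrightarrow> x = 0)"

definition tot_iso :: "(('k::field)^'n \<Rightarrow> 'k^'n \<Rightarrow> 'k) \<Rightarrow> ('k^'n) set \<Rightarrow> bool" where
  "tot_iso f U \<longleftrightarrow> vec.subspace U \<and> (\<forall>x\<in>U. \<forall>y\<in>U. f x y = 0)"

definition tot_sing :: "(('k::field)^'n \<Rightarrow> 'k) \<Rightarrow> ('k^'n) set \<Rightarrow> bool" where
  "tot_sing Q U \<longleftrightarrow> vec.subspace U \<and> (\<forall>x\<in>U. Q x = 0)"

definition witt :: "((('k::{field,finite})^('n::finite)) set \<Rightarrow> bool) \<Rightarrow> nat" where
  "witt TI = Max (vec.dim ` {U. TI U})"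

text \<open>The polar-space setting together with its scalar e (standard table):
  Sp(2D,q): e=1; O(2D+1,q): e=1; O+(2D,q): e=0; O-(2D+2,q): e=2;
  U(2D,r) (q=r^2): e=1/2; U(2D+1,r) (q=r^2): e=3/2.  Here 'k = F_q, CARD('n) is the dimension.\<close>
definition dual_polar_setting :: "((('k::{field,finite})^('n::finite)) set \<Rightarrow> bool) \<Rightarrow> real \<Rightarrow> bool" where
  "dual_polar_setting TI e \<longleftrightarrow>
     (let N = CARD('n); D = witt TI in
       (\<exists>f. alt_nondeg f \<and> TI = tot_iso f \<and> e = 1) \<or>
       (\<exists>Q. quad_nondeg Q \<and> TI = tot_sing Q \<and>
            ((N = 2 * D \<and> e = 0) \<or> (N = 2 * D + 1 \<and> e = 1) \<or> (N = 2 * D + 2 \<and> e = 2))) \<or>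
       (\<exists>\<sigma> f. herm_nondeg \<sigma> f \<and> TI = tot_iso f \<and>
            ((N = 2 * D \<and> e = 1 / 2) \<or> (N = 2 * D + 1 \<and> e = 3 / 2))))"

definition dp_vertices :: "((('k::{field,finite})^('n::finite)) set \<Rightarrow> bool) \<Rightarrow> ('k^'n) set set" where
  "dp_vertices TI = {U. TI U \<and> (\<forall>V. TI V \<and> U \<subseteq> V \<longrightarrow> V = U)}"

definition dp_adj :: "((('k::{field,finite})^('n::finite)) set \<Rightarrow> bool) \<Rightarrow> ('k^'n) set \<Rightarrow> ('k^'n) set \<Rightarrow> bool" where
  "dp_adj TI U W \<longleftrightarrow> U \<in> dp_vertices TI \<and> W \<in> dp_vertices TI \<and> vec.dim (U \<inter> W) = witt TI - 1"

definition dp_rel :: "((('k::{field,finite})^('n::finite)) set \<Rightarrow> bool) \<Rightarrow> (('k^'n) set \<times> ('k^'n) set) set" where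
  "dp_rel TI = {(U, W). dp_adj TI U W}"

definition dp_dist :: "((('k::{field,finite})^('n::finite)) set \<Rightarrow> bool) \<Rightarrow> ('k^'n) set \<Rightarrow> ('k^'n) set \<Rightarrow> nat" where
  "dp_dist TI U W = (LEAST m. (U, W) \<in> dp_rel TI ^^ m)"

definition dp_setdist :: "((('k::{field,finite})^('n::finite)) set \<Rightarrow> bool) \<Rightarrow> ('k^'n) set set \<Rightarrow> ('k^'n) set \<Rightarrow> nat" where
  "dp_setdist TI C W = (LEAST m. \<exists>c\<in>C. (c, W) \<in> dp_rel TI ^^ m)"

definition dp_Gamma :: "((('k::{field,finite})^('n::finite)) set \<Rightarrow> bool) \<Rightarrow> nat \<Rightarrow> ('k^'n) set \<Rightarrow> ('k^'n) set set" where
  "dp_Gamma TI i x = {y \<in> dp_vertices TI. dp_dist TI x y = i}"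

definition dp_max_clique :: "((('k::{field,finite})^('n::finite)) set \<Rightarrow> bool) \<Rightarrow> ('k^'n) set set \<Rightarrow> bool" where
  "dp_max_clique TI C \<longleftrightarrow> C \<subseteq> dp_vertices TI \<and> (\<forall>a\<in>C. \<forall>b\<in>C. a \<noteq> b \<longrightarrow> dp_adj TI a b) \<and>
     (\<forall>C'. C \<subseteq> C' \<and> C' \<subseteq> dp_vertices TI \<and> (\<forall>a\<in>C'. \<forall>b\<in>C'. a \<noteq> b \<longrightarrow> dp_adj TI a b) \<longrightarrow> C' = C)"

definition dp_Ci :: "((('k::{field,finite})^('n::finite)) set \<Rightarrow> bool) \<Rightarrow> ('k^'n) set set \<Rightarrow> nat \<Rightarrow> ('k^'n) set set" where
  "dp_Ci TI C i = {y \<in> dp_vertices TI. dp_setdist TI C y = i}"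

definition dp_Cminus where "dp_Cminus TI x C i = dp_Gamma TI i x \<inter> dp_Ci TI C i"
definition dp_Cplus where "dp_Cplus TI x C i = dp_Gamma TI (Suc i) x \<inter> dp_Ci TI C i"

definition cbasis :: "((('k::{field,finite})^('n::finite)) set \<Rightarrow> bool) \<Rightarrow> ('k^'n) set \<Rightarrow> ('k^'n) set set \<Rightarrow> nat \<Rightarrow> ('k^'n) set \<Rightarrow> complex" where
  "cbasis TI x C j = indicator (if even j then dp_Cminus TI x C (j div 2) else dp_Cplus TI x C (j div 2))"

definition Wvec :: "((('k::{field,finite})^('n::finite)) set \<Rightarrow> bool) \<Rightarrow> ('k^'n) set \<Rightarrow> ('k^'n) set set \<Rightarrow> (nat \<Rightarrow> complex) \<Rightarrow> ('k^'n) set \<Rightarrow> complex" where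
  "Wvec TI x C a = (\<lambda>U. \<Sum>j < 2 * witt TI. a j * cbasis TI x C j U)"

definition Wspace where "Wspace TI x C = range (Wvec TI x C)"

definition adj_op :: "((('k::{field,finite})^('n::finite)) set \<Rightarrow> bool) \<Rightarrow> (('k^'n) set \<Rightarrow> complex) \<Rightarrow> ('k^'n) set \<Rightarrow> complex" where
  "adj_op TI v = (\<lambda>U. \<Sum>W \<in> {W. dp_adj TI U W}. v W)"

definition dual_adj_op :: "((('k::{field,finite})^('n::finite)) set \<Rightarrow> bool) \<Rightarrow> ('k^'n) set \<Rightarrow> real \<Rightarrow> real \<Rightarrow> (('k^'n) set \<Rightarrow> complex) \<Rightarrow> ('k^'n) set \<Rightarrow> complex" where
  "dual_adj_op TI x a b v = (\<lambda>U. \<Sum>i \<le> witt TI.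
      complex_of_real (a + b * real CARD('k) powr (- real i)) * (indicator (dp_Gamma TI i x) U * v U))"

definition dual_adj_op_C :: "((('k::{field,finite})^('n::finite)) set \<Rightarrow> bool) \<Rightarrow> ('k^'n) set set \<Rightarrow> real \<Rightarrow> real \<Rightarrow> (('k^'n) set \<Rightarrow> complex) \<Rightarrow> ('k^'n) set \<Rightarrow> complex" where
  "dual_adj_op_C TI C a b v = (\<lambda>U. \<Sum>i < witt TI.
      complex_of_real (a + b * real CARD('k) powr (- real i)) * (indicator (dp_Ci TI C i) U * v U))"

definition mmul :: "nat \<Rightarrow> (nat \<Rightarrow> nat \<Rightarrow> complex) \<Rightarrow> (nat \<Rightarrow> nat \<Rightarrow> complex) \<Rightarrow> nat \<Rightarrow> nat \<Rightarrow> complex" where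
  "mmul n A B = (\<lambda>i j. \<Sum>k<n. A i k * B k j)"

definition mid :: "nat \<Rightarrow> nat \<Rightarrow> nat \<Rightarrow> complex" where
  "mid n = (\<lambda>i j. if i < n \<and> i = j then 1 else 0)"

definition minv :: "nat \<Rightarrow> (nat \<Rightarrow> nat \<Rightarrow> complex) \<Rightarrow> nat \<Rightarrow> nat \<Rightarrow> complex" where
  "minv n M = (THE B. (\<forall>i j. (n \<le> i \<or> n \<le> j) \<longrightarrow> B i j = 0) \<and>
                      mmul n M B = mid n \<and> mmul n B M = mid n)"

text \<open>Block-diagonal matrix with 2x2 blocks on indices (2i,2i+1), 0 <= i < D.
  f i r s is the (r,s) entry (r,s in {0,1}) of the i-th block.\<close>
definition blk_even :: "nat \<Rightarrow> (nat \<Rightarrow> nat \<Rightarrow> nat \<Rightarrow> complex) \<Rightarrow> nat \<Rightarrow> nat \<Rightarrow> complex" where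
  "blk_even D f = (\<lambda>i j. if i < 2 * D \<and> j < 2 * D \<and> i div 2 = j div 2
                        then f (i div 2) (i mod 2) (j mod 2) else 0)"

text \<open>Block-diagonal matrix with 1x1 block a0 on index 0, 2x2 blocks f i on (2i-1,2i) for
  1 <= i <= D-1, and 1x1 block aD on index 2D-1.\<close>
definition blk_odd :: "nat \<Rightarrow> complex \<Rightarrow> (nat \<Rightarrow> nat \<Rightarrow> nat \<Rightarrow> complex) \<Rightarrow> complex \<Rightarrow> nat \<Rightarrow> nat \<Rightarrow> complex" where
  "blk_odd D a0 f aD = (\<lambda>i j.
     if i = 0 \<and> j = 0 then a0
     else if i = 2 * D - 1 \<and> j = 2 * D - 1 then aD
     else if 1 \<le> i \<and> i \<le> 2 * D - 2 \<and> 1 \<le> j \<and> j \<le> 2 * D - 2 \<and> (i + 1) div 2 = (j + 1) div 2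
     then f ((i + 1) div 2) ((i + 1) mod 2) ((j + 1) mod 2) else 0)"

definition pw :: "real \<Rightarrow> real \<Rightarrow> complex" where
  "pw q s = complex_of_real (q powr s)"

definition t_blk :: "real \<Rightarrow> real \<Rightarrow> nat \<Rightarrow> nat \<Rightarrow> nat \<Rightarrow> complex" where
  "t_blk q e i r s =
     (if r = 0 \<and> s = 0 then pw q (- e / 2) - pw q (e / 2)
      else if r = 0 \<and> s = 1 then pw q (e / 2)
      else if r = 1 \<and> s = 0 then pw q (- e / 2) else 0)"

definition u'_blk :: "real \<Rightarrow> real \<Rightarrow> nat \<Rightarrow> nat \<Rightarrow> nat \<Rightarrow> nat \<Rightarrow> complex" where
  "u'_blk q e D i r s = (if r = 1 \<and> s = 0 then - \<i> * pw q ((real D - e) / 2 - real i) else 0)"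

definition t'_blk :: "real \<Rightarrow> nat \<Rightarrow> nat \<Rightarrow> nat \<Rightarrow> nat \<Rightarrow> complex" where
  "t'_blk q D i r s = \<i> *
     (if r = 0 \<and> s = 0 then pw q (- real D / 2) * complex_of_real (q ^ D - q ^ i + 1)
      else if r = 0 \<and> s = 1 then pw q (real D / 2) * (pw q (real i - real D) - 1)
      else if r = 1 \<and> s = 0 then pw q (- real D / 2) * complex_of_real (1 - q ^ i)
      else pw q (real i - real D / 2))"

definition u_blk :: "real \<Rightarrow> nat \<Rightarrow> nat \<Rightarrow> nat \<Rightarrow> nat \<Rightarrow> complex" where
  "u_blk q D i r s =
     (if r = 0 \<and> s = 0 then -1
      else if r = 0 \<and> s = 1 then complex_of_real (1 - q ^ (D - i)) else 0)"

text \<open>Matrices of the generators of the nil-DAHA on W in the basis cbasis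
  (column convention: column j is the image of the j-th basis vector).\<close>
definition mT where "mT q e D = blk_even D (t_blk q e)"
definition mU' where "mU' q e D = blk_even D (u'_blk q e D)"
definition mT' where "mT' q D = blk_odd D (\<i> * pw q (- real D / 2)) (t'_blk q D) (\<i> * pw q (- real D / 2))"
definition mU where "mU q D = blk_odd D 0 (u_blk q D) (-1)"
definition mX where "mX q e D = mmul (2 * D) (mT' q D) (mT q e D)"

definition mcalA where "mcalA q e D = (\<lambda>i j. mX q e D i j + minv (2 * D) (mX q e D) i j)"
definition mcalAs where "mcalAs q e D = (\<lambda>i j. \<i> * pw q (- real D / 2) *
    (mmul (2 * D) (mT q e D) (mU' q e D) i j + mmul (2 * D) (mU q D) (mT' q D) i j))"
definition mcalAt where "mcalAt q e D = (\<lambda>i j. \<i> * pw q (- real D / 2) *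
    (mmul (2 * D) (mT q e D) (mU' q e D) i j + complex_of_real q * mmul (2 * D) (mU q D) (mT' q D) i j))"

definition mapp :: "nat \<Rightarrow> (nat \<Rightarrow> nat \<Rightarrow> complex) \<Rightarrow> (nat \<Rightarrow> complex) \<Rightarrow> nat \<Rightarrow> complex" where
  "mapp n M a = (\<lambda>k. \<Sum>j<n. M k j * a j)"

definition acts_on_W_by where
  "acts_on_W_by TI x C opr M \<longleftrightarrow>
     (\<forall>a. opr (Wvec TI x C a) = Wvec TI x C (mapp (2 * witt TI) M a))"

definition Hbar_irreducible_on_W where
  "Hbar_irreducible_on_W TI x C q e \<longleftrightarrow>
     (let D = witt TI; n = 2 * D;
          gens = {mT q e D, minv n (mT q e D), mU q D, mX q e D, minv n (mX q e D)} in
      \<forall>S. S \<subseteq> Wspace TI x C \<and> (\<lambda>_. 0) \<in> S \<and> (\<forall>v\<in>S. \<forall>w\<in>S. (\<lambda>U. v U + w U) \<in> S) \<and>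
           (\<forall>c. \<forall>v\<in>S. (\<lambda>U. c * v U) \<in> S) \<and>
           (\<forall>M\<in>gens. \<forall>a. Wvec TI x C a \<in> S \<longrightarrow> Wvec TI x C (mapp n M a) \<in> S)
        \<longrightarrow> S = {\<lambda>_. 0} \<or> S = Wspace TI x C)"

end

theory Submission
  imports Defs
begin

text \<open>
  All three kinds of forms are handled through one notion: singular vectors together with a
  reflexive orthogonality that is linear in the first argument.  Distances then become codimensions
  of intersections, every maximal clique is the pencil of all vertices through an isotropic
  subspace \<open>h\<close> of dimension \<open>D - 1\<close>, and each pencil contains a unique vertex (gate) nearest to a given
  vertex.  Counting singular vectors on lines shows that a pencil has \<open>q powr e + 1\<close> vertices; this is
  the only place where the type of the form matters.  Summing over the hyperplanes of a vertex
  determines the adjacency action on the span of the classes.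

  On the algebra side both T and T' are inverted by their quadratic relations, so
  X plus its inverse has explicit rows.  The two dual operators are diagonal with jointly simple spectrum,
  hence an invariant subspace is spanned by basis vectors, and these are linked by the off-diagonal
  entries of T and T'.
\<close>

section \<open>Subspaces and hyperplanes over a finite field\<close>

text \<open>The pairing may be degenerate: in characteristic two the polar form of a quadratic form
  on an odd-dimensional space has a radical. Nondegeneracy is replaced by the rank identity dim U +
  dim (W \<inter> U^perp) = dim W + dim (U \<inter> W^perp), together with the absence of nonzero
  singular vectors in the radical. An element of W with coefficients \<open>a\<close> is the
  function y \<mapsto> a (class of y), so A acts by a neighbour sum, which is compared with one row
  of the matrix. Around a vertex y the hyperplanes of y are sorted by a flag p < P, where p = z
  \<inter> y, z being the subspace that carries the clique, and P is the intersection of y with its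
  gate in the clique. That gate is x exactly for the classes \<open>C_i^-\<close>, whence two kinds
  of rows. The scalar e arises as N - 2D + t, where N is the dimension of the whole space and q^t
  counts the singular vectors v + a u on a line with u singular and \<open>f v u = 1\<close>: t is
  1, 0, 1/2 for alternating, quadratic and Hermitian forms.\<close>

lemma subspace_dim_eqI:
  fixes S :: "('k::field^'n) set"
  assumes "vec.subspace S" "vec.subspace T" "S \<subseteq> T" "vec.dim T \<le> vec.dim S"
  shows "S = T"
  using vec.subspace_dim_equal[OF assms(1,2,3,4)] .

lemma dim_span_insert:
  fixes S :: "('k::field^'n) set"
  assumes "vec.subspace S" "u \<notin> S"
  shows "vec.dim (vec.span (insert u S)) = Suc (vec.dim S)" "vec.dim (insert u S) = Suc (vec.dim S)"
proof -
  have "vec.span S = S" using assms(1) by (simp only: vec.span_eq_iff)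
  then have "u \<notin> vec.span S" using assms(2) by (simp only: simp_thms)
  then show "vec.dim (insert u S) = Suc (vec.dim S)" by (simp add: vec.dim_insert)
  then show "vec.dim (vec.span (insert u S)) = Suc (vec.dim S)" by simp
qed

lemma span_insert_iff:
  fixes S :: "('k::field^'n) set"
  assumes "vec.subspace S"
  shows "x \<in> vec.span (insert u S) \<longleftrightarrow> (\<exists>c. \<exists>y\<in>S. x = y + c *s u)"
proof -
  have S: "vec.span S = S" using assms by (simp only: vec.span_eq_iff)
  have "x \<in> vec.span (insert u S) \<longleftrightarrow> (\<exists>c. x - c *s u \<in> S)"
    unfolding vec.span_insert S by simp
  also have "\<dots> \<longleftrightarrow> (\<exists>c. \<exists>y\<in>S. x = y + c *s u)"
    by (simp only: Bex_def diff_eq_eq[symmetric] eq_commute[of x] add_diff_eq)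
      (metis diff_add_cancel add_diff_cancel_right')
  finally show ?thesis .
qed

lemma span_insert_least:
  fixes S :: "('k::field^'n) set"
  assumes "vec.subspace T" "S \<subseteq> T" "u \<in> T"
  shows "vec.span (insert u S) \<subseteq> T"
  using assms by (intro vec.span_minimal) auto

lemma subset_span_insert: "S \<subseteq> vec.span (insert u (S :: ('k::field^'n) set))" "u \<in> vec.span (insert u S)"
  by (auto intro: vec.span_base)

text \<open>Any \<open>u\<close> in \<open>U\<close> with \<open>f u \<noteq> 0\<close> spans a
  complement of the kernel: subtracting \<open>f x / f u\<close> times \<open>u\<close> from
  \<open>x\<close> lands in it. Applied to the pairing with its second argument fixed.\<close>

lemma dim_le_Suc_dim_kernel:
  fixes f :: "'k::field^'n \<Rightarrow> 'k"
  assumes U: "vec.subspace U" and add: "\<And>x y. f (x + y) = f x + f y"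
    and scale: "\<And>c x. f (c *s x) = c * f x"
  shows "vec.dim U \<le> Suc (vec.dim {x\<in>U. f x = 0})"
proof (cases "\<exists>u\<in>U. f u \<noteq> 0")
  case True
  then obtain u where u: "u \<in> U" "f u \<noteq> 0" by auto
  have "U \<subseteq> vec.span (insert u {x\<in>U. f x = 0})"
  proof
    fix x assume x: "x \<in> U"
    define k where "k = - (f x / f u)"
    have "f (x + k *s u) = 0" using u by (simp only: add scale k_def) simp
    moreover have "x + k *s u \<in> U"
      using U x u(1) by (simp add: vec.subspace_add vec.subspace_scale)
    ultimately have "x + k *s u \<in> vec.span (insert u {x\<in>U. f x = 0})"
      by (intro vec.span_base) auto
    moreover have "k *s u \<in> vec.span (insert u {x\<in>U. f x = 0})"
      by (intro vec.span_scale vec.span_base) auto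
    ultimately show "x \<in> vec.span (insert u {x\<in>U. f x = 0})"
      by (metis add_diff_cancel_right' vec.span_diff)
  qed
  then have "vec.dim U \<le> vec.dim (insert u {x\<in>U. f x = 0})" by (rule vec.dim_mono)
  also have "\<dots> \<le> Suc (vec.dim {x\<in>U. f x = 0})" by (simp add: vec.dim_insert)
  finally show ?thesis .
next
  case False
  then have "{x\<in>U. f x = 0} = U" by auto
  then show ?thesis by simp
qed

lemma dim_Int_Suc_if_neq:
  fixes y :: "('k::field^'n) set"
  assumes "vec.subspace y" "vec.subspace c" "vec.dim y = Suc d" "vec.dim c = Suc d" "c \<noteq> y"
    "vec.subspace h" "h \<subseteq> y" "h \<subseteq> c" "vec.dim h = d"
  shows "c \<inter> y = h"
proof -
  have s: "vec.subspace (c \<inter> y)" using assms by (simp add: vec.subspace_inter)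
  have "vec.dim (c \<inter> y) \<le> d"
  proof (rule ccontr)
    assume "\<not> vec.dim (c \<inter> y) \<le> d"
    then have *: "Suc d \<le> vec.dim (c \<inter> y)" by simp
    have "c \<inter> y = y" using s assms * by (intro subspace_dim_eqI) auto
    moreover have "c \<inter> y = c" using s assms * by (intro subspace_dim_eqI) auto
    ultimately show False using \<open>c \<noteq> y\<close> by simp
  qed
  then show ?thesis
    using s assms by (intro subspace_dim_eqI[symmetric]) auto
qed

lemma card_subspace:
  fixes U :: "(('k::{field,finite})^'n::finite) set"
  assumes "vec.subspace U"
  shows "card U = CARD('k) ^ vec.dim U"
proof -
  have *: "card (vec.span B) = CARD('k) ^ card B" if "finite B" "vec.independent B" for B :: "('k^'n) set"
    using that
  proof (induction B)
    case (insert b B)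
    then have ind: "vec.independent B" "b \<notin> vec.span B"
      by (auto simp: vec.independent_insert)
    have "bij_betw (\<lambda>(c, y). y + c *s b) (UNIV \<times> vec.span B) (vec.span (insert b (vec.span B)))"
      unfolding bij_betw_def
    proof
      show "inj_on (\<lambda>(c, y). y + c *s b) (UNIV \<times> vec.span B)"
      proof (rule inj_onI, clarsimp)
        fix c y c' y'
        assume yy: "y \<in> vec.span B" "y' \<in> vec.span B" and eq: "y + c *s b = y' + c' *s b"
        have "(c' - c) *s b = y - y'" using eq by (simp add: algebra_simps vec.scale_left_diff_distrib)
        then have mem: "(c' - c) *s b \<in> vec.span B" using yy by (simp add: vec.span_diff)
        have "c' = c"
        proof (rule ccontr)
          assume "c' \<noteq> c"
          have "inverse (c' - c) *s ((c' - c) *s b) \<in> vec.span B"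
            using mem by (rule vec.span_scale)
          then show False using ind \<open>c' \<noteq> c\<close> by (simp only: vec.scale_scale) simp
        qed
        then show "c = c' \<and> y = y'" using eq by simp
      qed
      show "(\<lambda>(c, y). y + c *s b) ` (UNIV \<times> vec.span B) = vec.span (insert b (vec.span B))"
        using span_insert_iff[of "vec.span B" _ b] by (auto simp: image_iff)
    qed
    then have "card (vec.span (insert b (vec.span B))) = CARD('k) * card (vec.span B)"
      by (simp add: bij_betw_same_card[symmetric] card_cartesian_product)
    moreover have "vec.span (insert b (vec.span B)) = vec.span (insert b B)"
      by (simp only: vec.span_insert vec.span_span)
    ultimately show ?case using insert ind by simp
  qed simp
  obtain B where B: "B \<subseteq> U" "vec.independent B" "U \<subseteq> vec.span B" "card B = vec.dim U"
    using vec.basis_exists by blast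
  then have "vec.span B = U" using assms vec.span_minimal by blast
  then show ?thesis using * B vec.finiteI_independent by metis
qed

section \<open>Counting the hyperplanes of a subspace\<close>

definition hyps :: "('k::field^'n) set \<Rightarrow> ('k^'n) set \<Rightarrow> ('k^'n) set set" where
  "hyps y P = {h. vec.subspace h \<and> h \<subseteq> y \<and> P \<subseteq> h \<and> Suc (vec.dim h) = vec.dim y}"

lemma hyp_decomp:
  fixes y :: "('k::field^'n) set"
  assumes y: "vec.subspace y" and h: "h \<in> hyps y P" and v: "v \<in> y" "v \<notin> h" and w: "w \<in> y"
  shows "\<exists>!a. w - a *s v \<in> h"
proof -
  have hs: "vec.subspace h" "h \<subseteq> y" "Suc (vec.dim h) = vec.dim y" using h by (auto simp: hyps_def)
  have "vec.span (insert v h) = y"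
    using hs y v by (intro subspace_dim_eqI span_insert_least) (auto simp: dim_span_insert)
  then obtain c y' where "y' \<in> h" "w = y' + c *s v" using w span_insert_iff[OF hs(1)] by blast
  then have ex: "w - c *s v \<in> h" by simp
  moreover have "a = c" if "w - a *s v \<in> h" for a
  proof (rule ccontr)
    assume "a \<noteq> c"
    have "(w - c *s v) - (w - a *s v) \<in> h" using ex that hs(1) by (rule vec.subspace_diff[rotated])
    moreover have "(w - c *s v) - (w - a *s v) = (a - c) *s v"
      by (simp add: vec.scale_left_diff_distrib)
    ultimately have "(a - c) *s v \<in> h" by simp
    then have "inverse (a - c) *s ((a - c) *s v) \<in> h" using hs by (metis vec.subspace_scale)
    then show False using \<open>a \<noteq> c\<close> v by (simp only: vec.scale_scale) simp
  qed
  ultimately show ?thesis by blast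
qed

text \<open>A hyperplane missing \<open>v\<close> is complemented by \<open>v\<close>, so for a
  fixed \<open>w\<close> outside the span of \<open>v\<close> and \<open>P\<close> it contains
  exactly one \<open>w - a *s v\<close>. This sorts the hyperplanes into one family per field
  element, each of the same kind with \<open>P\<close> enlarged by one dimension.\<close>

lemma card_hyps_avoiding:
  fixes y :: "(('k::{field,finite})^'n::finite) set"
  assumes "vec.subspace y" "vec.subspace P" "P \<subseteq> y" "v \<in> y" "v \<notin> P"
  shows "card {h \<in> hyps y P. v \<notin> h} = CARD('k) ^ (vec.dim y - Suc (vec.dim P))"
  using assms
proof (induction "vec.dim y - Suc (vec.dim P)" arbitrary: P)
  case 0
  have "vec.dim (vec.span (insert v P)) \<le> vec.dim y"
    using 0 by (intro vec.dim_subset span_insert_least) auto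
  then have "Suc (vec.dim P) \<le> vec.dim y"
    by (simp only: dim_span_insert(1)[OF 0(3,6)])
  then have d: "Suc (vec.dim P) = vec.dim y" using 0(1) by simp
  have "{h \<in> hyps y P. v \<notin> h} = {P}"
  proof (intro set_eqI iffI)
    fix h assume h: "h \<in> {h \<in> hyps y P. v \<notin> h}"
    then have "P = h" using 0(3) d by (intro subspace_dim_eqI) (auto simp: hyps_def)
    then show "h \<in> {P}" by simp
  qed (use 0 d in \<open>auto simp: hyps_def\<close>)
  then show ?case using 0 by simp
next
  case (Suc n)
  have "\<not> y \<subseteq> vec.span (insert v P)"
  proof
    assume "y \<subseteq> vec.span (insert v P)"
    then have "vec.dim y \<le> Suc (vec.dim P)"
      using vec.dim_subset Suc.prems by (metis dim_span_insert)
    then show False using Suc.hyps(2) by simp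
  qed
  then obtain w where w: "w \<in> y" "w \<notin> vec.span (insert v P)" by auto
  define PP where "PP a = vec.span (insert (w - a *s v) P)" for a
  have nw: "w - a *s v \<notin> P" for a
  proof
    assume "w - a *s v \<in> P"
    then have "(w - a *s v) + a *s v \<in> vec.span (insert v P)"
      using span_insert_iff[OF Suc.prems(2)] by blast
    then show False using w by simp
  qed
  have nv: "v \<notin> PP a" for a
  proof
    assume "v \<in> PP a"
    then obtain c p where p: "p \<in> P" "v = p + c *s (w - a *s v)"
      unfolding PP_def using span_insert_iff[OF Suc.prems(2)] by blast
    show False
    proof (cases "c = 0")
      case True then show False using p Suc.prems by simp
    next
      case False
      have "- p + v = c *s (w - a *s v)" using p(2) by (simp add: algebra_simps)
      then have "c *s w = - p + (1 + c * a) *s v"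
        by (simp add: algebra_simps vec.scale_right_diff_distrib vec.scale_left_distrib)
      then have "w = inverse c *s (- p + (1 + c * a) *s v)"
        using False by (metis vec.scale_scale left_inverse vec.scale_one)
      also have "\<dots> = (- inverse c) *s p + (inverse c * (1 + c * a)) *s v"
        by (simp add: vec.scale_right_distrib vec.scale_left_distrib distrib_left)
      finally have "w \<in> vec.span (insert v P)"
        using span_insert_iff[OF Suc.prems(2)] p(1) Suc.prems(2) vec.subspace_scale by blast
      then show False using w by simp
    qed
  qed
  have "{h \<in> hyps y P. v \<notin> h} = (\<Union>a\<in>UNIV. {h \<in> hyps y (PP a). v \<notin> h})"
  proof (intro set_eqI iffI)
    fix h assume h: "h \<in> {h \<in> hyps y P. v \<notin> h}"
    then obtain a where a: "w - a *s v \<in> h" using hyp_decomp[OF Suc.prems(1), of h P v w] Suc.prems w by auto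
    then have "PP a \<subseteq> h" unfolding PP_def using h by (intro span_insert_least) (auto simp: hyps_def)
    then show "h \<in> (\<Union>a\<in>UNIV. {h \<in> hyps y (PP a). v \<notin> h})" using h by (auto simp: hyps_def)
  next
    fix h assume "h \<in> (\<Union>a\<in>UNIV. {h \<in> hyps y (PP a). v \<notin> h})"
    then obtain a where a: "h \<in> hyps y (PP a)" "v \<notin> h" by blast
    have "P \<subseteq> PP a" unfolding PP_def by (rule subset_span_insert)
    then show "h \<in> {h \<in> hyps y P. v \<notin> h}" using a by (auto simp: hyps_def)
  qed
  moreover have "card (\<Union>a\<in>UNIV. {h \<in> hyps y (PP a). v \<notin> h}) = (\<Sum>a\<in>UNIV. card {h \<in> hyps y (PP a). v \<notin> h})"
  proof (rule card_UN_disjoint)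
    show "\<forall>a\<in>UNIV. \<forall>b\<in>UNIV. a \<noteq> b \<longrightarrow> {h \<in> hyps y (PP a). v \<notin> h} \<inter> {h \<in> hyps y (PP b). v \<notin> h} = {}"
    proof (intro ballI impI)
    fix a b :: 'k assume "a \<noteq> b"
    show "{h \<in> hyps y (PP a). v \<notin> h} \<inter> {h \<in> hyps y (PP b). v \<notin> h} = {}"
    proof (rule ccontr)
      assume "\<not> ?thesis"
      then obtain h where h: "h \<in> hyps y (PP a)" "h \<in> hyps y (PP b)" "v \<notin> h" by auto
      have "w - a *s v \<in> h" "w - b *s v \<in> h"
        using h subset_span_insert(2)[of "w - a *s v" P] subset_span_insert(2)[of "w - b *s v" P]
        unfolding PP_def hyps_def by auto
      then show False using hyp_decomp[OF Suc.prems(1) h(1) _ h(3) w(1)] \<open>a \<noteq> b\<close> Suc.prems by blast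
    qed
    qed
  qed simp_all
  moreover have "card {h \<in> hyps y (PP a). v \<notin> h} = CARD('k) ^ n" for a
  proof -
    have d: "vec.dim (PP a) = Suc (vec.dim P)" unfolding PP_def using nw Suc.prems by (simp add: dim_span_insert)
    have n: "n = vec.dim y - Suc (vec.dim (PP a))" using d Suc.hyps(2) by simp
    have "card {h \<in> hyps y (PP a). v \<notin> h} = CARD('k) ^ (vec.dim y - Suc (vec.dim (PP a)))"
    proof (rule Suc.hyps(1)[OF n Suc.prems(1)])
      show "PP a \<subseteq> y" unfolding PP_def using Suc.prems w
        by (intro span_insert_least) (auto simp: vec.subspace_diff vec.subspace_scale)
    qed (use nv Suc.prems in \<open>auto simp: PP_def\<close>)
    then show ?thesis using n by simp
  qed
  ultimately have "card {h \<in> hyps y P. v \<notin> h} = CARD('k) ^ Suc n"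
    by (simp only: sum_constant of_nat_id power_Suc)
  then show ?case by (simp only: Suc.hyps(2))
qed

lemma hyps_split:
  fixes y :: "(('k::{field,finite})^'n::finite) set"
  shows "card (hyps y P) = card (hyps y (vec.span (insert v P))) + card {h \<in> hyps y P. v \<notin> h}"
proof -
  have "{h \<in> hyps y P. v \<in> h} = hyps y (vec.span (insert v P))"
    unfolding hyps_def using subset_span_insert(1)[where S = P and u = v] subset_span_insert(2)[where S = P and u = v]
      span_insert_least[where S = P and u = v] by blast
  moreover have "card (hyps y P) = card {h \<in> hyps y P. v \<in> h} + card {h \<in> hyps y P. v \<notin> h}"
    by (subst card_Un_disjoint[symmetric]) (auto intro: arg_cong[where f = card])
  ultimately show ?thesis by simp
qed

text \<open>The factor q - 1 keeps the geometric sum free of division. A vector \<open>v\<close>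
  outside \<open>P\<close> separates the hyperplanes through \<open>v\<close>, counted by induction,
  from the q^n that avoid it.\<close>

lemma card_hyps:
  fixes y :: "(('k::{field,finite})^'n::finite) set"
  assumes "vec.subspace y" "vec.subspace P" "P \<subseteq> y"
  shows "card (hyps y P) * (CARD('k) - 1) = CARD('k) ^ (vec.dim y - vec.dim P) - 1"
  using assms
proof (induction "vec.dim y - vec.dim P" arbitrary: P)
  case 0
  then have "P = y" by (intro subspace_dim_eqI) auto
  \<comment> \<open>The codimension in \<open>hyps\<close> is expressed with \<open>Suc\<close>
    instead of a truncated dim y - 1, so even the zero space has no hyperplane.\<close>
  then have "hyps y P = {}" by (auto simp: hyps_def)
  then show ?case using 0 by simp
next
  case (Suc n)
  then have "P \<noteq> y" by auto
  then obtain v where v: "v \<in> y" "v \<notin> P" using Suc.prems by auto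
  define P' where "P' = vec.span (insert v P)"
  have d: "vec.dim P' = Suc (vec.dim P)" using v Suc.prems by (simp add: P'_def dim_span_insert)
  then have n: "n = vec.dim y - vec.dim P'" using Suc.hyps(2) by simp
  have "card (hyps y P') * (CARD('k) - 1) = CARD('k) ^ n - 1"
    using Suc.hyps(1)[OF n Suc.prems(1)] v Suc.prems n span_insert_least[of y P v] by (auto simp: P'_def)
  moreover have "card (hyps y P) = card (hyps y P') + CARD('k) ^ n"
  proof -
    have "vec.dim y - Suc (vec.dim P) = n" using Suc.hyps(2) by simp
    then show ?thesis
      using hyps_split[where v = v and y = y and P = P] card_hyps_avoiding[OF Suc.prems v]
      by (simp add: P'_def)
  qed
  moreover obtain m where "CARD('k) = Suc m"
    using zero_less_card_finite[where 'a='k] gr0_implies_Suc by blast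
  moreover have "Suc m ^ n \<ge> 1" for m by simp
  ultimately have "card (hyps y P) * (CARD('k) - 1) = CARD('k) ^ Suc n - 1"
    by (simp add: algebra_simps)
  then show ?case by (simp only: Suc.hyps(2))
qed

section \<open>Geometry of polar spaces\<close>

text \<open>\<open>sing\<close> is separate from \<open>f\<close> because in characteristic two the
  polar form of \<open>Q\<close> satisfies \<open>f x x = 0\<close> for all x, whatever
  \<open>Q x\<close> is. For Hermitian forms the second argument is only semilinear, so nothing
  beyond the symmetry of vanishing is required of it. \<open>rad_sing\<close> tolerates a radical
  without nonzero singular vectors.\<close>

locale polar_form =
  fixes f :: "('k::{field,finite})^('n::finite) \<Rightarrow> 'k^'n \<Rightarrow> 'k"
    and sing :: "'k^'n \<Rightarrow> bool" and TI :: "('k^'n) set \<Rightarrow> bool"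
  assumes f_add: "f (x + y) z = f x z + f y z"
    and f_scale: "f (c *s x) z = c * f x z"
    and f_sym: "f x y = 0 \<Longrightarrow> f y x = 0"
    and f_sing: "sing x \<Longrightarrow> f x x = 0"
    and sing_zero: "sing 0"
    and sing_add: "sing x \<Longrightarrow> sing y \<Longrightarrow> f x y = 0 \<Longrightarrow> sing (x + y)"
    and sing_scale: "sing x \<Longrightarrow> sing (c *s x)"
    and TI_iff: "TI U \<longleftrightarrow> vec.subspace U \<and> (\<forall>x\<in>U. sing x) \<and> (\<forall>x\<in>U. \<forall>y\<in>U. f x y = 0)"
    and rad_sing: "sing x \<Longrightarrow> (\<And>y. f x y = 0) \<Longrightarrow> x = 0"
begin

abbreviation "D \<equiv> witt TI"
abbreviation "V \<equiv> dp_vertices TI"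

definition perp :: "('k^'n) set \<Rightarrow> ('k^'n) set" where
  "perp U = {x. \<forall>u\<in>U. f x u = 0}"

lemma f_zero: "f 0 z = 0" "f z 0 = 0"
  using f_scale[of 0 0 z] f_sym by auto

lemma f_diff: "f (x - y) z = f x z - f y z"
  using f_add[of "x - y" y z] by simp

text \<open>Swapping the arguments, adding on the left and swapping back preserves vanishing, which
  is all that is ever used of the second argument.\<close>

lemma f_add_right0: "f x y = 0 \<Longrightarrow> f x z = 0 \<Longrightarrow> f x (y + z) = 0"
  by (metis f_sym f_add add_0)

lemma f_scale_right0: "f x y = 0 \<Longrightarrow> f x (c *s y) = 0"
  by (metis f_sym f_scale mult_zero_right)

lemma subspace_perp: "vec.subspace (perp U)"
  by (rule vec.subspaceI) (auto simp: perp_def f_zero f_add f_scale)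

lemma perp_span: "perp (vec.span S) = perp S"
proof
  show "perp S \<subseteq> perp (vec.span S)"
  proof
    fix x assume x: "x \<in> perp S"
    have "vec.subspace {u. f x u = 0}"
      by (rule vec.subspaceI) (auto simp: f_zero f_add_right0 f_scale_right0)
    then have "vec.span S \<subseteq> {u. f x u = 0}"
      using x by (intro vec.span_minimal) (auto simp: perp_def)
    then show "x \<in> perp (vec.span S)" by (auto simp: perp_def)
  qed
  show "perp (vec.span S) \<subseteq> perp S"
    using vec.span_superset[of S] by (auto simp: perp_def)
qed

lemma perp_anti: "A \<subseteq> B \<Longrightarrow> perp B \<subseteq> perp A"
  by (auto simp: perp_def)

lemma perp_commute: "A \<subseteq> perp B \<longleftrightarrow> B \<subseteq> perp A"
  unfolding perp_def using f_sym by blast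

section \<open>Rank of the pairing between two subspaces\<close>

lemma dim_le_card_perp:
  assumes "finite F" "vec.subspace U"
  shows "vec.dim U \<le> card F + vec.dim (U \<inter> perp F)"
  using assms(1)
proof (induction F)
  case empty
  then show ?case by (simp add: perp_def)
next
  case (insert b F)
  have "vec.dim (U \<inter> perp F) \<le> Suc (vec.dim {x \<in> U \<inter> perp F. f x b = 0})"
    using assms(2) subspace_perp vec.subspace_inter
    by (intro dim_le_Suc_dim_kernel) (auto simp: f_add f_scale)
  moreover have "{x \<in> U \<inter> perp F. f x b = 0} = U \<inter> perp (insert b F)" by (auto simp: perp_def)
  ultimately show ?case using insert by simp
qed

text \<open>Extend a basis \<open>B\<close> of \<open>W \<inter> perp U\<close> to a basis
  \<open>B'\<close> of \<open>W\<close>. The vectors of \<open>B\<close> impose no condition on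
  \<open>U\<close>, so at most dim W - card B conditions cut out
  \<open>U \<inter> perp W\<close>.\<close>

lemma dim_perp_le:
  assumes U: "vec.subspace U" and W: "vec.subspace W"
  shows "vec.dim U + vec.dim (W \<inter> perp U) \<le> vec.dim W + vec.dim (U \<inter> perp W)"
proof -
  obtain B where B: "B \<subseteq> W \<inter> perp U" "vec.independent B" "card B = vec.dim (W \<inter> perp U)"
    using vec.basis_exists by metis
  obtain B' where B': "B \<subseteq> B'" "B' \<subseteq> W" "vec.independent B'" "W \<subseteq> vec.span B'"
    using vec.maximal_independent_subset_extend[of B W] B by auto
  have card: "card B' = vec.dim W" using B' by (metis vec.basis_card_eq_dim)
  have "U \<inter> perp (B' - B) \<subseteq> U \<inter> perp W"
  proof
    fix x assume x: "x \<in> U \<inter> perp (B' - B)"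
    have "B \<subseteq> perp U" using B by auto
    then have "U \<subseteq> perp B" using perp_commute by blast
    then have "x \<in> perp B" using x by auto
    then have "x \<in> perp B'" using x by (auto simp: perp_def)
    then have "x \<in> perp (vec.span B')" by (simp only: perp_span)
    then show "x \<in> U \<inter> perp W" using perp_anti[OF B'(4)] x by auto
  qed
  then have "vec.dim (U \<inter> perp (B' - B)) \<le> vec.dim (U \<inter> perp W)" by (rule vec.dim_subset)
  moreover have "vec.dim U \<le> card (B' - B) + vec.dim (U \<inter> perp (B' - B))"
    using U by (intro dim_le_card_perp) auto
  moreover have "card (B' - B) = card B' - card B" "card B \<le> card B'"
    using B'(1) by (auto intro: card_Diff_subset card_mono)
  ultimately show ?thesis using card B(3) by simp
qed

text \<open>Row rank equals column rank: dim U - dim (U \<inter> W^perp) and dim W - dim (W \<inter>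
  U^perp) are both the rank of the pairing restricted to U and W.\<close>

lemma dim_perp_eq:
  assumes "vec.subspace U" "vec.subspace W"
  shows "vec.dim U + vec.dim (W \<inter> perp U) = vec.dim W + vec.dim (U \<inter> perp W)"
  using dim_perp_le[OF assms] dim_perp_le[OF assms(2,1)] by simp

section \<open>Totally isotropic subspaces, vertices and gates\<close>

lemma TI_subspace: "TI U \<Longrightarrow> vec.subspace U"
  and TI_sing: "TI U \<Longrightarrow> x \<in> U \<Longrightarrow> sing x"
  and TI_perp: "TI U \<Longrightarrow> U \<subseteq> perp U"
  by (auto simp: TI_iff perp_def)

lemma TI_subset: "TI U \<Longrightarrow> vec.subspace h \<Longrightarrow> h \<subseteq> U \<Longrightarrow> TI h"
  by (auto simp: TI_iff)

lemma TI_span_insert: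
  assumes U: "TI U" and w: "sing w" "w \<in> perp U"
  shows "TI (vec.span (insert w U))"
proof -
  have uw: "f u w = 0" "f w u = 0" if "u \<in> U" for u using w that f_sym by (auto simp: perp_def)
  have "sing (u + c *s w)" if "u \<in> U" for u c
    using that uw U w TI_sing by (intro sing_add sing_scale f_scale_right0) auto
  moreover have "f (u + c *s w) (u' + c' *s w) = 0" if "u \<in> U" "u' \<in> U" for u u' c c'
  proof -
    have "f u u' = 0" using U that by (simp add: TI_iff)
    then have "f u (u' + c' *s w) = 0" "f w (u' + c' *s w) = 0"
      using uw that w f_sing by (auto intro!: f_add_right0 f_scale_right0)
    then show ?thesis by (simp add: f_add f_scale)
  qed
  ultimately show ?thesis
    unfolding TI_iff[of "vec.span (insert w U)"] Ball_def span_insert_iff[OF TI_subspace[OF U]] by auto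
qed

lemma TI_zero: "TI {0}"
  by (simp add: TI_iff sing_zero f_zero vec.subspace_single_0)

lemma dim_TI_le: "TI U \<Longrightarrow> vec.dim U \<le> D"
  unfolding witt_def by (rule Max_ge) auto

lemma ex_TI_dim: "\<exists>U. TI U \<and> vec.dim U = D"
proof -
  have "D \<in> vec.dim ` {U. TI U}" unfolding witt_def using TI_zero by (intro Max_in) auto
  then show ?thesis by auto
qed

lemma vertex_TI: "U \<in> V \<Longrightarrow> TI U"
  and vertex_subspace: "U \<in> V \<Longrightarrow> vec.subspace U"
  by (auto simp: dp_vertices_def TI_iff)

lemma vertex_absorb: "U \<in> V \<Longrightarrow> sing w \<Longrightarrow> w \<in> perp U \<Longrightarrow> w \<in> U"
  using TI_span_insert[of U w] subset_span_insert(1)[of U w] subset_span_insert(2)[of w U]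
  unfolding dp_vertices_def by blast

text \<open>Vectors of a largest \<open>W\<close> that are orthogonal to \<open>U\<close> are
  absorbed by the maximal \<open>U\<close>, so \<open>W \<inter> perp U\<close> is contained in
  \<open>U \<inter> perp W\<close>; the rank identity turns this into dim W \<le> dim U.\<close>

lemma vertex_dim:
  assumes "U \<in> V" shows "vec.dim U = D"
proof (rule ccontr)
  assume "vec.dim U \<noteq> D"
  then have less: "vec.dim U < D" using dim_TI_le[OF vertex_TI[OF assms]] by simp
  obtain W where W: "TI W" "vec.dim W = D" using ex_TI_dim by auto
  have "W \<inter> perp U \<subseteq> U \<inter> perp W"
    using vertex_absorb[OF assms] TI_sing[OF W(1)] TI_perp[OF W(1)] by auto
  then have "vec.dim (W \<inter> perp U) \<le> vec.dim (U \<inter> perp W)" by (rule vec.dim_subset)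
  moreover have "vec.dim U + vec.dim (W \<inter> perp U) = vec.dim W + vec.dim (U \<inter> perp W)"
    using dim_perp_eq vertex_subspace[OF assms] TI_subspace[OF W(1)] by blast
  ultimately show False using less W by simp
qed

lemma vertexI:
  assumes "TI U" "vec.dim U = D" shows "U \<in> V"
  unfolding dp_vertices_def
proof (intro CollectI conjI allI impI)
  fix W assume "TI W \<and> U \<subseteq> W"
  then show "W = U" using assms dim_TI_le[of W] by (intro subspace_dim_eqI[symmetric]) (auto simp: TI_iff)
qed fact

text \<open>Since \<open>h \<inter> perp y = h \<inter> y\<close>, the rank identity makes
  \<open>y \<inter> perp h\<close> exactly one dimension larger than \<open>h \<inter> y\<close>;
  adjoining one of its new vectors to \<open>h\<close> gives the gate. Any other \<open>c\<close> in
  the pencil meets \<open>y\<close> inside \<open>perp h \<inter> y\<close>, hence inside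
  \<open>g\<close>, hence inside c \<inter> g = h.\<close>

lemma pencil_gate:
  assumes h: "TI h" "Suc (vec.dim h) = D" and y: "y \<in> V"
  obtains g where "g \<in> V" "h \<subseteq> g" "g \<inter> y = perp h \<inter> y" "vec.dim (g \<inter> y) = Suc (vec.dim (h \<inter> y))"
    "\<And>c. c \<in> V \<Longrightarrow> h \<subseteq> c \<Longrightarrow> c \<noteq> g \<Longrightarrow> c \<inter> y = h \<inter> y"
proof -
  note hs = TI_subspace[OF h(1)] and ys = vertex_subspace[OF y]
  have "h \<inter> perp y = h \<inter> y"
    using vertex_absorb[OF y] TI_sing[OF h(1)] TI_perp[OF vertex_TI[OF y]] by auto
  then have d: "vec.dim (y \<inter> perp h) = Suc (vec.dim (h \<inter> y))"
    using dim_perp_eq[OF ys hs] vertex_dim[OF y] h(2) by simp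
  obtain w where w: "w \<in> y" "w \<in> perp h" "w \<notin> h"
  proof (rule ccontr)
    assume "\<not> thesis"
    then have "y \<inter> perp h \<subseteq> h \<inter> y" using that by auto
    then show False using d vec.dim_subset by (metis Suc_n_not_le_n)
  qed
  define g where "g = vec.span (insert w h)"
  have sw: "sing w" using TI_sing[OF vertex_TI[OF y]] w by auto
  have g: "TI g" "h \<subseteq> g" "vec.dim g = D"
    unfolding g_def using TI_span_insert[OF h(1) sw w(2)] subset_span_insert dim_span_insert[OF hs w(3)] h(2)
    by auto
  have gV: "g \<in> V" using g by (intro vertexI)
  have "g \<subseteq> perp h" using TI_perp[OF g(1)] perp_anti[OF g(2)] by blast
  moreover have "perp h \<inter> y \<subseteq> g"
  proof
    fix v assume v: "v \<in> perp h \<inter> y"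
    have "f v w = 0" using v w TI_perp[OF vertex_TI[OF y]] by (auto simp: perp_def)
    then have "v \<in> perp (insert w h)" using v by (auto simp: perp_def)
    then have "v \<in> perp g" unfolding g_def perp_span .
    then show "v \<in> g" using vertex_absorb[OF gV] TI_sing[OF vertex_TI[OF y]] v by auto
  qed
  ultimately have gy: "g \<inter> y = perp h \<inter> y" by auto
  have "c \<inter> y = h \<inter> y" if c: "c \<in> V" "h \<subseteq> c" "c \<noteq> g" for c
  proof -
    have "c \<subseteq> perp h" using TI_perp[OF vertex_TI[OF c(1)]] perp_anti[OF c(2)] by blast
    then have "c \<inter> y \<subseteq> g" using gy by auto
    moreover have "c \<inter> g = h"
      using c g gV hs h(2) vertex_subspace vertex_dim
      by (intro dim_Int_Suc_if_neq[where d = "vec.dim h"]) auto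
    ultimately show ?thesis using c by auto
  qed
  then show thesis using that gV g(2) gy d by (metis Int_commute)
qed

lemma dim_Int_pencil:
  assumes h: "TI h" "Suc (vec.dim h) = D" and y: "y \<in> V" and c: "c \<in> V" "h \<subseteq> c"
  shows "vec.dim (c \<inter> y) \<le> Suc (vec.dim (h \<inter> y))" "vec.dim (h \<inter> y) \<le> vec.dim (c \<inter> y)"
proof -
  obtain g where "vec.dim (g \<inter> y) = Suc (vec.dim (h \<inter> y))" "\<And>c. c \<in> V \<Longrightarrow> h \<subseteq> c \<Longrightarrow> c \<noteq> g \<Longrightarrow> c \<inter> y = h \<inter> y"
    using pencil_gate[OF h y] by metis
  then show "vec.dim (c \<inter> y) \<le> Suc (vec.dim (h \<inter> y))" using c by (metis le_Suc_eq order_refl)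
  show "vec.dim (h \<inter> y) \<le> vec.dim (c \<inter> y)" using c by (intro vec.dim_subset) auto
qed

lemma ex_hyp:
  assumes "vec.subspace y" "vec.subspace P" "P \<subseteq> y" "P \<noteq> (y :: ('k^'n) set)"
  shows "\<exists>h. h \<in> hyps y P"
proof -
  obtain v where "v \<in> y" "v \<notin> P" using assms by auto
  then have "card {h \<in> hyps y P. v \<notin> h} > 0" using card_hyps_avoiding[OF assms(1-3)] by simp
  then have "{h \<in> hyps y P. v \<notin> h} \<noteq> {}" by (metis card.empty less_irrefl)
  then show ?thesis by blast
qed

lemma hyps_TI: "y \<in> V \<Longrightarrow> h \<in> hyps y P \<Longrightarrow> TI h \<and> Suc (vec.dim h) = D \<and> h \<subseteq> y \<and> P \<subseteq> h"
  using TI_subset vertex_TI vertex_dim by (auto simp: hyps_def)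

section \<open>Graph distance as codimension of the intersection\<close>

lemma adj_hyp:
  assumes "dp_adj TI y w" "D > 0"
  shows "y \<in> V" "w \<in> V" "y \<inter> w \<in> hyps y {}" "y \<noteq> w"
proof -
  show *: "y \<in> V" "w \<in> V" using assms by (auto simp: dp_adj_def)
  show "y \<inter> w \<in> hyps y {}"
    using assms vertex_subspace[OF *(1)] vertex_subspace[OF *(2)] vertex_dim[OF *(1)]
    by (auto simp: dp_adj_def hyps_def vec.subspace_inter)
  \<comment> \<open>Positivity of \<open>D\<close> matters: for D = 0 the truncated D - 1 would make
    a vertex adjacent to itself.\<close>
  show "y \<noteq> w" using assms vertex_dim[OF *(1)] by (auto simp: dp_adj_def)
qed

lemma pencil_adj:
  assumes h: "TI h" "Suc (vec.dim h) = D" and "y \<in> V" "w \<in> V" "h \<subseteq> y" "h \<subseteq> w" "y \<noteq> w"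
  shows "y \<inter> w = h" "dp_adj TI y w"
proof -
  show "y \<inter> w = h"
    using assms vertex_subspace vertex_dim TI_subspace
    by (intro dim_Int_Suc_if_neq[where d = "vec.dim h"]) auto
  then show "dp_adj TI y w" using assms by (auto simp: dp_adj_def)
qed

text \<open>Two adjacent vertices lie in the pencil of their intersection, and within a pencil the
  dimension of the intersection with \<open>u\<close> varies by at most one.\<close>

lemma relpow_dim:
  assumes "(u, w) \<in> dp_rel TI ^^ m" "u \<in> V" "D > 0"
  shows "w \<in> V \<and> D \<le> vec.dim (u \<inter> w) + m"
  using assms(1)
proof (induction m arbitrary: w)
  case 0
  then show ?case using vertex_dim assms by simp
next
  case (Suc m)
  then obtain w' where w': "(u, w') \<in> dp_rel TI ^^ m" "dp_adj TI w' w" by (auto simp: dp_rel_def)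
  have *: "TI (w' \<inter> w)" "Suc (vec.dim (w' \<inter> w)) = D" "w' \<in> V" "w \<in> V"
    using adj_hyp[OF w'(2) assms(3)] hyps_TI by auto
  have "vec.dim (w' \<inter> u) \<le> Suc (vec.dim (w' \<inter> w \<inter> u))" "vec.dim (w' \<inter> w \<inter> u) \<le> vec.dim (w \<inter> u)"
    using dim_Int_pencil[OF *(1,2) assms(2)] * by auto
  then show ?case using Suc.IH[OF w'(1)] * by (simp add: Int_commute)
qed

text \<open>The path is built backwards from \<open>w\<close>: take a hyperplane of \<open>w\<close>
  containing \<open>u \<inter> w\<close>. The gate of its pencil towards \<open>u\<close> is a
  neighbour of \<open>w\<close> meeting \<open>u\<close> in one dimension more.\<close>

lemma relpow_ex:
  assumes "u \<in> V" "w \<in> V" "D = vec.dim (u \<inter> w) + m"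
  shows "(u, w) \<in> dp_rel TI ^^ m"
  using assms(2,3)
proof (induction m arbitrary: w)
  case 0
  have s: "vec.subspace u" "vec.subspace w" "vec.dim u = D" "vec.dim w = D"
    using 0 assms vertex_subspace vertex_dim by blast+
  have "u \<inter> w = u" "u \<inter> w = w"
    using s 0(2) by (intro subspace_dim_eqI; simp add: vec.subspace_inter)+
  then show ?case by simp
next
  case (Suc m)
  have d: "vec.dim (u \<inter> w) < D" using Suc.prems(2) by linarith
  then have "u \<inter> w \<noteq> w" using vertex_dim[OF Suc.prems(1)] by (metis less_irrefl)
  then obtain h where h: "h \<in> hyps w (u \<inter> w)"
    using ex_hyp[of w "u \<inter> w"] vertex_subspace[OF Suc.prems(1)] vertex_subspace[OF assms(1)]
    by (auto simp: vec.subspace_inter)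
  then have h': "TI h" "Suc (vec.dim h) = D" "h \<subseteq> w" "h \<inter> u = u \<inter> w" using hyps_TI[OF Suc.prems(1) h] by auto
  obtain g where g: "g \<in> V" "h \<subseteq> g" "vec.dim (g \<inter> u) = Suc (vec.dim (h \<inter> u))"
    using pencil_gate[OF h'(1,2) assms(1)] by metis
  have d': "vec.dim (u \<inter> g) = Suc (vec.dim (u \<inter> w))" using g(3) h'(4) by (simp only: Int_commute)
  then have "g \<noteq> w" by auto
  then have "dp_adj TI g w" using pencil_adj(2)[OF h'(1,2) g(1) Suc.prems(1) g(2) h'(3)] by blast
  moreover have "(u, g) \<in> dp_rel TI ^^ m"
    by (rule Suc.IH[OF g(1)]) (use d' Suc.prems(2) in linarith)
  ultimately show ?case by (auto simp: dp_rel_def)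
qed

lemma dp_dist_eq:
  assumes "u \<in> V" "w \<in> V" "D > 0"
  shows "dp_dist TI u w = D - vec.dim (u \<inter> w)"
  unfolding dp_dist_def
proof (rule Least_equality)
  have "vec.dim (u \<inter> w) \<le> D" using vertex_dim[OF assms(1)] by (metis Int_lower1 vec.dim_subset)
  then show "(u, w) \<in> dp_rel TI ^^ (D - vec.dim (u \<inter> w))" using assms by (intro relpow_ex) auto
  show "D - vec.dim (u \<inter> w) \<le> m" if "(u, w) \<in> dp_rel TI ^^ m" for m
    using relpow_dim[OF that] assms by simp
qed

text \<open>The minimum is attained at the gate, which accounts for the \<open>Suc\<close>;
  \<open>dim_Int_pencil\<close> shows that no member of the pencil does better.\<close>

lemma dp_setdist_eq:
  assumes h: "TI h" "Suc (vec.dim h) = D" and y: "y \<in> V"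
  shows "dp_setdist TI {c \<in> V. h \<subseteq> c} y = D - Suc (vec.dim (h \<inter> y))"
  unfolding dp_setdist_def
proof (rule Least_equality)
  obtain g where g: "g \<in> V" "h \<subseteq> g" "vec.dim (g \<inter> y) = Suc (vec.dim (h \<inter> y))"
    using pencil_gate[OF h y] by metis
  have "vec.dim (g \<inter> y) \<le> D" using vertex_dim[OF y] by (metis Int_lower2 vec.dim_subset)
  then have "(g, y) \<in> dp_rel TI ^^ (D - Suc (vec.dim (h \<inter> y)))" using g y by (intro relpow_ex) auto
  then show "\<exists>c\<in>{c \<in> V. h \<subseteq> c}. (c, y) \<in> dp_rel TI ^^ (D - Suc (vec.dim (h \<inter> y)))" using g by auto
  show "D - Suc (vec.dim (h \<inter> y)) \<le> m" if "\<exists>c\<in>{c \<in> V. h \<subseteq> c}. (c, y) \<in> dp_rel TI ^^ m" for m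
    using that relpow_dim dim_Int_pencil(1)[OF h y] h(2) by fastforce
qed

end

section \<open>Pencils of maximal subspaces\<close>

lemma dim_Int_hyp:
  fixes A :: "('k::field^'n) set"
  assumes A: "vec.subspace A" and g: "vec.subspace g" and h: "h \<in> hyps g P"
  shows "vec.dim (A \<inter> g) \<le> Suc (vec.dim (A \<inter> h))"
proof (cases "A \<inter> g \<subseteq> h")
  case True
  then have "vec.dim (A \<inter> g) \<le> vec.dim (A \<inter> h)" by (intro vec.dim_subset) auto
  then show ?thesis by simp
next
  case False
  then obtain w where w: "w \<in> A" "w \<in> g" "w \<notin> h" by auto
  have s: "vec.subspace (A \<inter> h)" using A h by (auto simp: hyps_def vec.subspace_inter)
  have "A \<inter> g \<subseteq> vec.span (insert w (A \<inter> h))"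
  proof
    fix x assume x: "x \<in> A \<inter> g"
    obtain a where "x - a *s w \<in> h" using hyp_decomp[OF g h w(2,3)] x by blast
    moreover have "x - a *s w \<in> A" using A x w by (simp add: vec.subspace_diff vec.subspace_scale)
    ultimately show "x \<in> vec.span (insert w (A \<inter> h))"
      using span_insert_iff[OF s] by (metis IntI diff_add_cancel)
  qed
  then have "vec.dim (A \<inter> g) \<le> vec.dim (vec.span (insert w (A \<inter> h)))" by (rule vec.dim_subset)
  then show ?thesis using dim_span_insert(1)[OF s] w by auto
qed

context polar_form
begin

text \<open>By \<open>rad_sing\<close>, a totally isotropic \<open>h\<close> meets the radical only
  in zero; then the rank identity against \<open>UNIV\<close> gives the usual formula even for a
  degenerate pairing.\<close>

lemma dim_perp: "TI h \<Longrightarrow> vec.dim (perp h) + vec.dim h = CARD('n)"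
proof -
  assume h: "TI h"
  have "h \<inter> perp UNIV \<subseteq> {0}" using rad_sing TI_sing[OF h] by (auto simp: perp_def)
  then have "h \<inter> perp UNIV = {0}"
    using vec.subspace_0[OF TI_subspace[OF h]] by (auto simp: perp_def f_zero)
  then show ?thesis using dim_perp_eq[OF vec.subspace_UNIV TI_subspace[OF h]] vec_dim_card[where 'a='k and 'n='n]
    by simp
qed

text \<open>Both sides count, with suitable multiplicity, the singular vectors \<open>v\<close> orthogonal to \<open>h\<close>
  with \<open>f v u = 1\<close> for a fixed \<open>u \<in> y - h\<close>: on the left according to the vertex spanned by \<open>h\<close> and \<open>v\<close>,
  on the right along the lines \<open>v + a u\<close>.\<close>

lemma card_pencil:
  assumes count: "\<And>u v. sing u \<Longrightarrow> f v u = 1 \<Longrightarrow> card {a. sing (v + a *s u)} = k"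
    and y: "y \<in> V" and h: "h \<in> hyps y P"
  shows "CARD('k) ^ D * card {c \<in> V. h \<subseteq> c \<and> c \<noteq> y} = CARD('k) ^ (CARD('n) - D) * k"
proof -
  have h': "TI h" "Suc (vec.dim h) = D" "h \<subseteq> y" using hyps_TI[OF y h] by auto
  note hs = TI_subspace[OF h'(1)] and ys = vertex_subspace[OF y] and yd = vertex_dim[OF y]
  have "h \<noteq> y" using h'(2) yd by auto
  then obtain u where u: "u \<in> y" "u \<notin> h" using h'(3) by auto
  have su: "sing u" using u TI_sing[OF vertex_TI[OF y]] by auto
  have uy: "u \<in> perp y" using TI_perp[OF vertex_TI[OF y]] u by auto
  have hu: "f v u = 0" if "v \<in> h" for v using that uy h'(3) f_sym by (auto simp: perp_def)
  have yspan: "y = vec.span (insert u h)"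
    using hs ys u h' yd by (intro subspace_dim_eqI[symmetric] span_insert_least) (auto simp: dim_span_insert)
  have py: "perp y = {v \<in> perp h. f v u = 0}" unfolding yspan perp_span by (auto simp: perp_def)
  define A where "A = {v \<in> perp h. f v u = 1}"
  define A' where "A' = {v \<in> A. sing v}"
  define L where "L = {c \<in> V. h \<subseteq> c \<and> c \<noteq> y}"
  \<comment> \<open>The two dimensions differ by one, so some vector orthogonal to \<open>h\<close>
    pairs nontrivially with \<open>u\<close>; after scaling, \<open>A\<close> becomes a coset of
    \<open>perp y\<close>.\<close>
  have "\<not> perp h \<subseteq> perp y"
  proof
    assume "perp h \<subseteq> perp y"
    then have "vec.dim (perp h) \<le> vec.dim (perp y)" by (rule vec.dim_subset)
    then show False using dim_perp[OF h'(1)] dim_perp[OF vertex_TI[OF y]] h'(2) yd by simp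
  qed
  then obtain v' where v': "v' \<in> perp h" "f v' u \<noteq> 0" unfolding py by auto
  define v0 where "v0 = inverse (f v' u) *s v'"
  have v0: "v0 \<in> perp h" "f v0 u = 1"
    using v' subspace_perp by (auto simp: v0_def f_scale vec.subspace_scale)
  have "A = (+) v0 ` perp y"
  proof (intro set_eqI iffI)
    fix v assume "v \<in> A"
    then have "v - v0 \<in> perp y" unfolding py A_def using v0 subspace_perp by (auto simp: f_diff vec.subspace_diff)
    then show "v \<in> (+) v0 ` perp y" by (metis add.commute diff_add_cancel image_eqI)
  qed (use v0 subspace_perp in \<open>auto simp: A_def py f_add vec.subspace_add\<close>)
  then have "card A = card (perp y)" by (simp add: card_image)
  also have "\<dots> = CARD('k) ^ (CARD('n) - D)"
    using card_subspace[OF subspace_perp[of y]] dim_perp[OF vertex_TI[OF y]] yd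
    by (metis diff_add_inverse2)
  finally have cardA: "card A = CARD('k) ^ (CARD('n) - D)" .
  \<comment> \<open>Translation by a multiple of \<open>u\<close> permutes \<open>A\<close>, because
    \<open>u\<close> is orthogonal to \<open>h\<close> and to itself. Thus every \<open>a\<close>
    contributes equally to the count of pairs (v, a).\<close>
  have "card {v \<in> A. sing (v + a *s u)} = card A'" for a
  proof (rule bij_betw_same_card[of "\<lambda>v. v + a *s u"], unfold bij_betw_def, intro conjI)
    have "f u u = 0" "u \<in> perp h" using f_sing[OF su] uy perp_anti[OF h'(3)] by auto
    then have mem: "v + b *s u \<in> A" if "v \<in> A" for v b
      using that subspace_perp by (auto simp: A_def f_add f_scale vec.subspace_add vec.subspace_scale)
    show "(\<lambda>v. v + a *s u) ` {v \<in> A. sing (v + a *s u)} = A'"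
    proof (intro set_eqI iffI)
      fix v assume v: "v \<in> A'"
      define v1 where "v1 = v + (-a) *s u"
      have "v1 + a *s u = v" by (simp add: v1_def vec.scale_minus_left)
      moreover have "v1 \<in> A" unfolding v1_def using v by (intro mem) (simp add: A'_def)
      ultimately show "v \<in> (\<lambda>v. v + a *s u) ` {v \<in> A. sing (v + a *s u)}"
        using v by (intro image_eqI[of _ _ v1]) (auto simp: A'_def)
    qed (auto simp: A'_def mem)
  qed (auto intro: inj_onI)
  then have "(\<Sum>v\<in>A. card {a \<in> UNIV. sing (v + a *s u)}) = (\<Sum>a\<in>(UNIV :: 'k set). card A')"
    by (intro sum_multicount_gen) auto
  moreover have "(\<Sum>v\<in>A. card {a \<in> UNIV. sing (v + a *s u)}) = (\<Sum>v\<in>A. k)"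
    by (intro sum.cong) (auto simp: count[OF su] A_def)
  ultimately have lines: "card A * k = CARD('k) * card A'" by simp
  \<comment> \<open>On \<open>c\<close> the pairing with \<open>u\<close> has kernel exactly
    \<open>h\<close>: a vector of the kernel is in \<open>perp y\<close>, so it is absorbed by
    \<open>y\<close>, and \<open>c \<inter> y = h\<close>. The level set is a coset of
    \<open>h\<close>.\<close>
  have fib: "card {v \<in> c. f v u = 1} = CARD('k) ^ vec.dim h" if c: "c \<in> L" for c
  proof -
    have c': "c \<in> V" "h \<subseteq> c" "c \<noteq> y" using c by (auto simp: L_def)
    note cs = vertex_subspace[OF c'(1)]
    have ch: "c \<inter> y = h" using pencil_adj(1)[OF h'(1,2) c'(1) y c'(2) h'(3) c'(3)] .
    have ker: "v \<in> h" if "v \<in> c" "f v u = 0" for v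
    proof -
      have "v \<in> perp h" using TI_perp[OF vertex_TI[OF c'(1)]] perp_anti[OF c'(2)] that by auto
      then have "v \<in> y" using vertex_absorb[OF y] TI_sing[OF vertex_TI[OF c'(1)]] that py by auto
      then show ?thesis using ch that by auto
    qed
    have "h \<noteq> c" using h'(2) vertex_dim[OF c'(1)] by auto
    then obtain w where w: "w \<in> c" "w \<notin> h" using c'(2) by auto
    then have fw: "f w u \<noteq> 0" using ker by auto
    define w0 where "w0 = inverse (f w u) *s w"
    have w0: "w0 \<in> c" "f w0 u = 1" using w fw cs by (auto simp: w0_def f_scale vec.subspace_scale)
    have "{v \<in> c. f v u = 1} = (+) w0 ` h"
    proof (intro set_eqI iffI)
      fix v assume "v \<in> {v \<in> c. f v u = 1}"
      then have "v - w0 \<in> h" using w0 cs by (intro ker) (auto simp: f_diff vec.subspace_diff)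
      then show "v \<in> (+) w0 ` h" by (metis add.commute diff_add_cancel image_eqI)
    next
      fix v assume "v \<in> (+) w0 ` h"
      then obtain w' where "w' \<in> h" "v = w0 + w'" by auto
      then show "v \<in> {v \<in> c. f v u = 1}" using w0 c'(2) cs hu by (auto simp: f_add vec.subspace_add)
    qed
    then show ?thesis using card_subspace[OF hs] by (simp add: card_image)
  qed
  have "A' = (\<Union>c\<in>L. {v \<in> c. f v u = 1})"
  proof (intro set_eqI iffI)
    fix v assume v: "v \<in> A'"
    then have v': "sing v" "v \<in> perp h" "f v u = 1" by (auto simp: A'_def A_def)
    have vh: "v \<notin> h" using hu v' by auto
    define c where "c = vec.span (insert v h)"
    have "c \<in> V" unfolding c_def using TI_span_insert[OF h'(1) v'(1,2)] dim_span_insert[OF hs vh] h'(2) by (intro vertexI) auto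
    moreover have "h \<subseteq> c" "v \<in> c" unfolding c_def by (rule subset_span_insert)+
    moreover have "c \<noteq> y" using \<open>v \<in> c\<close> v'(3) uy f_sym by (auto simp: perp_def)
    ultimately show "v \<in> (\<Union>c\<in>L. {v \<in> c. f v u = 1})" using v' by (auto simp: L_def)
  next
    fix v assume "v \<in> (\<Union>c\<in>L. {v \<in> c. f v u = 1})"
    then obtain c where c: "c \<in> V" "h \<subseteq> c" "v \<in> c" "f v u = 1" by (auto simp: L_def)
    then have "v \<in> perp h" "sing v"
      using TI_perp[OF vertex_TI[OF c(1)]] perp_anti[OF c(2)] TI_sing[OF vertex_TI[OF c(1)]] by auto
    then show "v \<in> A'" using c by (auto simp: A'_def A_def)
  qed
  moreover have "card (\<Union>c\<in>L. {v \<in> c. f v u = 1}) = (\<Sum>c\<in>L. card {v \<in> c. f v u = 1})"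
  proof (rule card_UN_disjoint)
    show "\<forall>c\<in>L. \<forall>d\<in>L. c \<noteq> d \<longrightarrow> {v \<in> c. f v u = 1} \<inter> {v \<in> d. f v u = 1} = {}"
    proof (intro ballI impI)
      fix c d assume "c \<in> L" "d \<in> L" "c \<noteq> d"
      then have "c \<inter> d = h" using pencil_adj(1)[OF h'(1,2)] by (auto simp: L_def)
      then have "f v u = 0" if "v \<in> c" "v \<in> d" for v using that hu by auto
      then show "{v \<in> c. f v u = 1} \<inter> {v \<in> d. f v u = 1} = {}" by fastforce
    qed
  qed simp_all
  ultimately have "card A' = card L * CARD('k) ^ vec.dim h" by (simp add: fib)
  then have "card A * k = CARD('k) ^ D * card L" using lines h'(2) by (metis mult.assoc mult.commute power_Suc)
  then show ?thesis unfolding cardA L_def by simp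
qed

end

text \<open>A pencil has \<open>s + 1\<close> vertices. With \<open>s\<close> a natural number the
  geometry proceeds without the exponent \<open>e\<close>; positivity says that each hyperplane of a
  vertex lies in a second vertex.\<close>

locale polar_order = polar_form f sing TI
  for f :: "('k::{field,finite})^('n::finite) \<Rightarrow> 'k^'n \<Rightarrow> 'k" and sing TI +
  fixes s :: nat
  assumes card_line: "y \<in> V \<Longrightarrow> h \<in> hyps y {} \<Longrightarrow> card {c \<in> V. h \<subseteq> c \<and> c \<noteq> y} = s"
    and s_pos: "s > 0"
begin

section \<open>Maximal cliques and the lines through a vertex\<close>

lemma hyps_empty: "h \<in> hyps y P \<Longrightarrow> h \<in> hyps y {}"
  by (simp add: hyps_def)

lemma ex_other_vertex:
  assumes "y \<in> V" "h \<in> hyps y P"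
  shows "\<exists>c\<in>V. h \<subseteq> c \<and> c \<noteq> y"
proof (rule ccontr)
  assume "\<not> ?thesis"
  then have "{c \<in> V. h \<subseteq> c \<and> c \<noteq> y} = {}" by auto
  then show False using card_line[OF assms(1) hyps_empty[OF assms(2)]] s_pos by (metis card.empty less_irrefl)
qed

lemma hyp_of_pencil:
  assumes "TI h" "Suc (vec.dim h) = D" "y \<in> V" "h \<subseteq> y"
  shows "h \<in> hyps y {}"
  using assms vertex_dim[OF assms(3)] by (auto simp: hyps_def TI_iff)

text \<open>The clique has a second vertex \<open>x'\<close>, as otherwise the pencil of a
  hyperplane of \<open>x\<close> would be larger. For a further member \<open>w\<close>, at most one
  of \<open>x\<close>, \<open>x'\<close> is the gate of the pencil on
  \<open>z = x \<inter> x'\<close> towards \<open>w\<close>. The other one meets \<open>w\<close> in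
  \<open>z \<inter> w\<close>, which by adjacency has dimension D - 1, so \<open>z\<close> lies in
  \<open>w\<close>.\<close>

lemma max_clique_pencil:
  assumes C: "dp_max_clique TI C" and x: "x \<in> C" and D: "D > 0"
  obtains z where "TI z" "Suc (vec.dim z) = D" "z \<subseteq> x" "C = {c \<in> V. z \<subseteq> c}"
proof -
  have CV: "C \<subseteq> V" and adj: "\<And>a b. a \<in> C \<Longrightarrow> b \<in> C \<Longrightarrow> a \<noteq> b \<Longrightarrow> dp_adj TI a b"
    and mx: "\<And>C'. C \<subseteq> C' \<Longrightarrow> C' \<subseteq> V \<Longrightarrow> (\<forall>a\<in>C'. \<forall>b\<in>C'. a \<noteq> b \<longrightarrow> dp_adj TI a b) \<Longrightarrow> C' = C"
    using C by (auto simp: dp_max_clique_def)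
  have clq: "\<forall>a\<in>{c \<in> V. h \<subseteq> c}. \<forall>b\<in>{c \<in> V. h \<subseteq> c}. a \<noteq> b \<longrightarrow> dp_adj TI a b"
    if "TI h" "Suc (vec.dim h) = D" for h
    using pencil_adj(2)[OF that] by auto
  have xV: "x \<in> V" using x CV by auto
  have "C \<noteq> {x}"
  proof
    assume Cx: "C = {x}"
    have "{0} \<noteq> x" using vertex_dim[OF xV] D by (metis vec.dim_span vec.span_empty vec.dim_empty less_irrefl)
    then obtain h where h: "h \<in> hyps x {0}"
      using ex_hyp[of x "{0}"] vertex_subspace[OF xV] vec.subspace_0 vec.subspace_single_0 by blast
    note h' = hyps_TI[OF xV h]
    obtain c where c: "c \<in> V" "h \<subseteq> c" "c \<noteq> x" using ex_other_vertex[OF xV h] by auto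
    have "{c \<in> V. h \<subseteq> c} = C" using clq h' Cx xV by (intro mx) auto
    then show False using c Cx by auto
  qed
  then obtain x' where x': "x' \<in> C" "x' \<noteq> x" using x by auto
  define z where "z = x \<inter> x'"
  have z: "TI z" "Suc (vec.dim z) = D" "z \<subseteq> x" "z \<subseteq> x'"
    using adj_hyp[OF adj[OF x x'(1)] D] x' hyps_TI unfolding z_def by auto
  have "z \<subseteq> w" if w: "w \<in> C" for w
  proof (cases "w = x \<or> w = x'")
    case True
    then show ?thesis using z by auto
  next
    case False
    have wV: "w \<in> V" "x' \<in> V" using w x' CV by auto
    have dims: "Suc (vec.dim (x \<inter> w)) = D" "Suc (vec.dim (x' \<inter> w)) = D"
      using adj_hyp(3)[OF adj[OF x w] D] adj_hyp(3)[OF adj[OF x'(1) w] D] False vertex_dim[OF xV] vertex_dim[OF wV(2)]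
      by (auto simp: hyps_def)
    obtain c where c: "c \<in> {x, x'}" "c \<inter> w = z \<inter> w"
      using pencil_gate[OF z(1,2) wV(1)] xV wV(2) x'(2) z(3,4) by (metis insertCI)
    then have "vec.dim (z \<inter> w) = vec.dim z" using dims z(2) by auto
    then have "z \<inter> w = z"
      using TI_subspace[OF z(1)] vertex_subspace[OF wV(1)] by (intro subspace_dim_eqI) (auto simp: vec.subspace_inter)
    then show ?thesis by auto
  qed
  then have "C \<subseteq> {c \<in> V. z \<subseteq> c}" using CV by auto
  then have "C = {c \<in> V. z \<subseteq> c}" using clq[OF z(1,2)] by (intro mx[symmetric]) auto
  then show thesis using that z by auto
qed

text \<open>A neighbour of \<open>y\<close> meets \<open>y\<close> in a hyperplane and belongs to
  the pencil of that hyperplane only, so the pencils through \<open>y\<close> partition the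
  neighbours.\<close>

lemma sum_adj:
  fixes F :: "('k^'n) set \<Rightarrow> 'c::comm_monoid_add"
  assumes y: "y \<in> V" and D: "D > 0"
  shows "(\<Sum>w | dp_adj TI y w. F w) = (\<Sum>h\<in>hyps y {}. \<Sum>c | c \<in> V \<and> h \<subseteq> c \<and> c \<noteq> y. F c)"
proof -
  have "{w. dp_adj TI y w} = (\<Union>h\<in>hyps y {}. {c. c \<in> V \<and> h \<subseteq> c \<and> c \<noteq> y})"
  proof (intro set_eqI iffI)
    fix w assume "w \<in> {w. dp_adj TI y w}"
    then show "w \<in> (\<Union>h\<in>hyps y {}. {c. c \<in> V \<and> h \<subseteq> c \<and> c \<noteq> y})"
      using adj_hyp[of y w] D by blast
  next
    fix w assume "w \<in> (\<Union>h\<in>hyps y {}. {c. c \<in> V \<and> h \<subseteq> c \<and> c \<noteq> y})"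
    then obtain h where "h \<in> hyps y {}" "w \<in> V" "h \<subseteq> w" "w \<noteq> y" by auto
    then show "w \<in> {w. dp_adj TI y w}" using hyps_TI[OF y] pencil_adj(2)[of h y w] y by auto
  qed
  moreover have "(\<Sum>w\<in>(\<Union>h\<in>hyps y {}. {c. c \<in> V \<and> h \<subseteq> c \<and> c \<noteq> y}). F w)
      = (\<Sum>h\<in>hyps y {}. \<Sum>c | c \<in> V \<and> h \<subseteq> c \<and> c \<noteq> y. F c)"
  proof (rule sum.UNION_disjoint; (intro ballI impI)?)
    fix h h' assume h: "h \<in> hyps y {}" "h' \<in> hyps y {}" "h \<noteq> h'"
    then have "y \<inter> c = h" "y \<inter> c = h'" if "c \<in> V" "h \<subseteq> c" "h' \<subseteq> c" "c \<noteq> y" for c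
      using hyps_TI[OF y h(1)] hyps_TI[OF y h(2)] pencil_adj(1)[of h y c] pencil_adj(1)[of h' y c] y that by auto
    then show "{c. c \<in> V \<and> h \<subseteq> c \<and> c \<noteq> y} \<inter> {c. c \<in> V \<and> h' \<subseteq> c \<and> c \<noteq> y} = {}"
      using h(3) by blast
  qed auto
  ultimately show ?thesis by simp
qed

end

section \<open>Neighbour sums of class functions\<close>

text \<open>The Gaussian integer [m]_q, taken complex because it multiplies coefficients of vectors
  in W.\<close>

definition qbr :: "nat \<Rightarrow> nat \<Rightarrow> complex" where
  "qbr q m = (of_nat q ^ m - 1) / (of_nat q - 1)"

lemma card_field_ge_2: "CARD('k::{field,finite}) \<ge> 2"
proof -
  have "card {0, 1 :: 'k} \<le> CARD('k)" by (intro card_mono) auto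
  then show ?thesis by simp
qed

lemma card_hyps_qbr:
  fixes y :: "(('k::{field,finite})^'n::finite) set"
  assumes "vec.subspace y" "vec.subspace P" "P \<subseteq> y"
  shows "of_nat (card (hyps y P)) = qbr CARD('k) (vec.dim y - vec.dim P)"
proof -
  have "of_nat (card (hyps y P) * (CARD('k) - 1)) = (of_nat (CARD('k) ^ (vec.dim y - vec.dim P) - 1) :: complex)"
    by (simp only: card_hyps[OF assms])
  moreover have "(of_nat CARD('k) :: complex) \<noteq> 1"
  proof -
    have "CARD('k) \<noteq> 1" using card_field_ge_2[where 'k='k] by linarith
    then show ?thesis using of_nat_eq_1_iff by blast
  qed
  moreover have "CARD('k) \<ge> 1" using card_field_ge_2[where 'k='k] by simp
  ultimately show ?thesis
    by (simp add: qbr_def field_simps of_nat_diff)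
qed

lemma hyps_zero: "vec.subspace y \<Longrightarrow> hyps y {} = hyps y {0}"
  by (auto simp: hyps_def vec.subspace_0)

context polar_order
begin

text \<open>A vertex of the pencil that meets \<open>w\<close> outside \<open>h\<close> must be the
  gate. Here \<open>y\<close> is, so every other vertex meets \<open>w\<close> just as
  \<open>h\<close> does.\<close>

lemma gate_far:
  assumes w: "w \<in> V" and y: "y \<in> V" and h: "h \<in> hyps y {}" and nsub: "\<not> w \<inter> y \<subseteq> h"
    and c: "c \<in> V" "h \<subseteq> c" "c \<noteq> y"
  shows "w \<inter> c = w \<inter> h"
proof -
  have h': "TI h" "Suc (vec.dim h) = D" "h \<subseteq> y" using hyps_TI[OF y h] by auto
  obtain g where g: "\<And>c. c \<in> V \<Longrightarrow> h \<subseteq> c \<Longrightarrow> c \<noteq> g \<Longrightarrow> c \<inter> w = h \<inter> w"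
    using pencil_gate[OF h'(1,2) w] by metis
  have "y = g" using g[of y] y h' nsub by auto
  then show ?thesis using g[of c] c by auto
qed

text \<open>Here \<open>y\<close> meets \<open>w\<close> only inside \<open>h\<close>, so it is not
  the gate: one other vertex of the pencil is closer to \<open>w\<close>, and the rest are as far
  away as \<open>y\<close>.\<close>

lemma gate_near:
  assumes w: "w \<in> V" and y: "y \<in> V" and h: "h \<in> hyps y {}" and sub: "w \<inter> y \<subseteq> h"
  obtains g where "g \<in> V" "h \<subseteq> g" "g \<noteq> y" "vec.dim (w \<inter> g) = Suc (vec.dim (w \<inter> y))"
    "\<And>c. c \<in> V \<Longrightarrow> h \<subseteq> c \<Longrightarrow> c \<noteq> g \<Longrightarrow> w \<inter> c = w \<inter> y"
proof -
  have h': "TI h" "Suc (vec.dim h) = D" "h \<subseteq> y" using hyps_TI[OF y h] by auto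
  have e: "h \<inter> w = w \<inter> y" using sub h' by auto
  obtain g where g: "g \<in> V" "h \<subseteq> g" "vec.dim (g \<inter> w) = Suc (vec.dim (h \<inter> w))"
      "\<And>c. c \<in> V \<Longrightarrow> h \<subseteq> c \<Longrightarrow> c \<noteq> g \<Longrightarrow> c \<inter> w = h \<inter> w"
    using pencil_gate[OF h'(1,2) w] by metis
  have "g \<noteq> y" using g(3) e by (auto simp: Int_commute)
  then show thesis using that[of g] g unfolding e by (auto simp: Int_commute)
qed

lemma sum_line_const:
  fixes F :: "('k^'n) set \<Rightarrow> complex"
  assumes "y \<in> V" "h \<in> hyps y {}" "\<And>c. c \<in> V \<Longrightarrow> h \<subseteq> c \<Longrightarrow> c \<noteq> y \<Longrightarrow> F c = b"
  shows "(\<Sum>c | c \<in> V \<and> h \<subseteq> c \<and> c \<noteq> y. F c) = of_nat s * b"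
proof -
  have "(\<Sum>c | c \<in> V \<and> h \<subseteq> c \<and> c \<noteq> y. F c) = (\<Sum>c | c \<in> V \<and> h \<subseteq> c \<and> c \<noteq> y. b)"
    using assms(3) by (intro sum.cong) auto
  then show ?thesis using card_line[OF assms(1,2)] by simp
qed

lemma sum_line_gate:
  fixes F :: "('k^'n) set \<Rightarrow> complex"
  assumes y: "y \<in> V" "h \<in> hyps y {}" and g: "g \<in> V" "h \<subseteq> g" "g \<noteq> y"
    and F: "\<And>c. c \<in> V \<Longrightarrow> h \<subseteq> c \<Longrightarrow> c \<noteq> y \<Longrightarrow> c \<noteq> g \<Longrightarrow> F c = b"
  shows "(\<Sum>c | c \<in> V \<and> h \<subseteq> c \<and> c \<noteq> y. F c) = F g + (of_nat s - 1) * b"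
proof -
  have "(\<Sum>c | c \<in> V \<and> h \<subseteq> c \<and> c \<noteq> y. F c - b) = (\<Sum>c\<in>{g}. F c - b)"
    using F g by (intro sum.mono_neutral_right) auto
  then have "(\<Sum>c | c \<in> V \<and> h \<subseteq> c \<and> c \<noteq> y. F c) - of_nat s * b = F g - b"
    using card_line[OF y] by (simp add: sum_subtractf)
  then show ?thesis by (simp add: algebra_simps)
qed

end

text \<open>The flag z < x encodes both base objects: the vertex \<open>x\<close> and the clique,
  which is the pencil of \<open>z\<close>.\<close>

locale polar_flag = polar_order f sing TI s
  for f :: "('k::{field,finite})^('n::finite) \<Rightarrow> 'k^'n \<Rightarrow> 'k" and sing TI s +
  fixes x z :: "('k^'n) set"
  assumes x: "x \<in> V" and z: "TI z" "Suc (vec.dim z) = D" "z \<subseteq> x"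
begin

text \<open>The distances from \<open>y\<close> to \<open>x\<close> and to the clique add up to the index of the basis vector
  supported on the class of \<open>y\<close>.\<close>

definition cls :: "('k^'n) set \<Rightarrow> nat" where
  "cls y = (D - vec.dim (x \<inter> y)) + (D - Suc (vec.dim (z \<inter> y)))"

lemma D_pos: "D > 0"
  using z by auto

lemma dims:
  assumes "y \<in> V"
  shows "vec.dim (z \<inter> y) \<le> vec.dim (x \<inter> y)" "vec.dim (x \<inter> y) \<le> Suc (vec.dim (z \<inter> y))"
    "vec.dim (x \<inter> y) \<le> D" "vec.dim (z \<inter> y) < D"
proof -
  show "vec.dim (z \<inter> y) \<le> vec.dim (x \<inter> y)" "vec.dim (x \<inter> y) \<le> Suc (vec.dim (z \<inter> y))"
    using dim_Int_pencil[OF z(1,2) assms x z(3)] by auto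
  show "vec.dim (x \<inter> y) \<le> D" using vertex_dim[OF x] by (metis Int_lower1 vec.dim_subset)
  have "vec.dim (z \<inter> y) \<le> vec.dim z" by (intro vec.dim_subset) auto
  then show "vec.dim (z \<inter> y) < D" using z by simp
qed

section \<open>How the class changes along a line through a vertex\<close>

lemma dim_Int_hyp_not_sub:
  assumes y: "y \<in> V" and h: "h \<in> hyps y {}" and A: "vec.subspace A" "\<not> A \<inter> y \<subseteq> h"
  shows "vec.dim (A \<inter> y) = Suc (vec.dim (A \<inter> h))"
proof -
  have hs: "vec.subspace h" "h \<subseteq> y" using h by (auto simp: hyps_def)
  note ys = vertex_subspace[OF y]
  have "vec.dim (A \<inter> h) \<noteq> vec.dim (A \<inter> y)"
  proof
    assume "vec.dim (A \<inter> h) = vec.dim (A \<inter> y)"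
    then have "A \<inter> h = A \<inter> y" using A hs ys by (intro subspace_dim_eqI) (auto simp: vec.subspace_inter)
    then show False using A by auto
  qed
  moreover have "vec.dim (A \<inter> h) \<le> vec.dim (A \<inter> y)" using hs by (intro vec.dim_subset) auto
  ultimately show ?thesis using dim_Int_hyp[OF A(1) ys h] by simp
qed

lemma subspaces: "vec.subspace x" "vec.subspace z" "y \<in> V \<Longrightarrow> vec.subspace (x \<inter> y)" "y \<in> V \<Longrightarrow> vec.subspace (z \<inter> y)"
  using vertex_subspace x z TI_subspace by (auto simp: vec.subspace_inter)

text \<open>As \<open>z\<close> lies in \<open>x\<close>, the vertex \<open>y\<close> is the gate
  towards \<open>x\<close>. Leaving it along the line costs one dimension in both intersections, so
  both distances grow by one.\<close>

lemma line_off: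
  assumes y: "y \<in> V" and h: "h \<in> hyps y {}" and nsub: "\<not> z \<inter> y \<subseteq> h"
  shows "(\<Sum>c | c \<in> V \<and> h \<subseteq> c \<and> c \<noteq> y. a (cls c)) = of_nat s * (a (cls y + 2) :: complex)"
proof (rule sum_line_const[OF y h])
  fix c assume c: "c \<in> V" "h \<subseteq> c" "c \<noteq> y"
  have nx: "\<not> x \<inter> y \<subseteq> h" using nsub z(3) by auto
  have xc: "x \<inter> c = x \<inter> h" using gate_far[OF x y h nx c] .
  have zc: "z \<inter> c = z \<inter> h" using xc z(3) by auto
  have "vec.dim (x \<inter> y) = Suc (vec.dim (x \<inter> h))" "vec.dim (z \<inter> y) = Suc (vec.dim (z \<inter> h))"
    using dim_Int_hyp_not_sub[OF y h] subspaces nx nsub by auto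
  then show "a (cls c) = a (cls y + 2)"
    using dims[OF y] z(2) unfolding cls_def xc zc by (intro arg_cong[where f = a]) simp
qed

context
  fixes y assumes y: "y \<in> V" and minus: "vec.dim (x \<inter> y) = Suc (vec.dim (z \<inter> y))"
begin

text \<open>Only the gate \<open>g\<close> towards \<open>x\<close> changes class. Its intersection
  with \<open>x\<close> grows by one; \<open>dims\<close> then forces the intersection with
  \<open>z\<close> to grow, and \<open>dim_Int_hyp\<close> limits that growth to one. Both distances
  drop.\<close>

lemma minus_line_near:
  assumes h: "h \<in> hyps y {}" and sub: "x \<inter> y \<subseteq> h"
  shows "(\<Sum>c | c \<in> V \<and> h \<subseteq> c \<and> c \<noteq> y. a (cls c)) = a (cls y - 2) + (of_nat s - 1) * (a (cls y) :: complex)"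
proof -
  obtain g where g: "g \<in> V" "h \<subseteq> g" "g \<noteq> y" "vec.dim (x \<inter> g) = Suc (vec.dim (x \<inter> y))"
    "\<And>c. c \<in> V \<Longrightarrow> h \<subseteq> c \<Longrightarrow> c \<noteq> g \<Longrightarrow> x \<inter> c = x \<inter> y"
    using gate_near[OF x y h sub] by metis
  have h': "TI h" "Suc (vec.dim h) = D" "h \<subseteq> y" using hyps_TI[OF y h] by auto
  have hg: "h \<in> hyps g {}" using hyp_of_pencil[OF h'(1,2) g(1,2)] .
  have "vec.dim (z \<inter> h) \<le> vec.dim (z \<inter> y)" using h' by (intro vec.dim_subset) auto
  then have "vec.dim (z \<inter> g) \<le> Suc (vec.dim (z \<inter> y))"
    using dim_Int_hyp[OF subspaces(2) vertex_subspace[OF g(1)] hg] by simp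
  then have zg: "vec.dim (z \<inter> g) = Suc (vec.dim (z \<inter> y))" using dims[OF g(1)] g(4) minus by simp
  have "cls g = cls y - 2" using zg g(4) dims[OF g(1)] minus unfolding cls_def by simp
  moreover have "a (cls c) = a (cls y)" if "c \<in> V" "h \<subseteq> c" "c \<noteq> y" "c \<noteq> g" for c
  proof -
    have "x \<inter> c = x \<inter> y" using g(5) that by auto
    moreover from this have "z \<inter> c = z \<inter> y" using z(3) by auto
    ultimately show ?thesis by (simp add: cls_def)
  qed
  ultimately show ?thesis using sum_line_gate[OF y h g(1-3), of "\<lambda>c. a (cls c)"] by simp
qed

text \<open>The vertex \<open>y\<close> is the gate towards \<open>x\<close>, so all others on the
  line are farther from \<open>x\<close>; they keep \<open>z \<inter> y\<close> and thus their
  distance from the clique.\<close>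

lemma minus_line_mid:
  assumes h: "h \<in> hyps y {}" and sub: "z \<inter> y \<subseteq> h" and nsub: "\<not> x \<inter> y \<subseteq> h"
  shows "(\<Sum>c | c \<in> V \<and> h \<subseteq> c \<and> c \<noteq> y. a (cls c)) = of_nat s * (a (cls y + 1) :: complex)"
proof (rule sum_line_const[OF y h])
  fix c assume c: "c \<in> V" "h \<subseteq> c" "c \<noteq> y"
  have xc: "x \<inter> c = x \<inter> h" using gate_far[OF x y h nsub c] .
  have hy: "h \<subseteq> y" using h by (auto simp: hyps_def)
  have zc: "z \<inter> c = z \<inter> y" using xc z(3) hy sub by auto
  have "vec.dim (x \<inter> y) = Suc (vec.dim (x \<inter> h))"
    using dim_Int_hyp_not_sub[OF y h] subspaces nsub by auto
  then show "a (cls c) = a (cls y + 1)"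
    using dims[OF y] minus z(2) unfolding cls_def xc zc by (intro arg_cong[where f = a]) simp
qed

end

context
  fixes y c0 assumes y: "y \<in> V" and plus: "vec.dim (x \<inter> y) = vec.dim (z \<inter> y)"
    and c0: "c0 \<in> V" "z \<subseteq> c0" "vec.dim (c0 \<inter> y) = Suc (vec.dim (z \<inter> y))"
begin

lemma plus_x: "x \<inter> y = z \<inter> y"
  using subspaces y plus z(3) by (intro subspace_dim_eqI[symmetric]) auto

text \<open>The gates of the line towards \<open>x\<close> and towards \<open>c0\<close> coincide:
  the latter meets \<open>z\<close> in more than \<open>z \<inter> y\<close>, so it cannot meet
  \<open>x\<close> only in \<open>x \<inter> y\<close>. At this common gate both distances
  drop.\<close>

lemma plus_line_near:
  assumes h: "h \<in> hyps y {}" and sub: "c0 \<inter> y \<subseteq> h"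
  shows "(\<Sum>c | c \<in> V \<and> h \<subseteq> c \<and> c \<noteq> y. a (cls c)) = a (cls y - 2) + (of_nat s - 1) * (a (cls y) :: complex)"
proof -
  have h': "TI h" "Suc (vec.dim h) = D" "h \<subseteq> y" using hyps_TI[OF y h] by auto
  have xsub: "x \<inter> y \<subseteq> h" using sub plus_x c0(2) by auto
  obtain g where g: "g \<in> V" "h \<subseteq> g" "g \<noteq> y" "vec.dim (x \<inter> g) = Suc (vec.dim (x \<inter> y))"
    "\<And>c. c \<in> V \<Longrightarrow> h \<subseteq> c \<Longrightarrow> c \<noteq> g \<Longrightarrow> x \<inter> c = x \<inter> y"
    using gate_near[OF x y h xsub] by metis
  obtain g' where g': "g' \<in> V" "h \<subseteq> g'" "vec.dim (c0 \<inter> g') = Suc (vec.dim (c0 \<inter> y))"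
    using gate_near[OF c0(1) y h sub] by metis
  have zg': "vec.dim (z \<inter> g') \<ge> Suc (vec.dim (z \<inter> y))"
    using dim_Int_pencil(1)[OF z(1,2) g'(1) c0(1,2)] g'(3) c0(3) by simp
  have "g' = g"
  proof (rule ccontr)
    assume "g' \<noteq> g"
    then have "x \<inter> g' = x \<inter> y" using g(5) g' by auto
    then show False using zg' dims(1)[OF g'(1)] plus by simp
  qed
  then have zg: "vec.dim (z \<inter> g) = Suc (vec.dim (z \<inter> y))" using zg' dims(1)[OF g(1)] g(4) plus by simp
  have "cls g = cls y - 2" using zg g(4) dims[OF g(1)] plus unfolding cls_def by simp
  moreover have "a (cls c) = a (cls y)" if "c \<in> V" "h \<subseteq> c" "c \<noteq> y" "c \<noteq> g" for c
  proof -
    have "x \<inter> c = x \<inter> y" using g(5) that by auto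
    moreover from this have "z \<inter> c = z \<inter> y" using z(3) by auto
    ultimately show ?thesis by (simp add: cls_def)
  qed
  ultimately show ?thesis using sum_line_gate[OF y h g(1-3), of "\<lambda>c. a (cls c)"] by simp
qed

text \<open>The vertex \<open>y\<close> is the gate towards \<open>c0\<close>, so no other vertex on
  the line meets \<open>z\<close> in more than \<open>y\<close> does. The gate towards
  \<open>x\<close> is still one step closer to \<open>x\<close>, which lowers the class by
  one.\<close>

lemma plus_line_mid:
  assumes h: "h \<in> hyps y {}" and sub: "z \<inter> y \<subseteq> h" and nsub: "\<not> c0 \<inter> y \<subseteq> h"
  shows "(\<Sum>c | c \<in> V \<and> h \<subseteq> c \<and> c \<noteq> y. a (cls c)) = a (cls y - 1) + (of_nat s - 1) * (a (cls y) :: complex)"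
proof -
  have h': "TI h" "Suc (vec.dim h) = D" "h \<subseteq> y" using hyps_TI[OF y h] by auto
  have xsub: "x \<inter> y \<subseteq> h" using sub plus_x by auto
  obtain g where g: "g \<in> V" "h \<subseteq> g" "g \<noteq> y" "vec.dim (x \<inter> g) = Suc (vec.dim (x \<inter> y))"
    "\<And>c. c \<in> V \<Longrightarrow> h \<subseteq> c \<Longrightarrow> c \<noteq> g \<Longrightarrow> x \<inter> c = x \<inter> y"
    using gate_near[OF x y h xsub] by metis
  have zc: "z \<inter> c = z \<inter> y" if "c \<in> V" "h \<subseteq> c" "c \<noteq> y" for c
    using gate_far[OF c0(1) y h nsub that] c0(2) h'(3) sub that by auto
  have "vec.dim (x \<inter> y) < D" using plus dims[OF y] by simp
  then have "cls g = cls y - 1" using zc[OF g(1-3)] g(4) unfolding cls_def by simp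
  moreover have "a (cls c) = a (cls y)" if "c \<in> V" "h \<subseteq> c" "c \<noteq> y" "c \<noteq> g" for c
    using g(5)[OF that(1,2,4)] zc[OF that(1-3)] by (simp add: cls_def)
  ultimately show ?thesis using sum_line_gate[OF y h g(1-3), of "\<lambda>c. a (cls c)"] by simp
qed

end

text \<open>With dim P = D - i there are [i] hyperplanes containing \<open>P\<close>, q^i containing
  \<open>p\<close> but not \<open>P\<close>, and [D] - [i+1] not containing
  \<open>p\<close>.\<close>

lemma sum_hyps_flag:
  fixes G :: "('k^'n) set \<Rightarrow> complex"
  assumes y: "y \<in> V" and p: "vec.subspace p" "p \<subseteq> P" and P: "vec.subspace P" "P \<subseteq> y"
    and dim: "vec.dim P = Suc (vec.dim p)"
    and near: "\<And>h. h \<in> hyps y {} \<Longrightarrow> P \<subseteq> h \<Longrightarrow> G h = A"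
    and mid: "\<And>h. h \<in> hyps y {} \<Longrightarrow> p \<subseteq> h \<Longrightarrow> \<not> P \<subseteq> h \<Longrightarrow> G h = B"
    and off: "\<And>h. h \<in> hyps y {} \<Longrightarrow> \<not> p \<subseteq> h \<Longrightarrow> G h = E"
    and i: "i = D - Suc (vec.dim p)"
  shows "(\<Sum>h\<in>hyps y {}. G h) = qbr CARD('k) i * A + of_nat CARD('k) ^ i * B
     + (qbr CARD('k) D - qbr CARD('k) (Suc i)) * E"
proof -
  note ys = vertex_subspace[OF y] and yd = vertex_dim[OF y]
  have "P \<noteq> p" using dim by auto
  then obtain v where v: "v \<in> P" "v \<notin> p" using p by auto
  have Pspan: "P = vec.span (insert v p)"
    using p P v dim by (intro subspace_dim_eqI[symmetric] span_insert_least) (auto simp: dim_span_insert)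
  have PD: "vec.dim P \<le> D" using vec.dim_subset[OF P(2)] yd by simp
  have PP: "P \<subseteq> h \<longleftrightarrow> v \<in> h" if "h \<in> hyps y p" for h
    using that v(1) span_insert_least[of h p v] unfolding Pspan hyps_def by auto
  have split: "hyps y {} = hyps y P \<union> {h \<in> hyps y p. v \<notin> h} \<union> (hyps y {} - hyps y p)"
    using p PP v(1) by (auto simp: hyps_def)
  have "(\<Sum>h\<in>hyps y {}. G h) = (\<Sum>h\<in>hyps y P. G h) + (\<Sum>h\<in>{h \<in> hyps y p. v \<notin> h}. G h) + (\<Sum>h\<in>hyps y {} - hyps y p. G h)"
    by (subst split, subst sum.union_disjoint; (subst sum.union_disjoint)?) (use p v in \<open>auto simp: hyps_def\<close>)
  moreover have "(\<Sum>h\<in>hyps y P. G h) = (\<Sum>h\<in>hyps y P. A)"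
    using near by (intro sum.cong) (auto simp: hyps_def)
  moreover have "(\<Sum>h\<in>{h \<in> hyps y p. v \<notin> h}. G h) = (\<Sum>h\<in>{h \<in> hyps y p. v \<notin> h}. B)"
    using mid PP by (intro sum.cong) (auto simp: hyps_def)
  moreover have "(\<Sum>h\<in>hyps y {} - hyps y p. G h) = (\<Sum>h\<in>hyps y {} - hyps y p. E)"
    using off by (intro sum.cong) (auto simp: hyps_def)
  moreover have "of_nat (card (hyps y P)) = qbr CARD('k) i"
    using card_hyps_qbr[OF ys P] yd dim i by simp
  moreover have "of_nat (card {h \<in> hyps y p. v \<notin> h}) = (of_nat CARD('k) ^ i :: complex)"
    using card_hyps_avoiding[OF ys p(1), of v] v p P yd i by auto
  moreover have "of_nat (card (hyps y {} - hyps y p)) = qbr CARD('k) D - qbr CARD('k) (Suc i)"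
  proof -
    have sub: "hyps y p \<subseteq> hyps y {}" by (auto simp: hyps_def)
    have "card (hyps y {} - hyps y p) = card (hyps y {}) - card (hyps y p)" "card (hyps y p) \<le> card (hyps y {})"
      using sub by (auto intro: card_Diff_subset card_mono)
    moreover have "of_nat (card (hyps y p)) = qbr CARD('k) (Suc i)"
      using card_hyps_qbr[OF ys p(1)] p P yd i dim PD by (auto simp: Suc_diff_Suc)
    moreover have "of_nat (card (hyps y {})) = qbr CARD('k) D"
      using card_hyps_qbr[OF ys vec.subspace_single_0] vec.subspace_0[OF ys] yd hyps_zero[OF ys] by simp
    ultimately show ?thesis by (simp add: of_nat_diff)
  qed
  ultimately show ?thesis by simp
qed

text \<open>The vertex \<open>x\<close> is the gate of the clique towards \<open>y\<close>, so the
  flag is z \<inter> y < x \<inter> y. The boundary indices are harmless: the truncated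
  \<open>2 * i - 2\<close> at i = 0 has coefficient [0] = 0, and \<open>2 * i + 2\<close> at i = D -
  1 has coefficient [D] - [D] = 0.\<close>

lemma adj_sum_minus:
  assumes y: "y \<in> V" and minus: "vec.dim (x \<inter> y) = Suc (vec.dim (z \<inter> y))"
    and i: "i = D - Suc (vec.dim (z \<inter> y))"
  shows "cls y = 2 * i" "(\<Sum>w | dp_adj TI y w. a (cls w)) =
    qbr CARD('k) i * (a (2 * i - 2) + (of_nat s - 1) * (a (2 * i) :: complex))
    + of_nat CARD('k) ^ i * (of_nat s * a (2 * i + 1))
    + (qbr CARD('k) D - qbr CARD('k) (Suc i)) * (of_nat s * a (2 * i + 2))"
proof -
  show cy: "cls y = 2 * i" using minus i by (simp add: cls_def)
  show "(\<Sum>w | dp_adj TI y w. a (cls w)) =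
    qbr CARD('k) i * (a (2 * i - 2) + (of_nat s - 1) * (a (2 * i) :: complex))
    + of_nat CARD('k) ^ i * (of_nat s * a (2 * i + 1))
    + (qbr CARD('k) D - qbr CARD('k) (Suc i)) * (of_nat s * a (2 * i + 2))"
    unfolding sum_adj[OF y D_pos]
    by (rule sum_hyps_flag[OF y subspaces(4)[OF y] _ subspaces(3)[OF y] _ minus])
       (use minus_line_near[OF y minus] minus_line_mid[OF y minus] line_off[OF y] cy i z(3) in auto)
qed

text \<open>The gate \<open>c0\<close> of the clique differs from \<open>x\<close>, and the flag is
  z \<inter> y < c0 \<inter> y. The boundary terms vanish as for the even classes.\<close>

lemma adj_sum_plus:
  assumes y: "y \<in> V" and plus: "vec.dim (x \<inter> y) = vec.dim (z \<inter> y)"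
    and i: "i = D - Suc (vec.dim (z \<inter> y))"
  shows "cls y = 2 * i + 1" "(\<Sum>w | dp_adj TI y w. a (cls w)) =
    qbr CARD('k) i * (a (2 * i - 1) + (of_nat s - 1) * (a (2 * i + 1) :: complex))
    + of_nat CARD('k) ^ i * (a (2 * i) + (of_nat s - 1) * a (2 * i + 1))
    + (qbr CARD('k) D - qbr CARD('k) (Suc i)) * (of_nat s * a (2 * i + 3))"
proof -
  show cy: "cls y = 2 * i + 1" using plus i dims[OF y] by (simp add: cls_def)
  obtain c0 where c0: "c0 \<in> V" "z \<subseteq> c0" "vec.dim (c0 \<inter> y) = Suc (vec.dim (z \<inter> y))"
    using pencil_gate[OF z(1,2) y] by metis
  have s0: "vec.subspace (c0 \<inter> y)" using vertex_subspace c0 y by (simp add: vec.subspace_inter)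
  show "(\<Sum>w | dp_adj TI y w. a (cls w)) =
    qbr CARD('k) i * (a (2 * i - 1) + (of_nat s - 1) * (a (2 * i + 1) :: complex))
    + of_nat CARD('k) ^ i * (a (2 * i) + (of_nat s - 1) * a (2 * i + 1))
    + (qbr CARD('k) D - qbr CARD('k) (Suc i)) * (of_nat s * a (2 * i + 3))"
    unfolding sum_adj[OF y D_pos]
    by (rule sum_hyps_flag[OF y subspaces(4)[OF y] _ s0 _ c0(3)])
       (use plus_line_near[OF y plus c0] plus_line_mid[OF y plus c0] line_off[OF y] cy i c0(2) in \<open>auto simp: eval_nat_numeral\<close>)
qed

lemma class_cases:
  assumes y: "y \<in> V"
  obtains i where "i < D" "cls y = 2 * i" "vec.dim (x \<inter> y) = Suc (vec.dim (z \<inter> y))" "i = D - Suc (vec.dim (z \<inter> y))"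
  | i where "i < D" "cls y = 2 * i + 1" "vec.dim (x \<inter> y) = vec.dim (z \<inter> y)" "i = D - Suc (vec.dim (z \<inter> y))"
proof -
  have i: "D - Suc (vec.dim (z \<inter> y)) < D" using D_pos by simp
  consider "vec.dim (x \<inter> y) = Suc (vec.dim (z \<inter> y))" | "vec.dim (x \<inter> y) = vec.dim (z \<inter> y)"
    using dims(1,2)[OF y] by linarith
  then show thesis using that i adj_sum_minus(1)[OF y] adj_sum_plus(1)[OF y] by metis
qed

text \<open>The two distances differ by at most one, so their sum k determines them as the ceiling
  and the floor of k/2.\<close>

lemma dp_dist_cls: "y \<in> V \<Longrightarrow> dp_dist TI x y = Suc (cls y) div 2"
  and dp_setdist_cls: "y \<in> V \<Longrightarrow> dp_setdist TI {c \<in> V. z \<subseteq> c} y = cls y div 2"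
proof -
  assume y: "y \<in> V"
  show "dp_dist TI x y = Suc (cls y) div 2"
    unfolding dp_dist_eq[OF x y D_pos] using dims[OF y] by (cases rule: class_cases[OF y]) auto
  show "dp_setdist TI {c \<in> V. z \<subseteq> c} y = cls y div 2"
    unfolding dp_setdist_eq[OF z(1,2) y] by (cases rule: class_cases[OF y]) auto
qed

end

section \<open>Alternating, quadratic and Hermitian forms\<close>

lemma involution:
  fixes \<sigma> :: "'k::field \<Rightarrow> 'k"
  assumes add: "\<And>a b. \<sigma> (a + b) = \<sigma> a + \<sigma> b" and mult: "\<And>a b. \<sigma> (a * b) = \<sigma> a * \<sigma> b"
    and inv: "\<And>a. \<sigma> (\<sigma> a) = a"
  shows "\<sigma> 0 = 0" "\<sigma> 1 = 1" "\<sigma> (- a) = - \<sigma> a" "\<sigma> (a - b) = \<sigma> a - \<sigma> b"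
proof -
  have "\<sigma> 0 + \<sigma> 0 = \<sigma> 0 + 0" unfolding add[symmetric] by simp
  then show s0: "\<sigma> 0 = 0" by (simp only: add_left_cancel)
  have "\<sigma> (\<sigma> 1 * 1) = \<sigma> (\<sigma> 1) * \<sigma> 1" by (rule mult)
  then show "\<sigma> 1 = 1" by (simp add: inv)
  have neg: "\<sigma> (- a) = - \<sigma> a" for a using add[of "-a" a] s0 by (simp add: eq_neg_iff_add_eq_0)
  then show "\<sigma> (- a) = - \<sigma> a" .
  show "\<sigma> (a - b) = \<sigma> a - \<sigma> b" using add[of a "- b"] by (simp add: neg)
qed

text \<open>The trace a + \<sigma> a maps onto the fixed field with fibres of equal size, and its
  kernel has as many elements as the fixed field. Both therefore have the square root of q as their
  size, which supplies t = 1/2 for Hermitian forms.\<close>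

lemma trace_kernel:
  fixes \<sigma> :: "'k::{field,finite} \<Rightarrow> 'k"
  assumes add: "\<And>a b. \<sigma> (a + b) = \<sigma> a + \<sigma> b" and mult: "\<And>a b. \<sigma> (a * b) = \<sigma> a * \<sigma> b"
    and inv: "\<And>a. \<sigma> (\<sigma> a) = a" and nontriv: "\<exists>a. \<sigma> a \<noteq> a"
  shows "\<sigma> c = c \<Longrightarrow> card {a. a + \<sigma> a = c} = card {a. a + \<sigma> a = 0}"
    and "card {a. a + \<sigma> a = 0} * card {a. a + \<sigma> a = 0} = CARD('k)"
proof -
  define K where "K = {a. a + \<sigma> a = 0}"
  define F where "F = {a. \<sigma> a = a}"
  note s = involution[of \<sigma>, OF add mult inv]
  note s0 = s(1) and s1 = s(2)
  have sdiv: "\<sigma> (a / b) = \<sigma> a / \<sigma> b" for a b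
  proof (cases "b = 0")
    case False
    then have "\<sigma> b \<noteq> 0" using inv s0 by metis
    then show ?thesis using mult[of "a / b" b] False by (simp add: field_simps)
  qed (simp add: s0)
  obtain d where d: "\<sigma> d \<noteq> d" using nontriv by auto
  \<comment> \<open>If the trace vanished identically, its value at 1 would force characteristic
    two, and then \<sigma> would be the identity.\<close>
  have "\<exists>a. a + \<sigma> a \<noteq> 0"
  proof (rule ccontr)
    assume "\<not> ?thesis"
    then have *: "\<And>a. a + \<sigma> a = 0" by auto
    have "1 + 1 = (0::'k)" using *[of 1] s1 by simp
    then have "d + d = 0" by (metis distrib_left mult.right_neutral mult_zero_right)
    then show False using *[of d] d by (metis add_left_cancel)
  qed
  then obtain t where t: "t + \<sigma> t \<noteq> 0" by auto
  have ts: "\<sigma> (t + \<sigma> t) = t + \<sigma> t" by (simp add: add inv add.commute)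
  have fib: "card {a. a + \<sigma> a = c} = card K" if c: "c \<in> F" for c
  proof -
    \<comment> \<open>Both \<open>c\<close> and the trace of \<open>t\<close> are fixed by \<sigma>,
      so rescaling \<open>t\<close> in this way produces trace \<open>c\<close>.\<close>
    define b where "b = c * t / (t + \<sigma> t)"
    have "b + \<sigma> b = c * (t + \<sigma> t) / (t + \<sigma> t)"
      using c unfolding b_def sdiv mult ts F_def by (simp add: add_divide_distrib distrib_left)
    then have b: "b + \<sigma> b = c" using t by simp
    have "{a. a + \<sigma> a = c} = (+) b ` K"
    proof (intro set_eqI iffI)
      fix a assume "a \<in> {a. a + \<sigma> a = c}"
      then have "(a - b) + \<sigma> (a - b) = c - (b + \<sigma> b)" by (auto simp: s(4))
      then have "a - b \<in> K" using b by (simp add: K_def)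
      then show "a \<in> (+) b ` K" by (metis add.commute diff_add_cancel image_eqI)
    next
      fix a assume "a \<in> (+) b ` K"
      then obtain a' where a': "a' + \<sigma> a' = 0" "a = b + a'" by (auto simp: K_def)
      then have "a + \<sigma> a = (b + \<sigma> b) + (a' + \<sigma> a')" by (simp add: add algebra_simps)
      then show "a \<in> {a. a + \<sigma> a = c}" using b a' by simp
    qed
    then show ?thesis by (simp add: card_image)
  qed
  \<comment> \<open>The nonzero element \<open>d - \<sigma> d\<close> is negated by \<sigma>, so
    division by it exchanges negated and fixed elements.\<close>
  have KF: "card K = card F"
  proof (rule bij_betw_same_card[of "\<lambda>a. a / (d - \<sigma> d)"], unfold bij_betw_def, intro conjI)
    have dd: "d - \<sigma> d \<noteq> 0" using d by simp
    have sd: "\<sigma> (d - \<sigma> d) = - (d - \<sigma> d)" by (simp add: s(4) inv)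
    show "inj_on (\<lambda>a. a / (d - \<sigma> d)) K" using dd by (auto intro: inj_onI)
    show "(\<lambda>a. a / (d - \<sigma> d)) ` K = F"
    proof (intro set_eqI iffI)
      fix b assume "b \<in> (\<lambda>a. a / (d - \<sigma> d)) ` K"
      then obtain a where a: "a + \<sigma> a = 0" "b = a / (d - \<sigma> d)" by (auto simp: K_def)
      have "\<sigma> a = - a" using a(1) by (simp add: eq_neg_iff_add_eq_0 add.commute)
      then have "\<sigma> b = b" unfolding a(2) sdiv sd by (simp only: minus_divide_divide)
      then show "b \<in> F" by (simp add: F_def)
    next
      fix b assume "b \<in> F"
      then have "\<sigma> b = b" by (simp add: F_def)
      then have "b * (d - \<sigma> d) + \<sigma> (b * (d - \<sigma> d)) = b * (d - \<sigma> d) + - (b * (d - \<sigma> d))"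
        by (simp only: mult sd mult_minus_right)
      then have "b * (d - \<sigma> d) \<in> K" unfolding K_def mem_Collect_eq add.right_inverse .
      then show "b \<in> (\<lambda>a. a / (d - \<sigma> d)) ` K" using dd by (intro image_eqI[of _ _ "b * (d - \<sigma> d)"]) auto
    qed
  qed
  have "UNIV = (\<Union>c\<in>F. {a. a + \<sigma> a = c})"
    by (auto simp: F_def add inv add.commute)
  then have "CARD('k) = card (\<Union>c\<in>F. {a. a + \<sigma> a = c})" by (simp only:)
  also have "\<dots> = (\<Sum>c\<in>F. card {a. a + \<sigma> a = c})"
    by (rule card_UN_disjoint) auto
  finally show "card {a. a + \<sigma> a = 0} * card {a. a + \<sigma> a = 0} = CARD('k)"
    using fib KF unfolding K_def by simp
  show "card {a. a + \<sigma> a = c} = card {a. a + \<sigma> a = 0}" if "\<sigma> c = c"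
    using fib that unfolding K_def F_def by simp
qed

section \<open>The three kinds of forms and their pencil sizes\<close>

lemma polar_form_alt:
  fixes f :: "('k::{field,finite})^('n::finite) \<Rightarrow> 'k^'n \<Rightarrow> 'k"
  assumes "alt_nondeg f"
  shows "polar_form f (\<lambda>_. True) (tot_iso f)"
proof -
  note A = assms[unfolded alt_nondeg_def is_bilin_def]
  note l = A[THEN conjunct1, THEN conjunct1, rule_format]
    A[THEN conjunct1, THEN conjunct2, THEN conjunct1, rule_format]
    A[THEN conjunct1, THEN conjunct2, THEN conjunct2, THEN conjunct1, rule_format]
    and a = A[THEN conjunct2, THEN conjunct1, rule_format]
    and nd = A[THEN conjunct2, THEN conjunct2, rule_format]
  show ?thesis
  proof
    fix x y assume xy: "f x y = 0"
    have "f (x + y) (x + y) = f x x + f y x + (f x y + f y y)" by (simp only: l)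
    then show "f y x = 0" by (simp add: a xy)
  qed (use nd in \<open>auto simp: l a tot_iso_def\<close>)
qed

text \<open>On a totally singular subspace the polar form vanishes because sums stay singular; a
  singular x has B x x = Q (2x) - 2 Q x = 0 in every characteristic.\<close>

lemma polar_form_quad:
  fixes Q :: "('k::{field,finite})^('n::finite) \<Rightarrow> 'k"
  assumes "quad_nondeg Q"
  shows "polar_form (\<lambda>x y. Q (x + y) - Q x - Q y) (\<lambda>x. Q x = 0) (tot_sing Q)"
    and "Q (c *s x) = c ^ 2 * Q x"
proof -
  define B where "B = (\<lambda>x y. Q (x + y) - Q x - Q y)"
  note A = assms[unfolded quad_nondeg_def, folded B_def]
  have sq: "Q (c *s x) = c ^ 2 * Q x" for c x using A[THEN conjunct1] by (elim allE)
  then show "Q (c *s x) = c ^ 2 * Q x" .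
  note Bl = A[THEN conjunct2, THEN conjunct1, unfolded is_bilin_def]
  note l = Bl[THEN conjunct1, rule_format] Bl[THEN conjunct2, THEN conjunct1, rule_format]
  have nd: "(\<And>y. B x y = 0) \<Longrightarrow> Q x = 0 \<Longrightarrow> x = 0" for x
    using A[THEN conjunct2, THEN conjunct2] by (auto simp: B_def)
  have Q0: "Q 0 = 0" using sq[of 0 0] by simp
  have Qadd: "Q (x + y) = Q x + Q y + B x y" for x y by (simp add: B_def)
  have sym: "B x y = B y x" for x y by (simp add: B_def add.commute)
  have QU: "tot_sing Q U \<longleftrightarrow> vec.subspace U \<and> (\<forall>x\<in>U. Q x = 0) \<and> (\<forall>x\<in>U. \<forall>y\<in>U. B x y = 0)" for U
  proof
    assume U: "tot_sing Q U"
    then have "B x y = 0" if "x \<in> U" "y \<in> U" for x y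
      using that vec.subspace_add[of U x y] unfolding tot_sing_def B_def by simp
    then show "vec.subspace U \<and> (\<forall>x\<in>U. Q x = 0) \<and> (\<forall>x\<in>U. \<forall>y\<in>U. B x y = 0)"
      using U unfolding tot_sing_def by blast
  qed (simp add: tot_sing_def)
  have self: "B x x = 0" if "Q x = 0" for x
  proof -
    have "Q (x + x) = Q ((1 + 1) *s x)" by (simp only: vec.scale_left_distrib vec.scale_one)
    then show "B x x = 0" using that by (simp add: B_def sq)
  qed
  have "polar_form B (\<lambda>x. Q x = 0) (tot_sing Q)"
  proof (rule polar_form.intro)
    show "B y x = 0" if "B x y = 0" for x y using that by (simp only: sym)
    show "Q (x + y) = 0" if "Q x = 0" "Q y = 0" "B x y = 0" for x y using that by (simp only: Qadd) simp
    show "Q (c *s x) = 0" if "Q x = 0" for c x using that by (simp add: sq)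
    show "x = 0" if "Q x = 0" "\<And>y. B x y = 0" for x using nd that by blast
  qed (fact l Q0 QU self)+
  then show "polar_form (\<lambda>x y. Q (x + y) - Q x - Q y) (\<lambda>x. Q x = 0) (tot_sing Q)"
    unfolding B_def .
qed

lemma herm_nondegD:
  assumes "herm_nondeg \<sigma> f"
  shows "\<sigma> (a + b) = \<sigma> a + \<sigma> b" "\<sigma> (a * b) = \<sigma> a * \<sigma> b" "\<sigma> (\<sigma> a) = a" "\<exists>a. \<sigma> a \<noteq> a"
    "f (x + y) w = f x w + f y w" "f (c *s x) w = c * f x w" "f y x = \<sigma> (f x y)"
    "(\<And>y. f x y = 0) \<Longrightarrow> x = 0"
proof -
  note A = assms[unfolded herm_nondeg_def]
  note A2 = A[THEN conjunct2] note A3 = A2[THEN conjunct2] note A4 = A3[THEN conjunct2]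
  note A5 = A4[THEN conjunct2] note A6 = A5[THEN conjunct2] note A7 = A6[THEN conjunct2]
  show "\<sigma> (a + b) = \<sigma> a + \<sigma> b" by (rule A[THEN conjunct1, rule_format])
  show "\<sigma> (a * b) = \<sigma> a * \<sigma> b" by (rule A2[THEN conjunct1, rule_format])
  show "\<sigma> (\<sigma> a) = a" by (rule A3[THEN conjunct1, rule_format])
  show "\<exists>a. \<sigma> a \<noteq> a" by (rule A4[THEN conjunct1])
  show "f (x + y) w = f x w + f y w" by (rule A5[THEN conjunct1, rule_format])
  show "f (c *s x) w = c * f x w" by (rule A6[THEN conjunct1, rule_format])
  show "f y x = \<sigma> (f x y)" by (rule A7[THEN conjunct1, rule_format])
  show "x = 0" if "\<And>y. f x y = 0" using A7[THEN conjunct2] that by blast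
qed

lemma polar_form_herm:
  fixes f :: "('k::{field,finite})^('n::finite) \<Rightarrow> 'k^'n \<Rightarrow> 'k"
  assumes "herm_nondeg \<sigma> f"
  shows "polar_form f (\<lambda>x. f x x = 0) (tot_iso f)"
proof -
  note sa = herm_nondegD(1)[OF assms] and l = herm_nondegD(5,6)[OF assms]
    and sym = herm_nondegD(7)[OF assms] and nd = herm_nondegD(8)[OF assms]
  have "\<sigma> 0 + \<sigma> 0 = \<sigma> 0 + 0" unfolding sa[symmetric] by simp
  then have s0: "\<sigma> 0 = 0" by (simp only: add_left_cancel)
  have r: "f w y = 0" if "f y w = 0" for w y
    unfolding sym[where x = y and y = w] that by (rule s0)
  have sum0: "f (x + y) (x + y) = 0" if "f x x = 0" "f y y = 0" "f x y = 0" for x y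
  proof -
    have "f (x + y) x = 0" "f (x + y) y = 0" using that r[OF that(3)] by (simp_all add: l)
    from this[THEN r] show ?thesis by (simp add: l)
  qed
  have scale0: "f (c *s x) (c *s x) = 0" if "f x x = 0" for x c
  proof -
    have "f (c *s x) x = 0" using that by (simp add: l)
    then have "f x (c *s x) = 0" by (rule r)
    then show ?thesis by (simp add: l)
  qed
  show ?thesis
  proof
    show "f 0 0 = 0" using l(2)[of 0 0 0] by simp
  next
    fix x y assume "f x x = 0" "f y y = 0" "f x y = 0"
    then show "f (x + y) (x + y) = 0" by (rule sum0)
  next
    fix x y assume "f x y = 0" then show "f y x = 0" by (rule r)
  next
    fix x c assume "f x x = 0" then show "f (c *s x) (c *s x) = 0" by (rule scale0)
  qed (use nd in \<open>auto simp: l tot_iso_def\<close>)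
qed

text \<open>\<open>card_pencil\<close> yields s = q^(N - 2D) k, and with k = q^t the hypothesis on N
  makes this \<open>q powr e\<close>. A hyperplane of one vertex is chosen only to name
  \<open>s\<close> as a cardinality.\<close>

lemma polar_order_of_count:
  fixes f :: "('k::{field,finite})^('n::finite) \<Rightarrow> 'k^'n \<Rightarrow> 'k"
  assumes pf: "polar_form f sing TI" and D: "witt TI > 0"
    and count: "\<And>u v. sing u \<Longrightarrow> f v u = 1 \<Longrightarrow> card {a. sing (v + a *s u)} = k"
    and k: "real k = real CARD('k) powr t" and N: "real CARD('n) = 2 * real (witt TI) + (e - t)"
  shows "\<exists>s. real s = real CARD('k) powr e \<and> polar_order f sing TI s"
proof -
  interpret polar_form f sing TI by fact
  have q: "real CARD('k) > 0" by simp
  obtain U where U: "TI U" "vec.dim U = D" using ex_TI_dim by auto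
  have ND: "D \<le> CARD('n)" using dim_perp[OF U(1)] U(2) by simp
  have line: "real (card {c \<in> V. h \<subseteq> c \<and> c \<noteq> y}) = real CARD('k) powr e" if "y \<in> V" "h \<in> hyps y {}" for y h
  proof -
    have "CARD('k) ^ D * card {c \<in> V. h \<subseteq> c \<and> c \<noteq> y} = CARD('k) ^ (CARD('n) - D) * k"
      using card_pencil[OF count that] by simp
    then have "real (CARD('k) ^ D * card {c \<in> V. h \<subseteq> c \<and> c \<noteq> y}) = real (CARD('k) ^ (CARD('n) - D) * k)"
      by (simp only:)
    then have "real CARD('k) powr D * real (card {c \<in> V. h \<subseteq> c \<and> c \<noteq> y})
        = real CARD('k) powr (real CARD('n) - real D) * real CARD('k) powr t"
      using q ND k by (simp add: powr_realpow[symmetric] of_nat_diff)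
    also have "\<dots> = real CARD('k) powr D * real CARD('k) powr e"
      unfolding powr_add[symmetric] N by (simp add: algebra_simps)
    finally show ?thesis using q by simp
  qed
  have UV: "U \<in> V" using U by (rule vertexI)
  have "{0} \<noteq> U" using U D by (metis vec.dim_span vec.span_empty vec.dim_empty less_irrefl)
  then obtain h where h: "h \<in> hyps U {0}"
    using ex_hyp[of U "{0}"] TI_subspace[OF U(1)] vec.subspace_0 vec.subspace_single_0 by blast
  then have h: "h \<in> hyps U {}" by (simp add: hyps_def)
  define s where "s = card {c \<in> V. h \<subseteq> c \<and> c \<noteq> U}"
  have s: "real s = real CARD('k) powr e" unfolding s_def using line[OF UV h] .
  then have "s > 0" using q by (metis of_nat_0_less_iff powr_gt_zero less_irrefl)
  moreover have "card {c \<in> V. h \<subseteq> c \<and> c \<noteq> y} = s" if "y \<in> V" "h \<in> hyps y {}" for y h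
    using line[OF that] s by simp
  ultimately have "polar_order f sing TI s" by unfold_locales
  then show ?thesis using s by blast
qed

lemma dual_polar_order:
  fixes TI :: "((('k::{field,finite})^('n::finite)) set \<Rightarrow> bool)"
  assumes "dual_polar_setting TI e" and D: "witt TI > 0"
  shows "\<exists>f sing s. real s = real CARD('k) powr e \<and> polar_order f sing TI s"
  using assms(1) unfolding dual_polar_setting_def Let_def
proof (elim disjE exE conjE)
  fix f assume f: "alt_nondeg f" and TI: "TI = tot_iso f" and e: "e = 1"
  interpret polar_form f "\<lambda>_. True" TI unfolding TI by (rule polar_form_alt[OF f])
  obtain U where U: "TI U" "vec.dim U = D" using ex_TI_dim by auto
  \<comment> \<open>Every vector is singular for an alternating form, so a vertex absorbs its whole
    perp; this yields N = 2D, which the setting does not state for this type.\<close>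
  have "U = perp U" using TI_perp[OF U(1)] vertex_absorb[OF vertexI[OF U]] by auto
  then have "CARD('n) = 2 * D" using dim_perp[OF U(1)] U(2) by simp
  then have "\<exists>s. real s = real CARD('k) powr e \<and> polar_order f (\<lambda>_. True) TI s"
    using e by (intro polar_order_of_count[OF polar_form_axioms D, of "CARD('k)" 1 e]) auto
  then show ?thesis by blast
next
  fix Q assume Q: "quad_nondeg Q" and TI: "TI = tot_sing Q"
  note pf = polar_form_quad(1)[OF Q, folded TI]
  interpret polar_form "\<lambda>x y. Q (x + y) - Q x - Q y" "\<lambda>x. Q x = 0" TI by (rule pf)
  \<comment> \<open>As \<open>u\<close> is singular and pairs to 1 with \<open>v\<close>, Q (v + a
    u) = Q v + a, which is zero for exactly one \<open>a\<close>.\<close>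
  have "card {a. Q (v + a *s u) = 0} = 1" if u: "Q u = 0" and vu: "Q (v + u) - Q v - Q u = 1" for u v
  proof -
    have "Q (v + a *s u) = Q v + a" for a
    proof -
      have "Q (a *s u + v) - Q (a *s u) - Q v = a * (Q (u + v) - Q u - Q v)" by (rule f_scale)
      moreover have "Q (u + v) - Q u - Q v = 1" using vu by (simp add: add.commute diff_diff_eq)
      moreover have "Q (a *s u) = 0" using polar_form_quad(2)[OF Q] u by simp
      ultimately show ?thesis by (simp add: add.commute algebra_simps)
    qed
    then have "{a. Q (v + a *s u) = 0} = {- Q v}" by (auto simp: add_eq_0_iff)
    then show ?thesis by simp
  qed
  then have main: ?thesis if "real CARD('n) = 2 * real (witt TI) + (e - 0)"
    using polar_order_of_count[OF pf D, of 1 0 e] that by (simp del: of_nat_add) blast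
  {
    assume "CARD('n) = 2 * witt TI" "e = 0"
    then show ?thesis by (intro main) simp
  next
    assume "CARD('n) = 2 * witt TI + 1" "e = 1"
    then show ?thesis by (intro main) simp
  next
    assume "CARD('n) = 2 * witt TI + 2" "e = 2"
    then show ?thesis by (intro main) simp
  }
next
  fix \<sigma> f assume f: "herm_nondeg \<sigma> f" and TI: "TI = tot_iso f"
  note pf = polar_form_herm[OF f, folded TI]
  interpret polar_form f "\<lambda>x. f x x = 0" TI by (rule pf)
  note \<sigma> = herm_nondegD(1-4)[OF f] and sym = herm_nondegD(7)[OF f]
  define k where "k = card {a. a + \<sigma> a = 0}"
  note s = involution[of \<sigma>, OF \<sigma>(1-3)]
  note s1 = s(2)
  \<comment> \<open>The form takes the value f v v + a + \<sigma> a, and f v v is fixed by \<sigma>,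
    so the solutions form a fibre of the trace.\<close>
  have "card {a. f (v + a *s u) (v + a *s u) = 0} = k" if u: "f u u = 0" and vu: "f v u = 1" for u v
  proof -
    have "f (v + a *s u) (v + a *s u) = f v v + (a + \<sigma> a)" for a
    proof -
      have uv: "f u v = 1" by (simp only: sym[where x = v and y = u] vu s1)
      have "f v (v + a *s u) = \<sigma> (f (v + a *s u) v)" by (rule sym)
      also have "\<dots> = \<sigma> (f v v) + \<sigma> a" by (simp add: f_add f_scale uv \<sigma>(1))
      also have "\<sigma> (f v v) = f v v" by (rule sym[symmetric])
      finally have fv: "f v (v + a *s u) = f v v + \<sigma> a" .
      have "f u (v + a *s u) = \<sigma> (f (v + a *s u) u)" by (rule sym)
      also have "\<dots> = 1" by (simp add: f_add f_scale vu u s1)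
      finally show ?thesis using fv by (simp add: f_add f_scale)
    qed
    then have "{a. f (v + a *s u) (v + a *s u) = 0} = {a. a + \<sigma> a = - f v v}" by (auto simp: eq_neg_iff_add_eq_0 add.commute)
    moreover have "\<sigma> (- f v v) = - f v v" using s(3) sym[of v v] by metis
    ultimately show ?thesis unfolding k_def using trace_kernel(1)[OF \<sigma>] by simp
  qed
  moreover have "real k = real CARD('k) powr (1/2)"
  proof -
    have "k * k = CARD('k)" unfolding k_def by (rule trace_kernel(2)[OF \<sigma>])
    then have "real k * real k = real CARD('k)" by (metis of_nat_mult)
    then show ?thesis by (simp add: powr_half_sqrt real_sqrt_unique power2_eq_square)
  qed
  ultimately have main: ?thesis if "real CARD('n) = 2 * real (witt TI) + (e - 1/2)"
    using that polar_order_of_count[OF pf D, of k "1/2" e] by blast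
  {
    assume "CARD('n) = 2 * witt TI" "e = 1 / 2"
    then show ?thesis by (intro main) simp
  next
    assume "CARD('n) = 2 * witt TI + 1" "e = 3 / 2"
    then show ?thesis by (intro main) simp
  }
qed

section \<open>Matrices of the nil-DAHA generators\<close>

text \<open>Matrices are functions on all pairs of naturals. Vanishing outside the square makes an
  inverse unique, as \<open>minv\<close> demands, and lets the action on sequences detect
  equality.\<close>

definition supported :: "nat \<Rightarrow> (nat \<Rightarrow> nat \<Rightarrow> complex) \<Rightarrow> bool" where
  "supported n M \<longleftrightarrow> (\<forall>i j. n \<le> i \<or> n \<le> j \<longrightarrow> M i j = 0)"

lemma mapp_mmul: "mapp n (mmul n A B) a = mapp n A (mapp n B a)"
proof
  fix k
  have "mapp n (mmul n A B) a k = (\<Sum>j<n. \<Sum>i<n. A k i * (B i j * a j))"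
    unfolding mapp_def mmul_def by (simp only: sum_distrib_right mult.assoc)
  also have "\<dots> = (\<Sum>i<n. \<Sum>j<n. A k i * (B i j * a j))" by (rule sum.swap)
  also have "\<dots> = mapp n A (mapp n B a) k"
    unfolding mapp_def by (simp only: sum_distrib_left)
  finally show "mapp n (mmul n A B) a k = mapp n A (mapp n B a) k" .
qed

lemma mapp_cong: "(\<And>j. j < n \<Longrightarrow> a j = b j) \<Longrightarrow> mapp n M a = mapp n M b"
  unfolding mapp_def by (intro ext sum.cong) auto

lemma mapp_lin: "mapp n (\<lambda>i j. c * M i j + d * N i j) a k = c * mapp n M a k + d * mapp n N a k"
  by (simp add: mapp_def sum.distrib sum_distrib_left algebra_simps)

lemma mapp_add: "mapp n (\<lambda>i j. M i j + N i j) a k = mapp n M a k + mapp n N a k"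
  using mapp_lin[of n 1 M 1 N] by simp

lemma mapp_diff: "mapp n (\<lambda>i j. M i j - d * N i j) a k = mapp n M a k - d * mapp n N a k"
  using mapp_lin[of n 1 M "-d" N] by simp

lemma mapp_scale: "mapp n (\<lambda>i j. c * M i j) a k = c * mapp n M a k"
  using mapp_lin[of n c M 0 M] by simp

lemma mapp_mid: "mapp n (mid n) a k = (if k < n then a k else 0)"
  by (simp add: mapp_def mid_def if_distrib[of "\<lambda>c. c * _"] sum.delta' cong: if_cong)

lemma supported_eqI:
  assumes "supported n A" "supported n B" and eq: "\<And>a k. k < n \<Longrightarrow> mapp n A a k = mapp n B a k"
  shows "A = B"
proof (intro ext)
  fix i j
  show "A i j = B i j"
  proof (cases "i < n \<and> j < n")
    case True
    have "mapp n M (\<lambda>k. if k = j then 1 else 0) i = M i j" for M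
      using True by (simp add: mapp_def if_distrib[of "\<lambda>c. _ * c"] cong: if_cong)
    then show ?thesis using eq True by metis
  next
    case False
    then show ?thesis using assms(1,2) by (auto simp: supported_def not_less)
  qed
qed

lemma supported_mmul: "supported n A \<Longrightarrow> supported n B \<Longrightarrow> supported n (mmul n A B)"
  by (auto simp: supported_def mmul_def)

lemma supported_mid: "supported n (mid n)"
  by (auto simp: supported_def mid_def)

lemma supported_diff: "supported n A \<Longrightarrow> supported n B \<Longrightarrow> supported n (\<lambda>i j. A i j - c * B i j)"
  by (auto simp: supported_def)

lemma minv_eqI:
  assumes B: "supported n B" and M: "supported n M"
    and MB: "\<And>a k. k < n \<Longrightarrow> mapp n M (mapp n B a) k = a k"
    and BM: "\<And>a k. k < n \<Longrightarrow> mapp n B (mapp n M a) k = a k"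
  shows "minv n M = B"
  unfolding minv_def
proof (rule the_equality)
  have "mmul n M B = mid n" "mmul n B M = mid n"
    by (rule supported_eqI[of n]; simp add: supported_mmul supported_mid B M mapp_mmul mapp_mid MB BM)+
  then show "(\<forall>i j. n \<le> i \<or> n \<le> j \<longrightarrow> B i j = 0) \<and> mmul n M B = mid n \<and> mmul n B M = mid n"
    using B by (auto simp: supported_def)
next
  fix B' assume B': "(\<forall>i j. n \<le> i \<or> n \<le> j \<longrightarrow> B' i j = 0) \<and> mmul n M B' = mid n \<and> mmul n B' M = mid n"
  show "B' = B"
  proof (rule supported_eqI[OF _ B])
    show "supported n B'" using B' unfolding supported_def by blast
    fix a k assume k: "k < n"
    have "mapp n B' a k = mapp n B' (mapp n M (mapp n B a)) k"
      using MB by (metis mapp_cong)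
    also have "\<dots> = mapp n B a k"
      using B' k by (simp only: mapp_mmul[symmetric, of n B' M] mapp_mid if_True)
    finally show "mapp n B' a k = mapp n B a k" .
  qed
qed

lemma blk_even_supported: "supported (2 * D) (blk_even D f)"
  by (auto simp: supported_def blk_even_def)

lemma blk_odd_supported: "D > 0 \<Longrightarrow> supported (2 * D) (blk_odd D a f b)"
  by (auto simp: supported_def blk_odd_def)

lemma mapp_two:
  assumes "j1 < n" "j2 < n" "j1 \<noteq> j2" "\<And>j. j < n \<Longrightarrow> j \<noteq> j1 \<Longrightarrow> j \<noteq> j2 \<Longrightarrow> M k j = 0"
  shows "mapp n M a k = M k j1 * a j1 + M k j2 * a j2"
proof -
  have "mapp n M a k = (\<Sum>j\<in>{j1, j2}. M k j * a j)"
    unfolding mapp_def using assms by (intro sum.mono_neutral_right) auto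
  then show ?thesis using assms(3) by simp
qed

lemma mapp_one:
  assumes "j1 < n" "\<And>j. j < n \<Longrightarrow> j \<noteq> j1 \<Longrightarrow> M k j = 0"
  shows "mapp n M a k = M k j1 * a j1"
proof -
  have "mapp n M a k = (\<Sum>j\<in>{j1}. M k j * a j)"
    unfolding mapp_def using assms by (intro sum.mono_neutral_right) auto
  then show ?thesis by simp
qed

lemma mapp_blk_even:
  assumes "i < D"
  shows "mapp (2 * D) (blk_even D f) a (2 * i) = f i 0 0 * a (2 * i) + f i 0 1 * a (2 * i + 1)"
    and "mapp (2 * D) (blk_even D f) a (2 * i + 1) = f i 1 0 * a (2 * i) + f i 1 1 * a (2 * i + 1)"
proof -
  have j: "j = 2 * i \<or> j = Suc (2 * i)" if "i = j div 2" for j using that by presburger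
  show "mapp (2 * D) (blk_even D f) a (2 * i) = f i 0 0 * a (2 * i) + f i 0 1 * a (2 * i + 1)"
    using assms j by (subst mapp_two[of "2 * i" _ "2 * i + 1"]) (auto simp: blk_even_def)
  show "mapp (2 * D) (blk_even D f) a (2 * i + 1) = f i 1 0 * a (2 * i) + f i 1 1 * a (2 * i + 1)"
    using assms j by (subst mapp_two[of "2 * i" _ "2 * i + 1"]) (auto simp: blk_even_def)
qed

lemma mapp_blk_odd_even:
  assumes "i < D"
  shows "mapp (2 * D) (blk_odd D a0 f aD) a (2 * i) =
    (if i = 0 then a0 * a 0 else f i 1 0 * a (2 * i - 1) + f i 1 1 * a (2 * i))"
proof (cases "i = 0")
  case True
  then show ?thesis using assms by (subst mapp_one[of 0]) (auto simp: blk_odd_def)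
next
  case False
  then obtain m where m: "i = Suc m" using gr0_implies_Suc by blast
  have j: "j = 2 * m + 1 \<or> j = 2 * m + 2" if "Suc m = Suc j div 2" for j using that by presburger
  \<comment> \<open>\<open>blk_odd\<close> tests its two corners before the blocks; these bounds
    exclude the last corner.\<close>
  have "2 * m + 2 < 2 * D" "2 * m + 2 \<noteq> 2 * D - 1" using assms m by auto
  then show ?thesis unfolding m using j
    by (subst mapp_two[of "2 * m + 1" _ "2 * m + 2"]) (auto simp: blk_odd_def)
qed

lemma mapp_blk_odd_odd:
  assumes "i < D"
  shows "mapp (2 * D) (blk_odd D a0 f aD) a (2 * i + 1) =
    (if Suc i = D then aD * a (2 * i + 1)
     else f (Suc i) 0 0 * a (2 * i + 1) + f (Suc i) 0 1 * a (2 * i + 2))"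
proof (cases "Suc i = D")
  case True
  then have D: "D = Suc i" by simp
  show ?thesis unfolding D by (subst mapp_one[of "2 * i + 1"]) (auto simp: blk_odd_def)
next
  case False
  have j: "j = 2 * i + 2 \<or> j = 2 * i + 1" if "Suc i = Suc j div 2" for j using that by presburger
  have "2 * i + 2 < 2 * D" "2 * i + 2 \<le> 2 * D - 2" using assms False by auto
  then show ?thesis using False j
    by (subst mapp_two[of "2 * i + 1" _ "2 * i + 2"]) (auto simp: blk_odd_def)
qed

section \<open>The generators over a real parameter q > 1\<close>

locale nil_daha =
  fixes q e :: real and D :: nat
  assumes q1: "q > 1" and D1: "D > 0"
begin

abbreviation "n \<equiv> 2 * D"
definition "qc \<equiv> complex_of_real q"
text \<open>In the parameters of the algebra, kappa = 1/g and kappa' = \<i>/h. All fractional powers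
  of q pass through \<open>g\<close> and \<open>h\<close>, so the matrix identities become rational,
  with g^2 = q^e and h^2 = q^D.\<close>

definition "g \<equiv> pw q (e / 2)"
definition "h \<equiv> pw q (real D / 2)"

lemma nz: "qc \<noteq> 0" "g \<noteq> 0" "h \<noteq> 0" "qc ^ i \<noteq> 0" "qc - 1 \<noteq> 0" "qc \<noteq> 1"
  using q1 by (auto simp: qc_def g_def h_def pw_def)

lemma pw_add: "pw q (a + b) = pw q a * pw q b"
  by (simp add: pw_def powr_add)

lemma pw_minus: "pw q (- a) = inverse (pw q a)"
  by (simp add: pw_def powr_minus)

lemma pw_diff: "pw q (a - b) = pw q a / pw q b"
  using pw_add[of a "-b"] pw_minus[of b] by (simp add: divide_inverse)

lemma pw_nat: "pw q (real i) = qc ^ i"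
  using q1 by (simp add: pw_def qc_def powr_realpow)

lemma pw_neg_half: "pw q (- e / 2) = inverse g" "pw q (- real D / 2) = inverse h"
  "pw q (- (e / 2)) = inverse g" "pw q (- (real D / 2)) = inverse h"
  using pw_minus[of "e/2"] pw_minus[of "real D / 2"] by (simp_all add: g_def h_def)

lemma h_sq: "h * h = qc ^ D"
  unfolding h_def pw_add[symmetric] pw_nat[symmetric] by simp

lemma g_sq: "g * g = complex_of_real (q powr e)"
  unfolding g_def pw_add[symmetric] by (simp add: pw_def)

lemma qc_pow_neq:
  assumes "i < j" shows "qc ^ i \<noteq> qc ^ j"
proof -
  have "q ^ i < q ^ j" using q1 assms by (intro power_strict_increasing) auto
  then show ?thesis unfolding qc_def of_real_power[symmetric] of_real_eq_iff by simp
qed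

abbreviation "opT \<equiv> mapp n (mT q e D)"
abbreviation "opT' \<equiv> mapp n (mT' q D)"
abbreviation "opU \<equiv> mapp n (mU q D)"
abbreviation "opU' \<equiv> mapp n (mU' q e D)"

lemma T_even: "i < D \<Longrightarrow> opT a (2 * i) = (inverse g - g) * a (2 * i) + g * a (2 * i + 1)"
  and T_odd: "i < D \<Longrightarrow> opT a (2 * i + 1) = inverse g * a (2 * i)"
  unfolding mT_def mapp_blk_even by (simp_all add: t_blk_def pw_neg_half g_def)

lemma U'_even: "i < D \<Longrightarrow> opU' a (2 * i) = 0"
  and U'_odd: "i < D \<Longrightarrow> opU' a (2 * i + 1) = - \<i> * (h / (g * qc ^ i)) * a (2 * i)"
proof -
  have "pw q ((real D - e) / 2 - real i) = h / (g * qc ^ i)"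
    using nz by (simp add: pw_diff pw_nat diff_divide_distrib h_def g_def)
  then show "i < D \<Longrightarrow> opU' a (2 * i + 1) = - \<i> * (h / (g * qc ^ i)) * a (2 * i)"
    unfolding mU'_def mapp_blk_even by (simp add: u'_blk_def)
  show "i < D \<Longrightarrow> opU' a (2 * i) = 0"
    unfolding mU'_def mapp_blk_even by (simp add: u'_blk_def)
qed

lemma t'_blk_entries:
  "t'_blk q D i 0 0 = \<i> * ((h * h - qc ^ i + 1) / h)" "t'_blk q D i 0 (Suc 0) = \<i> * ((qc ^ i - h * h) / h)"
  "t'_blk q D i (Suc 0) 0 = \<i> * ((1 - qc ^ i) / h)" "t'_blk q D i (Suc 0) (Suc 0) = \<i> * (qc ^ i / h)"
proof -
  have "pw q (real D / 2) * (pw q (real i - real D) - 1) = (qc ^ i - h * h) / h"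
    unfolding pw_diff pw_nat h_sq[symmetric] h_def[symmetric] using nz by (simp add: field_simps)
  then show "t'_blk q D i 0 (Suc 0) = \<i> * ((qc ^ i - h * h) / h)" by (simp add: t'_blk_def)
  have entry: "pw q (- real D / 2) * complex_of_real r = c / h" if "complex_of_real r = c" for r c
    unfolding pw_neg_half that by (simp only: divide_inverse mult.commute)
  show "t'_blk q D i 0 0 = \<i> * ((h * h - qc ^ i + 1) / h)"
    unfolding t'_blk_def by (subst entry[of _ "h * h - qc ^ i + 1"]) (simp_all add: h_sq, simp_all add: qc_def)
  show "t'_blk q D i (Suc 0) 0 = \<i> * ((1 - qc ^ i) / h)"
    unfolding t'_blk_def by (subst entry[of _ "1 - qc ^ i"]) (simp_all, simp_all add: qc_def)
  show "t'_blk q D i (Suc 0) (Suc 0) = \<i> * (qc ^ i / h)"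
    unfolding t'_blk_def pw_diff pw_nat h_def[symmetric] by simp
qed

text \<open>The 1x1 corner blocks obey the same formula as the 2x2 blocks: 1 - q^0 = 0 removes the
  truncated index at i = 0. In \<open>T'_odd\<close> the factor q^D - h^2 = 0 likewise removes the
  index beyond the end.\<close>

lemma T'_even: "i < D \<Longrightarrow> opT' a (2 * i) = \<i> * ((1 - qc ^ i) / h * a (2 * i - 1) + qc ^ i / h * a (2 * i))"
  unfolding mT'_def mapp_blk_odd_even One_nat_def t'_blk_entries pw_neg_half
  by (cases "i = 0") (simp_all add: divide_inverse distrib_left mult.assoc)

lemma T'_odd: "i < D \<Longrightarrow> opT' a (2 * i + 1) =
  \<i> * ((h * h - qc ^ Suc i + 1) / h * a (2 * i + 1) + (qc ^ Suc i - h * h) / h * a (2 * i + 2))"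
proof -
  assume i: "i < D"
  have "Suc i = D \<Longrightarrow> qc ^ Suc i = h * h" using h_sq by simp
  then show ?thesis
    using mapp_blk_odd_odd[OF i, of "\<i> * inverse h" "t'_blk q D" "\<i> * inverse h" a]
    unfolding mT'_def pw_neg_half
    by (cases "Suc i = D") (simp_all del: power_Suc add: t'_blk_entries divide_inverse distrib_left mult.assoc)
qed

lemma U_even: "i < D \<Longrightarrow> opU a (2 * i) = 0"
  unfolding mU_def mapp_blk_odd_even by (simp add: u_blk_def)

lemma U_odd: "i < D \<Longrightarrow> opU a (2 * i + 1) = - a (2 * i + 1) + (1 - h * h / qc ^ Suc i) * a (2 * i + 2)"
proof -
  assume i: "i < D"
  have "h * h / qc ^ Suc i = qc ^ (D - Suc i)"
    unfolding h_sq using power_diff[OF nz(1), of "Suc i" D] i by simp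
  then show ?thesis
    unfolding mU_def mapp_blk_odd_odd[OF i] by (auto simp: u_blk_def qc_def simp del: power_Suc)
qed

lemma index_cases:
  assumes "k < n"
  obtains i where "i < D" "k = 2 * i" | i where "i < D" "k = 2 * i + 1"
proof (cases "even k")
  case True
  then show thesis using that(1)[of "k div 2"] assms by auto
next
  case False
  then show thesis using that(2)[of "k div 2"] assms by auto
qed

text \<open>These are kappa - 1/kappa and kappa' - 1/kappa'.\<close>

definition "c1 = inverse g - g"
definition "c2 = \<i> * (inverse h + h)"

text \<open>The relation (T - kappa)(T + 1/kappa) = 0 in the form T^2 = c1 T + 1, which exhibits T -
  c1 as the inverse of T.\<close>

lemma T_quadratic: "k < n \<Longrightarrow> opT (opT a) k = c1 * opT a k + a k"
proof (erule index_cases)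
  fix i assume i: "i < D" "k = 2 * i"
  show ?thesis using nz unfolding i(2) T_even[OF i(1), of "opT a"] T_odd[OF i(1), of a] by (simp add: c1_def)
next
  fix i assume i: "i < D" "k = 2 * i + 1"
  show ?thesis using nz unfolding i(2) T_odd[OF i(1)] T_even[OF i(1), of a] by (simp add: c1_def field_simps)
qed

lemma T'_first: "opT' a 0 = \<i> * inverse h * a 0"
  using T'_even[OF D1, of a] by (simp add: divide_inverse)

lemma T'_last: "Suc m = D \<Longrightarrow> opT' a (2 * m + 1) = \<i> * inverse h * a (2 * m + 1)"
  using T'_odd[of m a] h_sq by (simp add: divide_inverse del: power_Suc)

lemma T'_mid:
  assumes "Suc m < D"
  shows "opT' a (2 * m + 1) = \<i> * ((h * h - qc ^ Suc m + 1) / h * a (2 * m + 1) + (qc ^ Suc m - h * h) / h * a (2 * m + 2))"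
    and "opT' a (2 * m + 2) = \<i> * ((1 - qc ^ Suc m) / h * a (2 * m + 1) + qc ^ Suc m / h * a (2 * m + 2))"
  using T'_odd[of m a] T'_even[OF assms, of a] assms by (simp_all del: power_Suc)

lemma index_cases':
  assumes "k < n"
  obtains "k = 0" | m where "Suc m < D" "k = 2 * m + 1" | m where "Suc m < D" "k = 2 * m + 2"
    | m where "Suc m = D" "k = 2 * m + 1"
proof (rule index_cases[OF assms])
  fix i assume i: "i < D" "k = 2 * i"
  show thesis
  proof (cases i)
    case 0
    then show thesis using that(1) i by simp
  next
    case (Suc m)
    then show thesis using that(3)[of m] i by simp
  qed
next
  fix i assume i: "i < D" "k = 2 * i + 1"
  show thesis
  proof (cases "Suc i = D")
    case True
    then show thesis using that(4) i(2) by blast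
  next
    case False
    then have "Suc i < D" using i(1) by simp
    then show thesis using that(2) i(2) by blast
  qed
qed

lemma T'_quadratic: "k < n \<Longrightarrow> opT' (opT' a) k = c2 * opT' a k + a k"
proof (erule index_cases')
  assume k: "k = 0"
  show ?thesis using nz unfolding k T'_first c2_def by (simp add: field_simps)
next
  fix m assume m: "Suc m < D" "k = 2 * m + 1"
  show ?thesis using nz unfolding m(2) T'_mid[OF m(1)] c2_def by (simp add: field_simps del: power_Suc)
next
  fix m assume m: "Suc m < D" "k = 2 * m + 2"
  show ?thesis using nz unfolding m(2) T'_mid[OF m(1)] c2_def by (simp add: field_simps del: power_Suc)
next
  fix m assume m: "Suc m = D" "k = 2 * m + 1"
  show ?thesis using nz unfolding m(2) T'_last[OF m(1)] c2_def by (simp add: field_simps)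
qed

end

section \<open>Rational identities behind the rows of X + 1/X\<close>

lemma row_reduce:
  fixes w :: complex
  assumes w: "w \<noteq> 0" and eq: "(1 - c) * A + \<i> * k * X = B * C + w * Q * E + (F - G) * H"
  shows "(c - 1) / (- w) * A + \<i> * k / w * X = B / w * C + Q * E + (F / w - G / w) * H"
proof -
  have "(c - 1) / (- w) * A + \<i> * k / w * X = ((1 - c) * A + \<i> * k * X) / w"
    by (simp add: add_divide_distrib divide_minus_right flip: minus_divide_left) (simp add: field_simps w)
  also have "\<dots> = B / w * C + w * Q * E / w + (F - G) / w * H"
    unfolding eq by (simp add: add_divide_distrib)
  finally show ?thesis using w by (simp add: diff_divide_distrib)
qed

text \<open>Row 2i multiplied by q - 1, with Q = q^i and c = q; \<open>A0\<close>,
  \<open>A1\<close>, \<open>A2\<close>, \<open>A3\<close> are the coefficients at 2i-2, 2i, 2i+1,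
  2i+2.\<close>

lemma row_even_identity:
  fixes g h :: complex
  assumes "g \<noteq> 0" "h \<noteq> 0"
  shows "(1 - g * g) * A1 + \<i> * (h * g) * (\<i> * ((1 - Q) / h * (inverse g * A0)
      + Q / h * ((inverse g - g) * A1 + g * A2))
      + g * (\<i> * ((h * h - c * Q + 1) / h * A2 + (c * Q - h * h) / h * A3) - \<i> * (inverse h + h) * A2))
    = (Q - 1) * (A0 + (g * g - 1) * A1) + (c - 1) * Q * (g * g * A2) + ((h * h - 1) - (c * Q - 1)) * (g * g * A3)"
  using assms by (simp add: field_simps)

text \<open>Row 2i+1 in the same way; \<open>A'\<close>, \<open>A0\<close>, \<open>A1\<close>,
  \<open>A2\<close>, \<open>A3\<close> are the coefficients at 2i-1, 2i, 2i+1, 2i+2, 2i+3. The terms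
  in \<open>A2\<close> cancel between X and its inverse.\<close>

lemma row_odd_identity:
  fixes g h :: complex
  assumes "g \<noteq> 0" "h \<noteq> 0"
  shows "(1 - g * g) * A1 + \<i> * (h * g) * (\<i> * ((h * h - c * Q + 1) / h * (inverse g * A0)
      + (c * Q - h * h) / h * ((inverse g - g) * A2 + g * A3))
      + inverse g * (\<i> * ((1 - Q) / h * A' + Q / h * A0) - \<i> * (inverse h + h) * A0)
      - (inverse g - g) * (\<i> * ((h * h - c * Q + 1) / h * A1 + (c * Q - h * h) / h * A2) - \<i> * (inverse h + h) * A1))
    = (Q - 1) * (A' + (g * g - 1) * A1) + (c - 1) * Q * (A0 + (g * g - 1) * A1)
      + ((h * h - 1) - (c * Q - 1)) * (g * g * A3)"
  using assms by (simp add: field_simps)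

context nil_daha
begin

section \<open>Inverses, rows of X + 1/X and the diagonal operators\<close>

lemma supp: "supported n (mT q e D)" "supported n (mT' q D)" "supported n (mU q D)" "supported n (mU' q e D)"
  unfolding mT_def mT'_def mU_def mU'_def
  using D1 by (simp_all add: blk_even_supported blk_odd_supported)

definition "mTinv = (\<lambda>i j. mT q e D i j - c1 * mid n i j)"
definition "mT'inv = (\<lambda>i j. mT' q D i j - c2 * mid n i j)"

lemma supp_inv: "supported n mTinv" "supported n mT'inv" "supported n (mX q e D)"
  unfolding mTinv_def mT'inv_def mX_def by (intro supported_diff supported_mmul supp supported_mid)+

lemma opTinv: "k < n \<Longrightarrow> mapp n mTinv a k = opT a k - c1 * a k"
  and opT'inv: "k < n \<Longrightarrow> mapp n mT'inv a k = opT' a k - c2 * a k"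
  unfolding mTinv_def mT'inv_def by (simp_all add: mapp_diff mapp_mid)

lemma mapp_sub: "mapp n M (\<lambda>k. a k - c * b k) k = mapp n M a k - c * mapp n M b k"
  by (simp add: mapp_def sum_subtractf sum_distrib_left algebra_simps)

lemma opTinv_fun: "mapp n M (mapp n mTinv a) = mapp n M (\<lambda>k. opT a k - c1 * a k)"
  and opT'inv_fun: "mapp n M (mapp n mT'inv a) = mapp n M (\<lambda>k. opT' a k - c2 * a k)"
  by (rule mapp_cong, simp add: opTinv opT'inv)+

lemma T_Tinv: "k < n \<Longrightarrow> opT (mapp n mTinv a) k = a k"
  and Tinv_T: "k < n \<Longrightarrow> mapp n mTinv (opT a) k = a k"
  and T'_T'inv: "k < n \<Longrightarrow> opT' (mapp n mT'inv a) k = a k"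
  and T'inv_T': "k < n \<Longrightarrow> mapp n mT'inv (opT' a) k = a k"
  by (simp_all add: opTinv_fun opT'inv_fun mapp_sub opTinv opT'inv T_quadratic T'_quadratic)

lemma minv_T: "minv n (mT q e D) = mTinv"
  by (rule minv_eqI) (simp_all add: supp supp_inv T_Tinv Tinv_T)

lemma opX: "mapp n (mX q e D) a = opT' (opT a)"
  by (simp add: mX_def mapp_mmul)

lemma minv_X: "minv n (mX q e D) = mmul n mTinv mT'inv"
proof (rule minv_eqI)
  fix a :: "nat \<Rightarrow> complex" and k assume k: "k < n"
  have "opT' (opT (mapp n mTinv (mapp n mT'inv a))) = opT' (mapp n mT'inv a)"
    by (rule mapp_cong) (simp add: T_Tinv)
  then show "mapp n (mX q e D) (mapp n (mmul n mTinv mT'inv) a) k = a k"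
    using k by (simp add: opX mapp_mmul T'_T'inv)
  have "mapp n mTinv (mapp n mT'inv (opT' (opT a))) = mapp n mTinv (opT a)"
    by (rule mapp_cong) (simp add: T'inv_T')
  then show "mapp n (mmul n mTinv mT'inv) (mapp n (mX q e D) a) k = a k"
    using k by (simp add: opX mapp_mmul Tinv_T)
qed (simp_all add: supp_inv supported_mmul)

lemma opXinv: "mapp n (minv n (mX q e D)) a = mapp n mTinv (mapp n mT'inv a)"
  by (simp add: minv_X mapp_mmul)

text \<open>The constant \<open>c1\<close> is the upper left entry of each block of T, so in even
  rows T - c1 reads only the odd coordinate.\<close>

lemma calA_even:
  assumes "i < D"
  shows "mapp n (mcalA q e D) a (2 * i) = opT' (opT a) (2 * i) + g * (opT' a (2 * i + 1) - c2 * a (2 * i + 1))"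
proof -
  have k: "2 * i < n" "2 * i + 1 < n" using assms by auto
  show ?thesis
    unfolding mcalA_def mapp_add opX opXinv opTinv[OF k(1)] T_even[OF assms, of "mapp n mT'inv a"]
      opT'inv[OF k(1)] opT'inv[OF k(2)] c1_def by (simp only: add.commute add_diff_cancel_right' add_diff_cancel_left')
qed

lemma calA_odd:
  assumes "i < D"
  shows "mapp n (mcalA q e D) a (2 * i + 1) = opT' (opT a) (2 * i + 1)
    + inverse g * (opT' a (2 * i) - c2 * a (2 * i)) - c1 * (opT' a (2 * i + 1) - c2 * a (2 * i + 1))"
proof -
  have k: "2 * i < n" "2 * i + 1 < n" using assms by auto
  show ?thesis
    unfolding mcalA_def mapp_add opX opXinv opTinv[OF k(2)] T_odd[OF assms, of "mapp n mT'inv a"]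
      opT'inv[OF k(1)] opT'inv[OF k(2)] by simp
qed

definition "br m = (qc ^ m - 1) / (qc - 1)"

lemma br_D: "br D = (h * h - 1) / (qc - 1)"
  by (simp add: br_def h_sq)

text \<open>The right side is the neighbour sum at a vertex of \<open>C_i^-\<close> with s = g^2;
  \<open>row_odd\<close> plays the same part for \<open>C_i^+\<close>.\<close>

lemma row_even:
  assumes i: "i < D"
  shows "(g * g - 1) / (1 - qc) * a (2 * i) + \<i> * (h * g) / (qc - 1) * mapp n (mcalA q e D) a (2 * i)
    = br i * (a (2 * i - 2) + (g * g - 1) * a (2 * i)) + qc ^ i * (g * g * a (2 * i + 1))
      + (br D - br (Suc i)) * (g * g * a (2 * i + 2))"
proof -
  have d: "1 - qc = - (qc - 1)" by simp
  have "opT' (opT a) (2 * i) = \<i> * ((1 - qc ^ i) / h * (inverse g * a (2 * i - 2))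
      + qc ^ i / h * ((inverse g - g) * a (2 * i) + g * a (2 * i + 1)))"
  proof (cases i)
    case 0
    then show ?thesis using T'_even[OF i, of "opT a"] T_even[OF i, of a] by simp
  next
    case (Suc m)
    then have m: "m < D" "2 * i - 1 = 2 * m + 1" "2 * i - 2 = 2 * m" using i by auto
    show ?thesis unfolding T'_even[OF i, of "opT a"] T_even[OF i, of a] m(2,3) T_odd[OF m(1)] ..
  qed
  then show ?thesis
    unfolding calA_even[OF i] T'_odd[OF i, of a] c2_def br_D d
    unfolding br_def power_Suc
    by (intro row_reduce nz(5)) (simp only: row_even_identity[OF nz(2,3)])
qed

lemma row_odd:
  assumes i: "i < D"
  shows "(g * g - 1) / (1 - qc) * a (2 * i + 1) + \<i> * (h * g) / (qc - 1) * mapp n (mcalA q e D) a (2 * i + 1)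
    = br i * (a (2 * i - 1) + (g * g - 1) * a (2 * i + 1)) + qc ^ i * (a (2 * i) + (g * g - 1) * a (2 * i + 1))
      + (br D - br (Suc i)) * (g * g * a (2 * i + 3))"
proof -
  have d: "1 - qc = - (qc - 1)" by simp
  have "(qc ^ Suc i - h * h) / h * opT a (2 * i + 2)
      = (qc ^ Suc i - h * h) / h * ((inverse g - g) * a (2 * i + 2) + g * a (2 * i + 3))"
  proof (cases "Suc i < D")
    case True
    then show ?thesis using T_even[OF True, of a] by (simp add: eval_nat_numeral)
  next
    case False
    then have "Suc i = D" using i by simp
    then show ?thesis using h_sq by simp
  qed
  then have "opT' (opT a) (2 * i + 1) = \<i> * ((h * h - qc ^ Suc i + 1) / h * (inverse g * a (2 * i))
      + (qc ^ Suc i - h * h) / h * ((inverse g - g) * a (2 * i + 2) + g * a (2 * i + 3)))"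
    unfolding T'_odd[OF i, of "opT a"] T_odd[OF i] by simp
  then show ?thesis
    unfolding calA_odd[OF i] T'_odd[OF i, of a] T'_even[OF i, of a] c1_def c2_def br_D d
    unfolding br_def power_Suc
    by (intro row_reduce nz(5)) (simp only: row_odd_identity[OF nz(2,3)])
qed

text \<open>T U' is supported on the even diagonal positions and U T' on the odd ones, so a weight
  on the second summand rescales only the odd eigenvalues.\<close>

lemma TU'_diag:
  assumes i: "i < D"
  shows "opT (opU' a) (2 * i) = - \<i> * (h / qc ^ i) * a (2 * i)" "opT (opU' a) (2 * i + 1) = 0"
  unfolding T_even[OF i] T_odd[OF i] U'_odd[OF i] U'_even[OF i] using nz by (simp_all add: field_simps)

lemma UT'_diag:
  assumes i: "i < D"
  shows "opU (opT' a) (2 * i) = 0" "opU (opT' a) (2 * i + 1) = - \<i> * (h / qc ^ Suc i) * a (2 * i + 1)"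
proof -
  show "opU (opT' a) (2 * i) = 0" by (rule U_even[OF i])
  have "(1 - h * h / qc ^ Suc i) * opT' a (2 * i + 2)
    = (1 - h * h / qc ^ Suc i) * (\<i> * ((1 - qc ^ Suc i) / h * a (2 * i + 1) + qc ^ Suc i / h * a (2 * i + 2)))"
  proof (cases "Suc i < D")
    case True
    then show ?thesis using T'_mid(2)[OF True, of a] by simp
  next
    case False
    then have "Suc i = D" using i by simp
    then have "1 - h * h / qc ^ Suc i = 0" using h_sq nz by simp
    then show ?thesis by (simp only: mult_zero_left)
  qed
  then show "opU (opT' a) (2 * i + 1) = - \<i> * (h / qc ^ Suc i) * a (2 * i + 1)"
    unfolding U_odd[OF i] T'_odd[OF i] using nz nz(4)[of "Suc i"]
    by (simp only:) (simp add: field_simps del: power_Suc)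
qed

text \<open>The ceiling of k/2 is the distance from x of class k. The extra factor q in
  \<open>mcalAt\<close> lowers the exponent at odd k only, giving the floor, the distance from the
  clique.\<close>

lemma calAs_diag: "k < n \<Longrightarrow> mapp n (mcalAs q e D) a k = inverse (qc ^ (Suc k div 2)) * a k"
proof (erule index_cases)
  fix i assume i: "i < D" "k = 2 * i"
  then show ?thesis unfolding mcalAs_def mapp_scale mapp_add mapp_mmul i(2) TU'_diag[OF i(1)] UT'_diag[OF i(1)] pw_neg_half
    using nz by (simp add: field_simps)
next
  fix i assume i: "i < D" "k = 2 * i + 1"
  then have "Suc k div 2 = Suc i" by simp
  then show ?thesis unfolding mcalAs_def mapp_scale mapp_add mapp_mmul i(2) TU'_diag[OF i(1)] UT'_diag[OF i(1)] pw_neg_half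
    using nz nz(4)[of "Suc i"] by (simp add: field_simps del: power_Suc)
qed

lemma calAt_diag: "k < n \<Longrightarrow> mapp n (mcalAt q e D) a k = inverse (qc ^ (k div 2)) * a k"
proof (erule index_cases)
  fix i assume i: "i < D" "k = 2 * i"
  then show ?thesis unfolding mcalAt_def mapp_scale mapp_add mapp_mmul i(2) TU'_diag[OF i(1)] UT'_diag[OF i(1)] pw_neg_half
    using nz by (simp add: field_simps)
next
  fix i assume i: "i < D" "k = 2 * i + 1"
  then have "k div 2 = i" by simp
  then show ?thesis unfolding mcalAt_def mapp_scale mapp_add mapp_mmul i(2) TU'_diag[OF i(1)] UT'_diag[OF i(1)] pw_neg_half
    using nz by (simp add: field_simps qc_def[symmetric])
qed

text \<open>This is X U' = U + 1, the defining relation of U'. It shows that the prescribed matrix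
  of U' belongs to the algebra generated by T, U, X and the inverses.\<close>

lemma X_U': "k < n \<Longrightarrow> opT' (opT (opU' a)) k = opU a k + a k"
proof (erule index_cases')
  assume k: "k = 0"
  show ?thesis unfolding k T'_first using TU'_diag(1)[OF D1, of a] U_even[OF D1, of a] nz by (simp add: field_simps)
next
  fix m assume m: "Suc m < D" "k = 2 * m + 1"
  then have m': "m < D" "2 * m + 2 = 2 * Suc m" by auto
  show ?thesis unfolding m(2) T'_mid[OF m(1)]
    unfolding TU'_diag[OF m'(1)] U_odd[OF m'(1)] m'(2) TU'_diag[OF m(1)]
    using nz nz(4)[of "Suc m"] by (simp add: field_simps del: power_Suc)
next
  fix m assume m: "Suc m < D" "k = 2 * m + 2"
  then have m': "m < D" "2 * m + 2 = 2 * Suc m" by auto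
  show ?thesis unfolding m(2) T'_mid[OF m(1)]
    unfolding TU'_diag[OF m'(1)] m'(2) TU'_diag[OF m(1)] U_even[OF m(1)]
    using nz nz(4)[of "Suc m"] by (simp add: field_simps del: power_Suc)
next
  fix m assume m: "Suc m = D" "k = 2 * m + 1"
  then have m': "m < D" by auto
  have "qc ^ Suc m = h * h" using m h_sq by simp
  then show ?thesis unfolding m(2) T'_last[OF m(1)] TU'_diag[OF m'] U_odd[OF m']
    using nz by (simp add: field_simps del: power_Suc)
qed

lemma opU'_inverse: "k < n \<Longrightarrow> mapp n (minv n (mX q e D)) (\<lambda>k. opU a k + a k) k = opU' a k"
proof -
  assume k: "k < n"
  have "mapp n (minv n (mX q e D)) (\<lambda>k. opU a k + a k) = mapp n (minv n (mX q e D)) (opT' (opT (opU' a)))"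
    by (rule mapp_cong) (simp add: X_U')
  also have "\<dots> = mapp n mTinv (opT (opU' a))"
    unfolding opXinv by (rule mapp_cong) (simp add: T'inv_T')
  finally show ?thesis using k by (simp add: Tinv_T)
qed

section \<open>Invariant subspaces and irreducibility\<close>

definition unit_vec :: "nat \<Rightarrow> nat \<Rightarrow> complex" where
  "unit_vec k = (\<lambda>j. if j = k then 1 else 0)"

text \<open>\<open>K\<close> stands for the coefficient sequences whose vectors lie in a submodule;
  \<open>Kcong\<close> expresses that entries from \<open>n\<close> onwards do not matter.\<close>

context
  fixes K :: "(nat \<Rightarrow> complex) set"
  assumes K0: "(\<lambda>_. 0) \<in> K"
    and Kadd: "\<And>a b. a \<in> K \<Longrightarrow> b \<in> K \<Longrightarrow> (\<lambda>k. a k + b k) \<in> K"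
    and Kscale: "\<And>a c. a \<in> K \<Longrightarrow> (\<lambda>k. c * a k) \<in> K"
    and Kcong: "\<And>a b. a \<in> K \<Longrightarrow> (\<And>k. k < n \<Longrightarrow> a k = b k) \<Longrightarrow> b \<in> K"
    and Kgen: "\<And>M a. M \<in> {mT q e D, minv n (mT q e D), mU q D, mX q e D, minv n (mX q e D)} \<Longrightarrow> a \<in> K \<Longrightarrow> mapp n M a \<in> K"
begin

lemma K_T: "a \<in> K \<Longrightarrow> opT a \<in> K"
  and K_U: "a \<in> K \<Longrightarrow> opU a \<in> K"
  by (rule Kgen; simp)+

lemma K_T': "a \<in> K \<Longrightarrow> opT' a \<in> K"
proof -
  assume a: "a \<in> K"
  have "mapp n (minv n (mT q e D)) a \<in> K" by (rule Kgen[OF _ a]) simp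
  then have "mapp n (mX q e D) (mapp n (minv n (mT q e D)) a) \<in> K" by (rule Kgen[rotated]) simp
  moreover have "mapp n (mX q e D) (mapp n (minv n (mT q e D)) a) = opT' a"
    unfolding opX minv_T by (rule mapp_cong) (simp add: T_Tinv)
  ultimately show ?thesis by simp
qed

lemma K_U': "a \<in> K \<Longrightarrow> opU' a \<in> K"
proof -
  assume a: "a \<in> K"
  then have "(\<lambda>k. opU a k + a k) \<in> K" by (intro Kadd K_U)
  then have "mapp n (minv n (mX q e D)) (\<lambda>k. opU a k + a k) \<in> K" by (rule Kgen[rotated]) simp
  then show ?thesis by (rule Kcong) (rule opU'_inverse)
qed

lemma K_calAs: "a \<in> K \<Longrightarrow> mapp n (mcalAs q e D) a \<in> K"
  and K_calAt: "a \<in> K \<Longrightarrow> mapp n (mcalAt q e D) a \<in> K"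
proof -
  assume a: "a \<in> K"
  have "(\<lambda>k. \<i> * pw q (- real D / 2) * (opT (opU' a) k + c * opU (opT' a) k)) \<in> K" for c
    by (intro Kscale Kadd K_T K_U K_T' K_U' a)
  note comb = this
  have "mapp n (mcalAs q e D) a = (\<lambda>k. \<i> * pw q (- real D / 2) * (opT (opU' a) k + 1 * opU (opT' a) k))"
    by (rule ext) (simp only: mcalAs_def mapp_scale mapp_add mapp_mmul mult_1)
  then show "mapp n (mcalAs q e D) a \<in> K" using comb[of 1] by simp
  have "mapp n (mcalAt q e D) a = (\<lambda>k. \<i> * pw q (- real D / 2) * (opT (opU' a) k + complex_of_real q * opU (opT' a) k))"
    by (rule ext) (simp only: mcalAt_def mapp_scale mapp_add mapp_mmul)
  then show "mapp n (mcalAt q e D) a \<in> K" using comb[of "complex_of_real q"] by simp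
qed

text \<open>The two diagonal operators jointly have pairwise distinct eigenvalue pairs, so a vector of
  minimal support is a multiple of a coordinate vector.\<close>

lemma K_unit:
  assumes "a \<in> K" "k < n" "a k \<noteq> 0"
  shows "unit_vec k \<in> K"
  using assms
proof (induction "card {j. j < n \<and> a j \<noteq> 0}" arbitrary: a rule: less_induct)
  case less
  show ?case
  proof (cases "\<exists>j<n. j \<noteq> k \<and> a j \<noteq> 0")
    case True
    then obtain j where j: "j < n" "j \<noteq> k" "a j \<noteq> 0" by auto
    obtain d M where d: "\<And>b i. i < n \<Longrightarrow> mapp n M b i = d i * b i" "mapp n M a \<in> K" "d k \<noteq> d j"
    proof -
      have inv: "inverse (qc ^ r) \<noteq> inverse (qc ^ t)" if "r \<noteq> t" for r t
      proof -
        have "qc ^ r \<noteq> qc ^ t" using qc_pow_neq that by (metis linorder_neqE_nat)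
        then show ?thesis by (simp only: inverse_eq_iff_eq simp_thms)
      qed
      \<comment> \<open>The two exponents add up to the index, so distinct indices are separated by
        at least one of the two operators.\<close>
      have "i = Suc i div 2 + i div 2" for i :: nat by presburger
      then have "Suc k div 2 \<noteq> Suc j div 2 \<or> k div 2 \<noteq> j div 2" using j(2) by metis
      then show thesis
      proof
        assume "Suc k div 2 \<noteq> Suc j div 2"
        then show thesis
          using that[of "mcalAs q e D" "\<lambda>k. inverse (qc ^ (Suc k div 2))"] calAs_diag K_calAs less.prems inv by blast
      next
        assume "k div 2 \<noteq> j div 2"
        then show thesis
          using that[of "mcalAt q e D" "\<lambda>k. inverse (qc ^ (k div 2))"] calAt_diag K_calAt less.prems inv by blast
      qed
    qed
    \<comment> \<open>Subtracting the eigenvalue at \<open>j\<close> kills coordinate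
      \<open>j\<close>, keeps coordinate \<open>k\<close> nonzero and creates no new
      support.\<close>
    define b where "b = (\<lambda>i. mapp n M a i + (- d j) * a i)"
    have bv: "b i = (d i - d j) * a i" if "i < n" for i
      using d(1)[OF that] by (simp add: b_def algebra_simps)
    have "b \<in> K" unfolding b_def using d(2) less.prems(1) by (intro Kadd Kscale)
    moreover have "b k \<noteq> 0" using bv[OF less.prems(2)] d(3) less.prems(3) by simp
    moreover have "{i. i < n \<and> b i \<noteq> 0} \<subset> {i. i < n \<and> a i \<noteq> 0}"
    proof (rule psubsetI)
      show "{i. i < n \<and> b i \<noteq> 0} \<subseteq> {i. i < n \<and> a i \<noteq> 0}"
        using bv by (metis (mono_tags, lifting) Collect_mono mult_zero_right)
      have "b j = 0" using bv[OF j(1)] by simp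
      then show "{i. i < n \<and> b i \<noteq> 0} \<noteq> {i. i < n \<and> a i \<noteq> 0}" using j(1,3) by blast
    qed
    then have "card {i. i < n \<and> b i \<noteq> 0} < card {i. i < n \<and> a i \<noteq> 0}"
      by (intro psubset_card_mono) auto
    ultimately show ?thesis using less.hyps less.prems(2) by blast
  next
    case False
    have "(\<lambda>i. inverse (a k) * a i) \<in> K" using less.prems by (intro Kscale)
    then show ?thesis by (rule Kcong) (use False less.prems in \<open>auto simp: unit_vec_def\<close>)
  qed
qed

text \<open>Neighbouring indices share a block of T or of T'. The off-diagonal entries of the latter
  are multiples of 1 - q^i and q^i - q^D with 0 < i < D, hence nonzero.\<close>

lemma K_step:
  assumes k: "Suc k < n"
  shows "unit_vec k \<in> K \<longleftrightarrow> unit_vec (Suc k) \<in> K"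
proof -
  have "k < n" using k by simp
  then show ?thesis
  proof (rule index_cases)
    fix i assume i: "i < D" "k = 2 * i"
    have "opT (unit_vec k) (Suc k) \<noteq> 0" "opT (unit_vec (Suc k)) k \<noteq> 0"
      using T_odd[OF i(1), of "unit_vec k"] T_even[OF i(1), of "unit_vec (Suc k)"] nz i(2)
      by (auto simp: unit_vec_def)
    then show ?thesis using K_T K_unit k \<open>k < n\<close> by blast
  next
    fix m assume m: "m < D" "k = 2 * m + 1"
    then have m': "Suc m < D" using k by simp
    have "qc ^ Suc m \<noteq> qc ^ D" "qc ^ Suc m \<noteq> 1" using qc_pow_neq[OF m'] qc_pow_neq[of 0 "Suc m"] by auto
    then have "opT' (unit_vec k) (Suc k) \<noteq> 0" "opT' (unit_vec (Suc k)) k \<noteq> 0"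
      using T'_mid[OF m', of "unit_vec k"] T'_mid[OF m', of "unit_vec (Suc k)"] nz m(2) h_sq
      by (auto simp: unit_vec_def simp del: power_Suc)
    then show ?thesis using K_T' K_unit k \<open>k < n\<close> by blast
  qed
qed

lemma coordinates_irreducible:
  assumes a: "a \<in> K" "k < n" "a k \<noteq> 0"
  shows "b \<in> K"
proof -
  have down: "unit_vec 0 \<in> K" if "unit_vec j \<in> K" "j < n" for j
    using that by (induction j) (use K_step in auto)
  have up: "j < n \<Longrightarrow> unit_vec j \<in> K" for j
    by (induction j) (use K_step down[OF K_unit[OF a] a(2)] in auto)
  have "(\<lambda>j. if j < m then b j else 0) \<in> K" if "m \<le> n" for m
    using that
  proof (induction m)
    case 0
    then show ?case using K0 by simp
  next
    case (Suc m)
    then have "(\<lambda>j. (if j < m then b j else 0) + b m * unit_vec m j) \<in> K"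
      by (intro Kadd Kscale up) auto
    then show ?case by (rule Kcong) (auto simp: unit_vec_def less_Suc_eq)
  qed
  then have "(\<lambda>j. if j < n then b j else 0) \<in> K" by simp
  then show ?thesis by (rule Kcong) simp
qed

end

end

section \<open>The action on W\<close>

context nil_daha
begin

lemma alpha_eq: "complex_of_real ((q powr e - 1) / (1 - q)) = (g * g - 1) / (1 - qc)"
  by (simp add: g_sq qc_def)

text \<open>Half of the exponent D + e in \<beta> cancels against \<tau>, leaving q^((D+e)/2) = h
  g.\<close>

lemma beta_tau_eq: "complex_of_real (q powr (real D + e) / (q - 1))
    * (\<i> * complex_of_real (q powr (- (real D + e) / 2))) = \<i> * (h * g) / (qc - 1)"
proof -
  have "q powr (real D + e) * q powr (- (real D + e) / 2) = q powr (real D / 2) * q powr (e / 2)"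
    unfolding powr_add[symmetric] by (simp add: field_simps)
  then have "complex_of_real (q powr (real D + e)) * complex_of_real (q powr (- (real D + e) / 2)) = h * g"
    unfolding h_def g_def pw_def of_real_mult[symmetric] by (simp only:)
  moreover have "complex_of_real (A / (q - 1)) * (\<i> * complex_of_real B)
      = \<i> * (complex_of_real A * complex_of_real B) / (qc - 1)" for A B
    by (simp add: qc_def)
  ultimately show ?thesis by (simp only:)
qed

lemma powr_neg_nat: "complex_of_real (q powr (- real i)) = inverse (qc ^ i)"
  using pw_minus[of "real i"] by (simp add: pw_nat) (simp add: pw_def)

end

context polar_flag
begin

lemma cls_less: "y \<in> V \<Longrightarrow> cls y < 2 * D"
  by (cases rule: class_cases[of y]) auto

context
  fixes C assumes C: "C = {c \<in> V. z \<subseteq> c}"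
begin

lemma setdist_C: "y \<in> V \<Longrightarrow> dp_setdist TI C y = cls y div 2"
  unfolding C by (rule dp_setdist_cls)

text \<open>The dictionary between W and geometry: ceiling and floor of half the class index pick
  out exactly one basis vector that is nonzero at \<open>y\<close>.\<close>

lemma Wvec_cls: "Wvec TI x C a y = (if y \<in> V then a (cls y) else 0)"
proof (cases "y \<in> V")
  case True
  have "cbasis TI x C j y = (if j = cls y then 1 else 0)" for j
  proof -
    have "y \<in> (if even j then dp_Cminus TI x C (j div 2) else dp_Cplus TI x C (j div 2)) \<longleftrightarrow>
      (if even j then Suc (cls y) div 2 = j div 2 else Suc (cls y) div 2 = Suc (j div 2)) \<and> cls y div 2 = j div 2"
      using True dp_dist_cls[OF True] setdist_C[OF True]
      by (simp add: dp_Cminus_def dp_Cplus_def dp_Gamma_def dp_Ci_def)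
    also have "\<dots> \<longleftrightarrow> j = cls y"
    proof (cases "even j")
      case True
      then obtain m where m: "j = 2 * m" by (rule evenE)
      have "Suc (cls y) div 2 = m \<and> cls y div 2 = m \<longleftrightarrow> 2 * m = cls y" by presburger
      then show ?thesis unfolding m by simp
    next
      case False
      then obtain m where m: "j = 2 * m + 1" by (rule oddE)
      have "Suc (cls y) div 2 = Suc m \<and> cls y div 2 = m \<longleftrightarrow> 2 * m + 1 = cls y" by presburger
      then show ?thesis unfolding m by simp
    qed
    finally show ?thesis unfolding cbasis_def by (simp add: indicator_def)
  qed
  then show ?thesis using True cls_less[OF True] by (simp add: Wvec_def if_distrib[of "\<lambda>c. _ * c"] cong: if_cong)
next
  case False
  then show ?thesis
    by (auto simp: Wvec_def cbasis_def dp_Cminus_def dp_Cplus_def dp_Gamma_def indicator_def intro!: sum.neutral)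
qed

lemma acts_onI:
  assumes "\<And>a y. y \<notin> V \<Longrightarrow> opr (Wvec TI x C a) y = 0"
    and "\<And>a y. y \<in> V \<Longrightarrow> opr (Wvec TI x C a) y = mapp (2 * D) M a (cls y)"
  shows "acts_on_W_by TI x C opr M"
  unfolding acts_on_W_by_def by (intro allI ext) (simp add: Wvec_cls[of "mapp _ _ _"] assms)

context
  fixes e assumes s: "real s = real CARD('k) powr e"
begin

interpretation nd: nil_daha "real CARD('k)" e D
  using card_field_ge_2[where 'k='k] D_pos by unfold_locales auto

lemma qc: "of_nat CARD('k) = nd.qc"
  unfolding nd.qc_def by simp

lemma gg: "of_nat s = nd.g * nd.g"
  unfolding nd.g_sq by (simp flip: s)

lemma qbr: "qbr CARD('k) m = nd.br m"
  by (simp only: qbr_def nd.br_def qc)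

lemma adj_op_acts:
  "acts_on_W_by TI x C (adj_op TI) (\<lambda>i j. complex_of_real ((real CARD('k) powr e - 1) / (1 - real CARD('k))) * mid (2 * D) i j
    + complex_of_real (real CARD('k) powr (real D + e) / (real CARD('k) - 1))
      * (\<i> * complex_of_real (real CARD('k) powr (- (real D + e) / 2))) * mcalA (real CARD('k)) e D i j)"
proof (rule acts_onI)
  fix a y assume "y \<notin> V"
  then show "adj_op TI (Wvec TI x C a) y = 0" by (simp add: adj_op_def dp_adj_def)
next
  fix a y assume y: "y \<in> V"
  have "adj_op TI (Wvec TI x C a) y = (\<Sum>w | dp_adj TI y w. a (cls w))"
    unfolding adj_op_def by (intro sum.cong) (auto simp: Wvec_cls dp_adj_def)
  also have "\<dots> = (nd.g * nd.g - 1) / (1 - nd.qc) * a (cls y)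
      + \<i> * (nd.h * nd.g) / (nd.qc - 1) * mapp (2 * D) (mcalA (real CARD('k)) e D) a (cls y)"
  \<comment> \<open>Vertices of \<open>C_i^-\<close> read off row 2i and vertices of
    \<open>C_i^+\<close> row 2i+1; with \<open>s = g * g\<close> the neighbour sum and the row agree
    term by term.\<close>
  proof (cases rule: class_cases[OF y])
    case (1 i)
    show ?thesis
      unfolding adj_sum_minus(2)[OF y 1(3,4), of a] 1(2) nd.row_even[OF 1(1), of a] qc gg qbr ..
  next
    case (2 i)
    show ?thesis
      unfolding adj_sum_plus(2)[OF y 2(3,4), of a] 2(2) nd.row_odd[OF 2(1), of a] qc gg qbr ..
  qed
  finally show "adj_op TI (Wvec TI x C a) y = mapp (2 * D) (\<lambda>i j. complex_of_real ((real CARD('k) powr e - 1) / (1 - real CARD('k))) * mid (2 * D) i j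
    + complex_of_real (real CARD('k) powr (real D + e) / (real CARD('k) - 1))
      * (\<i> * complex_of_real (real CARD('k) powr (- (real D + e) / 2))) * mcalA (real CARD('k)) e D i j) a (cls y)"
    unfolding mapp_lin nd.alpha_eq nd.beta_tau_eq mapp_mid if_P[OF cls_less[OF y]] .
qed

text \<open>Both sides are affine in \<open>b\<close> and \<open>c\<close>, and at class k the
  powers of q agree, so the scalars of the theorem can be inserted at the end.\<close>

lemma dual_adj_op_acts:
  "acts_on_W_by TI x C (dual_adj_op TI x b c)
    (\<lambda>i j. complex_of_real b * mid (2 * D) i j + complex_of_real c * mcalAs (real CARD('k)) e D i j)"
proof (rule acts_onI)
  fix a y assume "y \<notin> V"
  then show "dual_adj_op TI x b c (Wvec TI x C a) y = 0" by (simp add: dual_adj_op_def Wvec_cls)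
next
  fix a y assume y: "y \<in> V"
  note k = cls_less[OF y]
  let ?d = "Suc (cls y) div 2"
  have "dual_adj_op TI x b c (Wvec TI x C a) y
    = (\<Sum>i\<le>D. if i = ?d then complex_of_real (b + c * real CARD('k) powr (- real i)) * a (cls y) else 0)"
    unfolding dual_adj_op_def using y
    by (intro sum.cong) (auto simp: Wvec_cls dp_Gamma_def dp_dist_cls indicator_def)
  also have "\<dots> = complex_of_real (b + c * real CARD('k) powr (- real ?d)) * a (cls y)"
    using k by simp
  finally show "dual_adj_op TI x b c (Wvec TI x C a) y = mapp (2 * D)
    (\<lambda>i j. complex_of_real b * mid (2 * D) i j + complex_of_real c * mcalAs (real CARD('k)) e D i j) a (cls y)"
    unfolding mapp_lin nd.calAs_diag[OF k] mapp_mid if_P[OF k]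
    by (simp only: of_real_add of_real_mult nd.powr_neg_nat distrib_right mult.assoc)
qed

lemma dual_adj_op_C_acts:
  "acts_on_W_by TI x C (dual_adj_op_C TI C b c)
    (\<lambda>i j. complex_of_real b * mid (2 * D) i j + complex_of_real c * mcalAt (real CARD('k)) e D i j)"
proof (rule acts_onI)
  fix a y assume "y \<notin> V"
  then show "dual_adj_op_C TI C b c (Wvec TI x C a) y = 0" by (simp add: dual_adj_op_C_def Wvec_cls)
next
  fix a y assume y: "y \<in> V"
  note k = cls_less[OF y]
  let ?d = "cls y div 2"
  have "dual_adj_op_C TI C b c (Wvec TI x C a) y
    = (\<Sum>i<D. if i = ?d then complex_of_real (b + c * real CARD('k) powr (- real i)) * a (cls y) else 0)"
    unfolding dual_adj_op_C_def using y
    by (intro sum.cong) (auto simp: Wvec_cls dp_Ci_def setdist_C indicator_def)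
  also have "\<dots> = complex_of_real (b + c * real CARD('k) powr (- real ?d)) * a (cls y)"
    using k by simp
  finally show "dual_adj_op_C TI C b c (Wvec TI x C a) y = mapp (2 * D)
    (\<lambda>i j. complex_of_real b * mid (2 * D) i j + complex_of_real c * mcalAt (real CARD('k)) e D i j) a (cls y)"
    unfolding mapp_lin nd.calAt_diag[OF k] mapp_mid if_P[OF k]
    by (simp only: of_real_add of_real_mult nd.powr_neg_nat distrib_right mult.assoc)
qed

text \<open>A submodule is pulled back along \<open>Wvec\<close> to coefficient sequences. A nonzero
  vector of it has a nonzero coefficient at the class of some vertex, which starts the coordinate
  argument.\<close>

lemma irreducible: "Hbar_irreducible_on_W TI x C (real CARD('k)) e"
  unfolding Hbar_irreducible_on_W_def Let_def
proof (intro allI impI, elim conjE)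
  fix S :: "(('k^'n) set \<Rightarrow> complex) set"
  assume sub: "S \<subseteq> Wspace TI x C" and S0: "(\<lambda>_. 0) \<in> S"
    and Sadd: "\<forall>v\<in>S. \<forall>w\<in>S. (\<lambda>U. v U + w U) \<in> S"
    and Sscale: "\<forall>c. \<forall>v\<in>S. (\<lambda>U. c * v U) \<in> S"
    and gens: "\<forall>M\<in>{mT (real CARD('k)) e D, minv (2 * D) (mT (real CARD('k)) e D), mU (real CARD('k)) D,
       mX (real CARD('k)) e D, minv (2 * D) (mX (real CARD('k)) e D)}.
       \<forall>a. Wvec TI x C a \<in> S \<longrightarrow> Wvec TI x C (mapp (2 * D) M a) \<in> S"
  define K where "K = {a. Wvec TI x C a \<in> S}"
  show "S = {\<lambda>_. 0} \<or> S = Wspace TI x C"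
  proof (cases "S = {\<lambda>_. 0}")
    case False
    then obtain v where v: "v \<in> S" "v \<noteq> (\<lambda>_. 0)" using S0 by blast
    then obtain a where a: "v = Wvec TI x C a" using sub unfolding Wspace_def by blast
    have "\<exists>y\<in>V. a (cls y) \<noteq> 0"
    proof (rule ccontr)
      assume "\<not> ?thesis"
      then have "v = (\<lambda>_. 0)" unfolding a by (intro ext) (simp add: Wvec_cls)
      then show False using v by simp
    qed
    then obtain y where y: "y \<in> V" "a (cls y) \<noteq> 0" by auto
    have "b \<in> K" for b
    proof (rule nd.coordinates_irreducible[of K a "cls y"])
      have "Wvec TI x C (\<lambda>_. 0) = (\<lambda>_. 0)" by (intro ext) (simp add: Wvec_cls)
      then show "(\<lambda>_. 0) \<in> K" using S0 by (simp add: K_def)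
    next
      fix a b assume "a \<in> K" "b \<in> K"
      moreover have "Wvec TI x C (\<lambda>k. a k + b k) = (\<lambda>U. Wvec TI x C a U + Wvec TI x C b U)"
        by (intro ext) (simp add: Wvec_cls)
      ultimately show "(\<lambda>k. a k + b k) \<in> K" using Sadd by (simp add: K_def)
    next
      fix a c assume "a \<in> K"
      moreover have "Wvec TI x C (\<lambda>k. c * a k) = (\<lambda>U. c * Wvec TI x C a U)"
        by (intro ext) (simp add: Wvec_cls)
      ultimately show "(\<lambda>k. c * a k) \<in> K" using Sscale by (simp add: K_def)
    next
      fix a b assume "a \<in> K" "\<And>k. k < 2 * D \<Longrightarrow> a k = b k"
      moreover from this have "Wvec TI x C a = Wvec TI x C b"
        by (intro ext) (simp add: Wvec_cls cls_less)
      ultimately show "b \<in> K" by (simp add: K_def)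
    next
      fix M a assume "M \<in> {mT (real CARD('k)) e D, minv (2 * D) (mT (real CARD('k)) e D), mU (real CARD('k)) D,
       mX (real CARD('k)) e D, minv (2 * D) (mX (real CARD('k)) e D)}" "a \<in> K"
      then show "mapp (2 * D) M a \<in> K" using gens unfolding K_def by blast
    next
      show "a \<in> K" using v a by (simp add: K_def)
      show "cls y < 2 * D" by (rule cls_less[OF y(1)])
      show "a (cls y) \<noteq> 0" by (rule y(2))
    qed
    then have "Wspace TI x C \<subseteq> S" unfolding Wspace_def K_def by blast
    then show ?thesis using sub by blast
  qed simp
qed

end

end

end

theorem theorem8p13:
  fixes TI :: "((('k::{field,finite})^('n::finite)) set \<Rightarrow> bool)"
    and e :: real and x :: "('k^'n) set" and C :: "('k^'n) set set"
  assumes setting: "dual_polar_setting TI e"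
    and D3: "witt TI \<ge> 3"
    and clique: "dp_max_clique TI C"
    and xC: "x \<in> C"
  shows
    "let q = real CARD('k); D = witt TI;
         \<alpha> = (q powr e - 1) / (1 - q);
         \<beta> = q powr (real D + e) / (q - 1);
         \<tau> = \<i> * complex_of_real (q powr (- (real D + e) / 2));
         \<alpha>s = q * (1 + q powr (real D + e - 2)) / (1 - q);
         \<beta>s = q * (1 + q powr (real D + e - 2)) * (1 + q powr (real D + e - 1))
               / ((q - 1) * (1 + q powr (e - 1)));
         \<alpha>t = \<alpha>s;
         \<beta>t = (1 + q powr (e - 1)) / (1 + q powr e) * \<beta>s
     in acts_on_W_by TI x C (adj_op TI)
          (\<lambda>i j. complex_of_real \<alpha> * mid (2 * D) i j + complex_of_real \<beta> * \<tau> * mcalA q e D i j)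
      \<and> acts_on_W_by TI x C (dual_adj_op TI x \<alpha>s \<beta>s)
          (\<lambda>i j. complex_of_real \<alpha>s * mid (2 * D) i j + complex_of_real \<beta>s * mcalAs q e D i j)
      \<and> acts_on_W_by TI x C (dual_adj_op_C TI C \<alpha>t \<beta>t)
          (\<lambda>i j. complex_of_real \<alpha>t * mid (2 * D) i j + complex_of_real \<beta>t * mcalAt q e D i j)
      \<and> Hbar_irreducible_on_W TI x C q e"
proof -
  have D: "witt TI > 0" using D3 by simp
  obtain f sing s where s: "real s = real CARD('k) powr e" and po: "polar_order f sing TI s"
    using dual_polar_order[OF setting D] by blast
  interpret polar_order f sing TI s by (rule po)
  obtain z where z: "TI z" "Suc (vec.dim z) = witt TI" "z \<subseteq> x" and C: "C = {c \<in> dp_vertices TI. z \<subseteq> c}"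
    using max_clique_pencil[OF clique xC D] by metis
  interpret polar_flag f sing TI s x z
    using xC C z by unfold_locales auto
  show ?thesis
    unfolding Let_def
    using adj_op_acts[OF C s] dual_adj_op_acts[OF C s] dual_adj_op_C_acts[OF C s] irreducible[OF C s]
    by blast
qed

end
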